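(* Let $K$ be a field of positive prime characteristic $p$ with $[K:K^p]=b<\infty$, let $\mathfrak m$ be the maximal ideal of the ring $S=K[\![x_1,\dots,x_n]\!]$, and let $f$ be a nonzero element of $\mathfrak m$. If $d$ is a positive integer and $\Re=S[\![y]\!]/(y^{p^d}+f)$, then $$\mathbb S(\Re)=\frac{\sharp(F_*^d(\Re),\Re)}{b^dp^{nd}}.$$
   Context: $y$ is a new variable over $S$. For a ring $A$ of characteristic $p$ and $e\ge1$, $F_*^e(A)$ is the $A$-module equal to $A$ as an abelian group (the element corresponding to $m$ is written $F_*^e(m)$) with $aF_*^e(m)=F_*^e(a^{p^e}m)$. For a finitely generated module $M$ over a Noetherian local ring $A$, $\sharp(M,A)$ denotes the maximal rank of a free direct summand of $M$, i.e. the unique nonnegative integer $a$ with $M\cong A^a\oplus N$ where $N$ has no nonzero free direct summand. F-signature: let $(A,\mathfrak n,k)$ be a Noetherian local ring of prime characteristic $p$ and dimension $D$ that is F-finite (i.e. $F_*^1(A)$ is a finitely generated $A$-module). With $\alpha(A)=\log_p[k:k^p]$, the F-signature is $\mathbb S(A)=\lim_{e\to\infty}\sharp(F_*^e(A),A)/p^{e(D+\alpha(A))}$. *)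

theory Defs
  imports Complex_Main "HOL-Library.Extended_Nat" "HOL-Algebra.Algebra"
begin

section \<open>Power series rings\<close>

definition exponents :: "'v set \<Rightarrow> ('v \<Rightarrow> nat) set" where
  "exponents V = {m. \<forall>v. v \<notin> V \<longrightarrow> m v = 0}"

text \<open>The ring of formal power series over \<open>R\<close> in the finite set of variables \<open>V\<close>. A series is
  the extensional function that assigns to each exponent vector its coefficient.\<close>

definition power_series_ring ::
    "'v set \<Rightarrow> ('a, 'm) ring_scheme \<Rightarrow> (('v \<Rightarrow> nat) \<Rightarrow> 'a) ring" where
  "power_series_ring V R =
    \<lparr> carrier = exponents V \<rightarrow>\<^sub>E carrier R,
      monoid.mult = (\<lambda>s t. \<lambda>m\<in>exponents V.
        \<Oplus>\<^bsub>R\<^esub>k\<in>{k. \<forall>v. k v \<le> m v}. s k \<otimes>\<^bsub>R\<^esub> t (\<lambda>v. m v - k v)),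
      monoid.one = (\<lambda>m\<in>exponents V. if m = (\<lambda>_. 0) then \<one>\<^bsub>R\<^esub> else \<zero>\<^bsub>R\<^esub>),
      ring.zero = (\<lambda>m\<in>exponents V. \<zero>\<^bsub>R\<^esub>),
      ring.add = (\<lambda>s t. \<lambda>m\<in>exponents V. s m \<oplus>\<^bsub>R\<^esub> t m) \<rparr>"

definition ps_const :: "'v set \<Rightarrow> ('a, 'm) ring_scheme \<Rightarrow> 'a \<Rightarrow> ('v \<Rightarrow> nat) \<Rightarrow> 'a" where
  "ps_const V R a = (\<lambda>m\<in>exponents V. if m = (\<lambda>_. 0) then a else \<zero>\<^bsub>R\<^esub>)"

definition ps_var :: "'v set \<Rightarrow> ('a, 'm) ring_scheme \<Rightarrow> 'v \<Rightarrow> ('v \<Rightarrow> nat) \<Rightarrow> 'a" where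
  "ps_var V R v = (\<lambda>m\<in>exponents V. if m = (\<lambda>_. 0)(v := 1) then \<one>\<^bsub>R\<^esub> else \<zero>\<^bsub>R\<^esub>)"


section \<open>Free direct summands\<close>

definition module_iso ::
    "('a, 'm) ring_scheme \<Rightarrow> ('a, 'b) module \<Rightarrow> ('a, 'c) module \<Rightarrow> ('b \<Rightarrow> 'c) set" where
  "module_iso A M N = {h. bij_betw h (carrier M) (carrier N) \<and>
     (\<forall>x\<in>carrier M. \<forall>y\<in>carrier M. h (x \<oplus>\<^bsub>M\<^esub> y) = h x \<oplus>\<^bsub>N\<^esub> h y) \<and>
     (\<forall>a\<in>carrier A. \<forall>x\<in>carrier M. h (a \<odot>\<^bsub>M\<^esub> x) = a \<odot>\<^bsub>N\<^esub> h x)}"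

text \<open>The record of modules extends that of rings. In the next two definitions its fields
  \<open>mult\<close> and \<open>one\<close> carry no information.\<close>

definition free_module :: "('a, 'm) ring_scheme \<Rightarrow> nat \<Rightarrow> ('a, nat \<Rightarrow> 'a) module" where
  "free_module A r =
    \<lparr> carrier = {..<r} \<rightarrow>\<^sub>E carrier A,
      monoid.mult = undefined, monoid.one = undefined,
      ring.zero = (\<lambda>i\<in>{..<r}. \<zero>\<^bsub>A\<^esub>),
      ring.add = (\<lambda>x y. \<lambda>i\<in>{..<r}. x i \<oplus>\<^bsub>A\<^esub> y i),
      module.smult = (\<lambda>a x. \<lambda>i\<in>{..<r}. a \<otimes>\<^bsub>A\<^esub> x i) \<rparr>"

definition module_sum :: "('a, 'b) module \<Rightarrow> ('a, 'c) module \<Rightarrow> ('a, 'b \<times> 'c) module" where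
  "module_sum M N =
    \<lparr> carrier = carrier M \<times> carrier N,
      monoid.mult = undefined, monoid.one = undefined,
      ring.zero = (\<zero>\<^bsub>M\<^esub>, \<zero>\<^bsub>N\<^esub>),
      ring.add = (\<lambda>(x, y) (x', y'). (x \<oplus>\<^bsub>M\<^esub> x', y \<oplus>\<^bsub>N\<^esub> y')),
      module.smult = (\<lambda>a (x, y). (a \<odot>\<^bsub>M\<^esub> x, a \<odot>\<^bsub>N\<^esub> y)) \<rparr>"

text \<open>A complement \<open>N\<close> of a direct summand of \<open>M\<close> is isomorphic to a submodule of \<open>M\<close>, so it is
  no restriction that the elements of \<open>N\<close> have the same type as those of \<open>M\<close>.\<close>

definition has_free_summand ::
    "('a, 'm) ring_scheme \<Rightarrow> ('a, 'b) module \<Rightarrow> nat \<Rightarrow> bool" where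
  "has_free_summand A M r \<longleftrightarrow>
     (\<exists>N :: ('a, 'b) module. module A N \<and>
        module_iso A M (module_sum (free_module A r) N) \<noteq> {})"

text \<open>\<open>\<sharp>(M, A)\<close>. For \<open>M\<close> finitely generated over a Noetherian local ring \<open>A\<close>, the ranks of the
  free direct summands of \<open>M\<close> are bounded, so that the maximum exists.\<close>

definition max_free_rank :: "('a, 'b) module \<Rightarrow> ('a, 'm) ring_scheme \<Rightarrow> nat" where
  "max_free_rank M A = (GREATEST r. has_free_summand A M r)"


section \<open>F-signature\<close>

text \<open>\<open>F\<^sub>*\<^sup>e(A)\<close> for a ring \<open>A\<close> of characteristic \<open>p\<close>.\<close>

definition frobenius_pushforward ::
    "nat \<Rightarrow> nat \<Rightarrow> ('a, 'm) ring_scheme \<Rightarrow> ('a, 'a) module" where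
  "frobenius_pushforward p e A =
    \<lparr> carrier = carrier A, monoid.mult = monoid.mult A, monoid.one = monoid.one A,
      ring.zero = ring.zero A, ring.add = ring.add A,
      module.smult = (\<lambda>a m. (a [^]\<^bsub>A\<^esub> (p ^ e :: nat)) \<otimes>\<^bsub>A\<^esub> m) \<rparr>"

definition krull_dim :: "('a, 'm) ring_scheme \<Rightarrow> enat" where
  "krull_dim A = Sup {enat l | l. \<exists>P. (\<forall>i\<le>l. primeideal (P i) A) \<and> (\<forall>i<l. P i \<subset> P (Suc i))}"

text \<open>Only meaningful for a local ring \<open>A\<close>, whose maximal ideal is unique.\<close>

definition residue_field :: "('a, 'm) ring_scheme \<Rightarrow> 'a set ring" where
  "residue_field A = A Quot (THE M. maximalideal M A)"

definition pth_powers :: "nat \<Rightarrow> ('a, 'm) ring_scheme \<Rightarrow> 'a set" where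
  "pth_powers p k = (\<lambda>x. x [^]\<^bsub>k\<^esub> p) ` carrier k"

definition residue_log_degree :: "nat \<Rightarrow> ('a, 'm) ring_scheme \<Rightarrow> real" where
  "residue_log_degree p A =
     (let k = residue_field A
      in log (real p) (real (ring.dim k (pth_powers p k) (carrier k))))"

definition F_signature_seq :: "nat \<Rightarrow> ('a, 'm) ring_scheme \<Rightarrow> nat \<Rightarrow> real" where
  "F_signature_seq p A e =
     real (max_free_rank (frobenius_pushforward p e A) A) /
     real p powr (real e * (real (the_enat (krull_dim A)) + residue_log_degree p A))"

text \<open>The F-signature of an F-finite Noetherian local ring \<open>A\<close> of prime characteristic \<open>p\<close>.\<close>

definition F_signature :: "nat \<Rightarrow> ('a, 'm) ring_scheme \<Rightarrow> real" where
  "F_signature p A = lim (F_signature_seq p A)"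

end

theory Submission
  imports Defs "HOL-Library.Fun_Lexorder"
begin

text \<open>Put \<open>q = p\<^sup>d\<close>. By Weierstrass division \<open>R\<close> is free over \<open>S\<close> with basis \<open>1, \<eta>, \<dots>, \<eta>\<^bsup>q-1\<^esup>\<close>, where
  \<open>\<eta>\<^sup>q = - f\<close>, so all \<open>q\<close>-th powers of \<open>R\<close> lie in \<open>S\<close>. As \<open>S\<close> is free of rank \<open>c = b p\<^sup>n\<close> over
  \<open>S\<^sup>p\<close>, this makes \<open>F\<^sub>*\<^bsup>e+1\<^esup>(R)\<close> a direct sum of \<open>c\<close> copies of \<open>F\<^sub>*\<^sup>e(R)\<close> for every \<open>e \<ge> d\<close>. Over a
  local ring \<open>\<sharp>\<close> is additive: \<open>M\<close> has a free summand of rank \<open>r\<close> iff there are \<open>r\<close> elements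
  and \<open>r\<close> forms dual to each other, and if \<open>r\<close> is maximal then every form maps the common kernel
  of these forms into the maximal ideal. Hence
  \<open>\<sharp>(F\<^sub>*\<^sup>e(R), R) = c\<^bsup>e-d\<^esup> \<sharp>(F\<^sub>*\<^sup>d(R), R)\<close>, and the sequence defining the F-signature is constant from
  \<open>d\<close> on. Its normalization needs the residue field of \<open>R\<close>, which is \<open>K\<close>, and \<open>dim R = n\<close>. Contraction
  along \<open>S \<subseteq> R\<close> is a bijection on primes because \<open>R\<^sup>q \<subseteq> S\<close>, which reduces the latter to \<open>dim S = n\<close>. The
  bound \<open>dim S \<le> n\<close> is read off from the Hilbert functions of the rings \<open>S/Q\<close>, the number of
  monomials of degree less than \<open>N\<close> that lead no element of \<open>Q\<close>: passing to a larger prime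
  lowers their order of growth.\<close>

text \<open>The range e \<ge> d is dictated by linearity. A scalar a of R acts on
  \<open>F_*^e(R)\<close> as a^(p^e), which for e \<ge> d is an element s of S, and on
  \<open>F_*^(e+1)(R)\<close> as s^p. Expanding every S-coordinate of an element of R along a basis
  of S over S^p is therefore R-linear. The number c is also the base of the normalization: p^(n +
  log_p b) = c, so that c^(e-d) / c^e leaves the constant c^(-d).

  Both estimates of size rest on the same elimination modulo a prime ideal. Modulo the maximal ideal
  of R it shows that an identity matrix which factors through c times a coordinates has at most c
  times a rows; this bounds the rank of c copies of a module of rank a. Modulo the zero ideal of K
  it yields the linear dependence between normal forms that compares the Hilbert functions of two
  primes.

  Since \<sharp> is a greatest number, it has a meaning only where the ranks are bounded; a bound is
  therefore carried along with every rank computation.\<close>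

section \<open>Rearranging finite sums in commutative monoids, groups and ideals\<close>

lemma (in abelian_monoid) finsum_Sigma:
  assumes "finite A" "\<And>a. a \<in> A \<Longrightarrow> finite (B a)"
    and "\<And>a b. a \<in> A \<Longrightarrow> b \<in> B a \<Longrightarrow> f a b \<in> carrier G"
  shows "(\<Oplus>a\<in>A. \<Oplus>b\<in>B a. f a b) = (\<Oplus>x\<in>Sigma A B. f (fst x) (snd x))"
  using assms
proof (induction A rule: finite_induct)
  case (insert a A)
  have split: "Sigma (insert a A) B = Pair a ` B a \<union> Sigma A B"
    by auto
  have "(\<Oplus>x\<in>Pair a ` B a. f (fst x) (snd x)) = (\<Oplus>b\<in>B a. f a b)"
    by (subst finsum_reindex) (auto simp: inj_on_def insert.prems)
  then have "(\<Oplus>x\<in>Sigma (insert a A) B. f (fst x) (snd x)) =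
      (\<Oplus>b\<in>B a. f a b) \<oplus> (\<Oplus>x\<in>Sigma A B. f (fst x) (snd x))"
    unfolding split using insert
    by (subst finsum_Un_disjoint) (auto intro!: finite_SigmaI)
  then show ?case
    using insert by (subst finsum_insert) auto
qed simp

lemma (in abelian_monoid) finsum_bij:
  assumes "bij_betw h A B" "\<And>b. b \<in> B \<Longrightarrow> f b \<in> carrier G"
  shows "(\<Oplus>a\<in>A. f (h a)) = (\<Oplus>b\<in>B. f b)"
  using finsum_reindex[of f h A] assms by (auto simp: bij_betw_def)

lemma (in abelian_monoid) finsum_swap:
  assumes "finite A" "finite B"
    and "\<And>a b. a \<in> A \<Longrightarrow> b \<in> B \<Longrightarrow> f a b \<in> carrier G"
  shows "(\<Oplus>a\<in>A. \<Oplus>b\<in>B. f a b) = (\<Oplus>b\<in>B. \<Oplus>a\<in>A. f a b)"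
proof -
  have "(\<Oplus>x\<in>A \<times> B. f (fst x) (snd x)) = (\<Oplus>x\<in>B \<times> A. f (snd x) (fst x))"
    using finsum_bij[of "prod.swap" "B \<times> A" "A \<times> B" "\<lambda>x. f (fst x) (snd x)"] assms
    by (auto simp: bij_betw_def inj_on_def product_swap)
  then show ?thesis
    using finsum_Sigma[of A "\<lambda>_. B" f] finsum_Sigma[of B "\<lambda>_. A" "\<lambda>b a. f a b"] assms by simp
qed

lemma (in abelian_monoid) finsum_neutral_right:
  assumes "finite A" "B \<subseteq> A" "\<And>a. a \<in> A - B \<Longrightarrow> f a = \<zero>" "\<And>a. a \<in> B \<Longrightarrow> f a \<in> carrier G"
  shows "finsum G f A = finsum G f B"
proof -
  have "f a \<in> carrier G" if "a \<in> A" for a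
    using assms that by (cases "a \<in> B") auto
  then show ?thesis
    by (intro add.finprod_mono_neutral_cong_right) (use assms in auto)
qed

lemma (in abelian_monoid) finsum_single:
  assumes "finite A" "i \<in> A" "\<And>a. a \<in> A \<Longrightarrow> a \<noteq> i \<Longrightarrow> f a = \<zero>" "f i \<in> carrier G"
  shows "finsum G f A = f i"
  using finsum_neutral_right[of A "{i}" f] assms by auto

lemma (in abelian_monoid) finsum_zeroI:
  assumes "\<And>a. a \<in> A \<Longrightarrow> f a = \<zero>"
  shows "finsum G f A = \<zero>"
  using add.finprod_one_eqI assms by blast

lemma (in abelian_group) finsum_minus:
  assumes "finite A" "f \<in> A \<rightarrow> carrier G"
  shows "(\<Oplus>a\<in>A. \<ominus> f a) = \<ominus> (\<Oplus>a\<in>A. f a)"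
  using assms
proof (induction A rule: finite_induct)
  case empty
  have "\<zero> \<oplus> \<zero> = \<zero>"
    by simp
  then have "\<ominus> \<zero> = \<zero>"
    by (intro minus_equality) auto
  then show ?case
    by (simp only: finsum_empty)
qed (auto simp: minus_add Pi_iff)

lemma (in ideal) finsum_ideal_closed:
  assumes "\<And>a. a \<in> A \<Longrightarrow> f a \<in> I"
  shows "finsum R f A \<in> I"
proof (cases "finite A")
  case True
  then show ?thesis
    using assms
  proof (induction A rule: finite_induct)
    case (insert a A)
    then have "f a \<in> I" "finsum R f A \<in> I"
      by auto
    moreover have "finsum R f (insert a A) = f a \<oplus> finsum R f A"
      using insert Icarr by (intro finsum_insert) auto
    ultimately show ?case
      by simp
  qed simp
qed simp

section \<open>The binomial theorem and the Frobenius map in characteristic \<open>p\<close>\<close>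

lemma (in cring) binomial_theorem:
  assumes a: "a \<in> carrier R" and b: "b \<in> carrier R"
  shows "(a \<oplus> b) [^] (n::nat) = (\<Oplus>k\<in>{..n}. [(n choose k)] \<cdot> (a [^] k \<otimes> b [^] (n - k)))"
proof (induction n)
  case 0
  then show ?case using a b by simp
next
  case (Suc n)
  define T where "T n k = [(n choose k)] \<cdot> (a [^] k \<otimes> b [^] (n - k))" for n k :: nat
  have T[simp]: "T n k \<in> carrier R" for n k
    using a b by (simp add: T_def)
  have T0: "T (Suc n) 0 = T n 0 \<otimes> b"
    using a b by (simp add: T_def)
  \<comment> \<open>Pascal's rule. For k \<ge> n the exponent \<open>n - Suc k\<close> is truncated,
    but then the coefficient \<open>n choose Suc k\<close> vanishes.\<close>
  have TS: "T (Suc n) (Suc k) = T n k \<otimes> a \<oplus> T n (Suc k) \<otimes> b" for k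
  proof (cases "k < n")
    case True
    then have "b [^] (n - k) = b [^] (n - Suc k) \<otimes> b"
      by (metis Suc_diff_Suc nat_pow_Suc)
    then have *: "a [^] (Suc k) \<otimes> b [^] (n - k) = a [^] Suc k \<otimes> b [^] (n - Suc k) \<otimes> b"
      "a [^] k \<otimes> b [^] (n - k) \<otimes> a = a [^] (Suc k) \<otimes> b [^] (n - k)"
      using a b by (simp_all add: m_ac)
    have "T n k \<otimes> a = [(n choose k)] \<cdot> (a [^] (Suc k) \<otimes> b [^] (n - k))"
      "T n (Suc k) \<otimes> b = [(n choose Suc k)] \<cdot> (a [^] (Suc k) \<otimes> b [^] (n - k))"
      unfolding T_def using a b * by (simp_all add: add_pow_ldistr del: nat_pow_Suc)
    then show ?thesis
      using a b by (simp add: T_def add.nat_pow_mult del: nat_pow_Suc)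
  next
    case False
    then show ?thesis
    proof (cases "k = n")
      case True
      moreover have "n choose Suc n = 0"
        by (simp add: binomial_eq_0)
      ultimately show ?thesis
        using a b by (simp add: T_def del: binomial_eq_0_iff)
    qed (use a b in \<open>simp add: T_def binomial_eq_0\<close>)
  qed
  have Tz: "T n (Suc n) = \<zero>"
    using binomial_eq_0[of n "Suc n"] by (simp add: T_def del: nat_pow_Suc binomial_eq_0_iff)
  have "(\<Oplus>k\<in>{..Suc n}. T (Suc n) k) = (\<Oplus>k\<in>{..n}. T n k \<otimes> a \<oplus> T n (Suc k) \<otimes> b) \<oplus> T n 0 \<otimes> b"
    by (subst finsum_Suc2) (use a b in \<open>auto simp: T0 TS\<close>)
  also have "\<dots> = (\<Oplus>k\<in>{..n}. T n k \<otimes> a) \<oplus> ((\<Oplus>k\<in>{..n}. T n (Suc k) \<otimes> b) \<oplus> T n 0 \<otimes> b)"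
    using a b by (subst finsum_addf) (auto simp: a_ac)
  also have "(\<Oplus>k\<in>{..n}. T n (Suc k) \<otimes> b) \<oplus> T n 0 \<otimes> b = (\<Oplus>k\<in>{..Suc n}. T n k \<otimes> b)"
    by (subst finsum_Suc2) (use a b in auto)
  also have "\<dots> = (\<Oplus>k\<in>{..n}. T n k \<otimes> b)"
    by (subst finsum_Suc) (use a b Tz in auto)
  also have "(\<Oplus>k\<in>{..n}. T n k \<otimes> a) \<oplus> (\<Oplus>k\<in>{..n}. T n k \<otimes> b) = (\<Oplus>k\<in>{..n}. T n k) \<otimes> (a \<oplus> b)"
    using a b by (simp add: finsum_ldistr r_distr)
  also have "\<dots> = (a \<oplus> b) [^] (Suc n)"
    using Suc by (simp add: T_def)
  finally show ?case
    by (simp add: T_def)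
qed

text \<open>Stated as \<open>p\<close> times one vanishing, so that the property passes along every
  ring homomorphism without a check that the target is nonzero.\<close>

locale char_cring = cring R for R (structure) and p :: nat +
  assumes prime_p: "Factorial_Ring.prime p"
    and char_p: "[p] \<cdot>\<^bsub>R\<^esub> \<one>\<^bsub>R\<^esub> = \<zero>\<^bsub>R\<^esub>"
begin

lemma p_pos: "p > 0"
  using prime_p prime_gt_0_nat by blast

lemma p_add_pow:
  assumes "x \<in> carrier R" "p dvd m"
  shows "[m] \<cdot> x = \<zero>"
proof -
  obtain k where m: "m = p * k"
    using assms by auto
  have "[p] \<cdot> x = \<zero>"
    using add_pow_ldistr[of \<one> x p] assms char_p by simp
  then show ?thesis
    using assms by (simp add: m flip: add.nat_pow_pow)
qed

lemma frob_add:
  assumes "a \<in> carrier R" "b \<in> carrier R"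
  shows "(a \<oplus> b) [^] p = a [^] p \<oplus> b [^] p"
proof -
  have "[(p choose k)] \<cdot> (a [^] k \<otimes> b [^] (p - k)) = \<zero>" if "k \<in> {..p} - {0, p}" for k
    using that assms prime_p by (intro p_add_pow dvd_choose_prime) auto
  then have "(a \<oplus> b) [^] p = (\<Oplus>k\<in>{0, p}. [(p choose k)] \<cdot> (a [^] k \<otimes> b [^] (p - k)))"
    unfolding binomial_theorem[OF assms] using assms by (intro finsum_neutral_right) auto
  also have "\<dots> = a [^] p \<oplus> b [^] p"
    using assms p_pos by (simp add: a_comm)
  finally show ?thesis .
qed

lemma frob_pow_add:
  assumes "a \<in> carrier R" "b \<in> carrier R"
  shows "(a \<oplus> b) [^] (p ^ e) = a [^] (p ^ e) \<oplus> b [^] (p ^ e)"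
proof (induction e)
  case (Suc e)
  then show ?case
    using assms by (simp add: mult.commute[of p] frob_add flip: nat_pow_pow)
qed (use assms in simp)

lemma frob_zero [simp]: "\<zero> [^] (p ^ e) = \<zero>"
  using p_pos by (intro nat_pow_zero) auto

lemma frob_finsum:
  assumes "finite A" "f \<in> A \<rightarrow> carrier R"
  shows "(\<Oplus>a\<in>A. f a) [^] (p ^ e) = (\<Oplus>a\<in>A. f a [^] (p ^ e))"
  using assms by (induction A rule: finite_induct) (auto simp: frob_pow_add Pi_iff)

lemma frob_minus:
  assumes "a \<in> carrier R"
  shows "(\<ominus> a) [^] (p ^ e) = \<ominus> (a [^] (p ^ e))"
proof -
  have "a [^] (p ^ e) \<oplus> (\<ominus> a) [^] (p ^ e) = \<zero>"
    using assms by (simp add: r_neg flip: frob_pow_add)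
  then show ?thesis
    using assms by (metis a_comm a_inv_closed minus_equality nat_pow_closed)
qed

end

text \<open>Gaussian elimination modulo a prime ideal.\<close>

lemma (in primeideal) dependent_rows:
  assumes "finite A" "finite B" "card B < card A"
    and "\<And>a b. a \<in> A \<Longrightarrow> b \<in> B \<Longrightarrow> M a b \<in> carrier R"
  shows "\<exists>x \<in> A \<rightarrow> carrier R. (\<exists>a\<in>A. x a \<notin> I) \<and> (\<forall>b\<in>B. (\<Oplus>a\<in>A. x a \<otimes> M a b) \<in> I)"
  using assms(2,1,3,4)
proof (induction B arbitrary: A M rule: finite_induct)
  case empty
  then obtain a where "a \<in> A"
    by fastforce
  moreover have "\<one> \<notin> I"
    using I_notcarr one_imp_carrier by blast
  ultimately show ?case
    by (intro bexI[of _ "\<lambda>_. \<one>"]) auto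
next
  case (insert c B)
  show ?case
  proof (cases "\<exists>a\<in>A. M a c \<notin> I")
    \<comment> \<open>All entries of column \<open>c\<close> lie in \<open>I\<close>, so any
      relation for the remaining columns also serves \<open>c\<close>.\<close>
    case False
    have "card B < card A"
      using insert by simp
    then obtain x where x: "x \<in> A \<rightarrow> carrier R" "\<exists>a\<in>A. x a \<notin> I"
      "\<forall>b\<in>B. (\<Oplus>a\<in>A. x a \<otimes> M a b) \<in> I"
      using insert.IH[of A M] insert.prems by (auto simp: Pi_iff)
    have "(\<Oplus>a\<in>A. x a \<otimes> M a c) \<in> I"
      using False x by (intro finsum_ideal_closed I_l_closed) auto
    then show ?thesis
      using x by (intro bexI[of _ x]) auto
  next
    case True
    then obtain a0 where a0: "a0 \<in> A" "M a0 c \<notin> I"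
      by blast
    define A' where "A' = A - {a0}"
    have A: "A = insert a0 A'" "a0 \<notin> A'" "finite A'"
      using a0 insert.prems by (auto simp: A'_def)
    have M: "M a b \<in> carrier R" if "a \<in> A'" "b \<in> insert c B" for a b
      using insert.prems that A by auto
    have M0: "M a0 b \<in> carrier R" if "b \<in> insert c B" for b
      using insert.prems that A by auto
    \<comment> \<open>Cross-multiplication clears column \<open>c\<close>. Division by the pivot
      \<open>M a0 c\<close> is impossible, as it is only known to lie outside
      \<open>I\<close>.\<close>
    define M' where "M' a b = M a0 c \<otimes> M a b \<ominus> M a c \<otimes> M a0 b" for a b
    have M'c: "M' a b \<in> carrier R" if "a \<in> A'" "b \<in> B" for a b
      using M M0 that by (auto simp: M'_def)
    have "card B < card A'"
      using insert A by simp
    then obtain x where x: "x \<in> A' \<rightarrow> carrier R" "\<exists>a\<in>A'. x a \<notin> I"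
      "\<forall>b\<in>B. (\<Oplus>a\<in>A'. x a \<otimes> M' a b) \<in> I"
      using insert.IH[of A' M', OF A(3)] M'c by blast
    define s where "s = (\<Oplus>a\<in>A'. x a \<otimes> M a c)"
    have xc: "x a \<in> carrier R" if "a \<in> A'" for a
      using x that by auto
    have s: "s \<in> carrier R"
      using M xc by (auto simp: s_def)
    \<comment> \<open>The coefficient of row \<open>a0\<close> is the one that turns the sum over
      \<open>A\<close> into the sum over \<open>A'\<close> of the eliminated rows
      \<open>M'\<close>.\<close>
    define z where "z = (\<lambda>a. if a = a0 then \<ominus> s else M a0 c \<otimes> x a)"
    have z: "z \<in> A \<rightarrow> carrier R"
      using xc s M0[of c] by (auto simp: z_def A)
    have sum: "(\<Oplus>a\<in>A. z a \<otimes> M a b) = (\<Oplus>a\<in>A'. x a \<otimes> M' a b)" if b: "b \<in> insert c B" for b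
    proof -
      have "(\<Oplus>a\<in>A. z a \<otimes> M a b) = z a0 \<otimes> M a0 b \<oplus> (\<Oplus>a\<in>A'. z a \<otimes> M a b)"
        unfolding A(1) using A(2,3) z M b M0 by (subst finsum_insert) (auto simp: A(1))
      also have "(\<Oplus>a\<in>A'. z a \<otimes> M a b) = (\<Oplus>a\<in>A'. M a0 c \<otimes> (x a \<otimes> M a b))"
        using A M b M0[of c] xc by (intro finsum_cong') (auto simp: z_def m_assoc)
      also have "z a0 \<otimes> M a0 b = (\<Oplus>a\<in>A'. \<ominus> (x a \<otimes> M a c \<otimes> M a0 b))"
        using M xc A(3) M0 b
        by (subst finsum_minus)
          (auto simp: z_def s_def l_minus finsum_ldistr)
      also have "(\<Oplus>a\<in>A'. \<ominus> (x a \<otimes> M a c \<otimes> M a0 b)) \<oplus> (\<Oplus>a\<in>A'. M a0 c \<otimes> (x a \<otimes> M a b))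
          = (\<Oplus>a\<in>A'. \<ominus> (x a \<otimes> M a c \<otimes> M a0 b) \<oplus> M a0 c \<otimes> (x a \<otimes> M a b))"
        using M xc M0 b by (intro finsum_addf[symmetric]) auto
      also have "\<dots> = (\<Oplus>a\<in>A'. x a \<otimes> M' a b)"
      proof (intro finsum_cong')
        fix a assume a: "a \<in> A'"
        have "M a b \<in> carrier R" "M a c \<in> carrier R" "M a0 b \<in> carrier R" "M a0 c \<in> carrier R"
          "x a \<in> carrier R"
          using M M0 b a xc by auto
        then show "\<ominus> (x a \<otimes> M a c \<otimes> M a0 b) \<oplus> M a0 c \<otimes> (x a \<otimes> M a b) = x a \<otimes> M' a b"
          unfolding M'_def by algebra
      qed (use M b M0 xc in \<open>auto simp: M'_def\<close>)
      finally show ?thesis .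
    qed
    have "(\<Oplus>a\<in>A. z a \<otimes> M a b) \<in> I" if b: "b \<in> insert c B" for b
    proof (cases "b = c")
      case True
      have "x a \<otimes> M' a c = \<zero>" if "a \<in> A'" for a
      proof -
        have "M a c \<in> carrier R" "M a0 c \<in> carrier R" "x a \<in> carrier R"
          using M M0 that xc by auto
        then show ?thesis
          unfolding M'_def by algebra
      qed
      then show ?thesis
        using sum[of c] True by (simp add: finsum_zeroI)
    qed (use sum x b in auto)
    moreover have "\<exists>a\<in>A. z a \<notin> I"
    proof -
      obtain a where "a \<in> A'" "x a \<notin> I"
        using x by blast
      \<comment> \<open>Primality keeps the product of the pivot and \<open>x a\<close>, both
        outside \<open>I\<close>, outside \<open>I\<close>.\<close>
      then have "z a \<notin> I"
        using I_prime[of "M a0 c" "x a"] a0 M0[of c] xc A by (auto simp: z_def)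
      then show ?thesis
        using \<open>a \<in> A'\<close> A by auto
    qed
    ultimately show ?thesis
      using z by blast
  qed
qed

subsection \<open>Formal power series\<close>

definition esum :: "('v \<Rightarrow> nat) \<Rightarrow> ('v \<Rightarrow> nat) \<Rightarrow> 'v \<Rightarrow> nat" where
  "esum a b = (\<lambda>v. a v + b v)"

definition ediff :: "('v \<Rightarrow> nat) \<Rightarrow> ('v \<Rightarrow> nat) \<Rightarrow> 'v \<Rightarrow> nat" where
  "ediff a b = (\<lambda>v. a v - b v)"

definition below :: "('v \<Rightarrow> nat) \<Rightarrow> ('v \<Rightarrow> nat) set" where
  "below m = {k. \<forall>v. k v \<le> m v}"

text \<open>The symmetric form of the range of convolution. In it, commutativity and associativity
  of the product become bijections of index sets.\<close>

definition splits :: "('v \<Rightarrow> nat) \<Rightarrow> (('v \<Rightarrow> nat) \<times> ('v \<Rightarrow> nat)) set" where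
  "splits m = {x. esum (fst x) (snd x) = m}"

abbreviation ezero :: "'v \<Rightarrow> nat" where
  "ezero \<equiv> \<lambda>_. 0"

lemma esum_comm: "esum a b = esum b a"
  and esum_left_comm: "esum a (esum b c) = esum b (esum a c)"
  and esum_zero [simp]: "esum a ezero = a" "esum ezero a = a"
  and ediff_zero [simp]: "ediff a ezero = a"
  by (auto simp: esum_def ediff_def)

lemma esum_cancel [simp]: "esum a b = esum a c \<longleftrightarrow> b = c" "esum b a = esum c a \<longleftrightarrow> b = c"
  by (auto simp: esum_def fun_eq_iff)

lemma ediff_esum [simp]: "ediff (esum a b) a = b" "ediff (esum a b) b = a"
  by (auto simp: esum_def ediff_def)

lemma esum_ediff [simp]: "a \<in> below m \<Longrightarrow> esum a (ediff m a) = m"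
  "a \<in> below m \<Longrightarrow> esum (ediff m a) a = m"
  by (auto simp: esum_def ediff_def below_def)

lemma below_esum [simp]: "a \<in> below (esum a b)" "b \<in> below (esum a b)"
  by (auto simp: esum_def below_def)

lemma below_refl [simp]: "a \<in> below a"
  and below_zero [simp]: "ezero \<in> below a"
  by (auto simp: below_def)

lemma exponents_zero [simp]: "ezero \<in> exponents V"
  and exponents_esum [simp]: "esum a b \<in> exponents V \<longleftrightarrow> a \<in> exponents V \<and> b \<in> exponents V"
  and exponents_ediff [simp]: "a \<in> exponents V \<Longrightarrow> ediff a b \<in> exponents V"
  by (auto simp: exponents_def esum_def ediff_def)

lemma below_exponents: "m \<in> exponents V \<Longrightarrow> k \<in> below m \<Longrightarrow> k \<in> exponents V"
  unfolding exponents_def below_def by (auto dest: spec) (metis le_zero_eq)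

lemma finite_below:
  assumes "finite V" "m \<in> exponents V"
  shows "finite (below m)"
proof -
  have "k \<in> (\<lambda>g v. if v \<in> V then g v else 0) ` (PiE V (\<lambda>v. {..m v}))" if k: "k \<in> below m" for k
  proof
    show "k = (\<lambda>v. if v \<in> V then restrict k V v else 0)"
      using below_exponents[OF assms(2) k] by (auto simp: exponents_def)
  qed (use k in \<open>auto simp: below_def\<close>)
  then have "below m \<subseteq> (\<lambda>g v. if v \<in> V then g v else 0) ` (PiE V (\<lambda>v. {..m v}))"
    by blast
  then show ?thesis
    using assms(1) by (meson finite_PiE finite_atMost finite_imageI finite_subset)
qed

lemma bij_betw_below_splits: "bij_betw (\<lambda>k. (k, ediff m k)) (below m) (splits m)"
  by (rule bij_betwI[of _ _ _ fst]) (auto simp: splits_def)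

lemma splits_exponents:
  "x \<in> splits m \<Longrightarrow> m \<in> exponents V \<Longrightarrow> fst x \<in> exponents V"
  "x \<in> splits m \<Longrightarrow> m \<in> exponents V \<Longrightarrow> snd x \<in> exponents V"
  unfolding splits_def by auto

lemma finite_splits: "finite V \<Longrightarrow> m \<in> exponents V \<Longrightarrow> finite (splits m)"
  using bij_betw_finite[OF bij_betw_below_splits] finite_below by blast

locale power_series = cring R for R (structure) and V :: "'v set" +
  assumes finite_vars: "finite V"
begin

abbreviation P where "P \<equiv> power_series_ring V R"
abbreviation E where "E \<equiv> exponents V"

lemma carrier_P: "carrier P = E \<rightarrow>\<^sub>E carrier R"
  by (simp add: power_series_ring_def)

lemma coeff_closed [simp, intro]: "s \<in> carrier P \<Longrightarrow> m \<in> E \<Longrightarrow> s m \<in> carrier R"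
  by (auto simp: carrier_P)

lemma series_eqI:
  assumes "s \<in> carrier P" "t \<in> carrier P" "\<And>m. m \<in> E \<Longrightarrow> s m = t m"
  shows "s = t"
  using assms unfolding carrier_P by (rule PiE_ext)

lemma series_closedI: "(\<And>m. m \<in> E \<Longrightarrow> s m \<in> carrier R) \<Longrightarrow> restrict s E \<in> carrier P"
  by (auto simp: carrier_P)

lemma coeff_zero [simp]: "m \<in> E \<Longrightarrow> \<zero>\<^bsub>P\<^esub> m = \<zero>"
  and coeff_one: "m \<in> E \<Longrightarrow> \<one>\<^bsub>P\<^esub> m = (if m = ezero then \<one> else \<zero>)"
  and coeff_add [simp]: "m \<in> E \<Longrightarrow> (s \<oplus>\<^bsub>P\<^esub> t) m = s m \<oplus> t m"
  and coeff_mult_below: "m \<in> E \<Longrightarrow> (s \<otimes>\<^bsub>P\<^esub> t) m = (\<Oplus>k\<in>below m. s k \<otimes> t (ediff m k))"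
  by (simp_all add: power_series_ring_def below_def ediff_def)

lemma coeff_mult:
  assumes "s \<in> carrier P" "t \<in> carrier P" "m \<in> E"
  shows "(s \<otimes>\<^bsub>P\<^esub> t) m = (\<Oplus>x\<in>splits m. s (fst x) \<otimes> t (snd x))"
proof -
  have "(\<Oplus>k\<in>below m. s (fst (k, ediff m k)) \<otimes> t (snd (k, ediff m k))) =
      (\<Oplus>x\<in>splits m. s (fst x) \<otimes> t (snd x))"
    using assms splits_exponents[of _ m V] by (intro finsum_bij bij_betw_below_splits) auto
  then show ?thesis
    using assms by (simp add: coeff_mult_below)
qed

lemma P_zero_closed: "\<zero>\<^bsub>P\<^esub> \<in> carrier P"
  and P_one_closed: "\<one>\<^bsub>P\<^esub> \<in> carrier P"
  and P_add_closed: "s \<in> carrier P \<Longrightarrow> t \<in> carrier P \<Longrightarrow> s \<oplus>\<^bsub>P\<^esub> t \<in> carrier P"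
  by (auto simp: power_series_ring_def)

lemma P_mult_closed: "s \<in> carrier P \<Longrightarrow> t \<in> carrier P \<Longrightarrow> s \<otimes>\<^bsub>P\<^esub> t \<in> carrier P"
proof -
  assume st: "s \<in> carrier P" "t \<in> carrier P"
  have "s \<otimes>\<^bsub>P\<^esub> t \<in> extensional E"
    by (simp add: power_series_ring_def)
  moreover have "(s \<otimes>\<^bsub>P\<^esub> t) m \<in> carrier R" if "m \<in> E" for m
    using that st coeff_mult[OF st that] splits_exponents[of _ m V] by auto
  ultimately show ?thesis
    by (auto simp: carrier_P PiE_def)
qed

lemma P_mult_comm:
  assumes "s \<in> carrier P" "t \<in> carrier P"
  shows "s \<otimes>\<^bsub>P\<^esub> t = t \<otimes>\<^bsub>P\<^esub> s"
proof (rule series_eqI)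
  fix m assume m: "m \<in> E"
  have E: "fst x \<in> E" "snd x \<in> E" if "x \<in> splits m" for x
    using that m splits_exponents by blast+
  have bij: "bij_betw prod.swap (splits m) (splits m)"
    by (rule bij_betwI[of _ _ _ prod.swap]) (auto simp: splits_def esum_comm)
  have "(s \<otimes>\<^bsub>P\<^esub> t) m = (\<Oplus>x\<in>splits m. s (fst x) \<otimes> t (snd x))"
    using assms m by (simp add: coeff_mult)
  also have "\<dots> = (\<Oplus>x\<in>splits m. s (fst (prod.swap x)) \<otimes> t (snd (prod.swap x)))"
    using assms E by (intro finsum_bij[OF bij, symmetric]) auto
  also have "\<dots> = (\<Oplus>x\<in>splits m. t (fst x) \<otimes> s (snd x))"
  proof (rule finsum_cong')
    fix x assume "x \<in> splits m"
    then show "s (fst (prod.swap x)) \<otimes> t (snd (prod.swap x)) = t (fst x) \<otimes> s (snd x)"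
      using E assms by (simp add: m_comm)
  qed (use E assms in auto)
  also have "\<dots> = (t \<otimes>\<^bsub>P\<^esub> s) m"
    using assms m by (simp add: coeff_mult)
  finally show "(s \<otimes>\<^bsub>P\<^esub> t) m = (t \<otimes>\<^bsub>P\<^esub> s) m" .
qed (use assms P_mult_closed in auto)

text \<open>One sum over nested splittings, so that associativity only asks for a bijection of its
  index set.\<close>

lemma coeff_mult3:
  assumes s: "s \<in> carrier P" and t: "t \<in> carrier P" and u: "u \<in> carrier P" and m: "m \<in> E"
  shows "((s \<otimes>\<^bsub>P\<^esub> t) \<otimes>\<^bsub>P\<^esub> u) m =
    (\<Oplus>z\<in>Sigma (splits m) (\<lambda>x. splits (fst x)). s (fst (snd z)) \<otimes> t (snd (snd z)) \<otimes> u (snd (fst z)))"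
    (is "_ = (\<Oplus>z\<in>?A. _ z)")
proof -
  have E: "a \<in> E" "b \<in> E" if "(a, b) \<in> splits k" "k \<in> E" for a b k
    using splits_exponents[OF that(1) that(2)] by auto
  have fin: "finite (splits k)" if "k \<in> E" for k
    using finite_splits finite_vars that by blast
  have "((s \<otimes>\<^bsub>P\<^esub> t) \<otimes>\<^bsub>P\<^esub> u) m =
      (\<Oplus>x\<in>splits m. (\<Oplus>y\<in>splits (fst x). s (fst y) \<otimes> t (snd y)) \<otimes> u (snd x))"
    using s t u m E P_mult_closed
    by (subst coeff_mult) (auto intro!: finsum_cong' m_closed finsum_closed simp: coeff_mult dest: E)
  also have "\<dots> = (\<Oplus>x\<in>splits m. (\<Oplus>y\<in>splits (fst x). s (fst y) \<otimes> t (snd y) \<otimes> u (snd x)))"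
  proof (rule finsum_cong')
    fix x assume "x \<in> splits m"
    then have x: "fst x \<in> E" "snd x \<in> E"
      using splits_exponents[OF _ m] by auto
    show "(\<Oplus>y\<in>splits (fst x). s (fst y) \<otimes> t (snd y)) \<otimes> u (snd x) =
        (\<Oplus>y\<in>splits (fst x). s (fst y) \<otimes> t (snd y) \<otimes> u (snd x))"
    proof (intro finsum_ldistr)
      show "(\<lambda>y. s (fst y) \<otimes> t (snd y)) \<in> splits (fst x) \<rightarrow> carrier R"
      proof
        fix y assume "y \<in> splits (fst x)"
        then have "fst y \<in> E" "snd y \<in> E"
          using splits_exponents[OF _ x(1)] by auto
        then show "s (fst y) \<otimes> t (snd y) \<in> carrier R"
          using s t by simp
      qed
    qed (use fin x u in auto)
  next
    show "(\<lambda>x. \<Oplus>y\<in>splits (fst x). s (fst y) \<otimes> t (snd y) \<otimes> u (snd x)) \<in> splits m \<rightarrow> carrier R"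
    proof (intro Pi_I finsum_closed m_closed)
      fix x y assume "x \<in> splits m" "y \<in> splits (fst x)"
      moreover from this have "fst x \<in> E" "snd x \<in> E"
        using splits_exponents[OF _ m] by auto
      ultimately show "s (fst y) \<in> carrier R" "t (snd y) \<in> carrier R" "u (snd x) \<in> carrier R"
        using s t u splits_exponents[of y "fst x" V] by auto
    qed
  qed simp
  also have "\<dots> = (\<Oplus>z\<in>?A. s (fst (snd z)) \<otimes> t (snd (snd z)) \<otimes> u (snd (fst z)))"
    using s t u m E by (intro finsum_Sigma) (auto intro!: fin dest: E)
  finally show ?thesis .
qed

lemma P_mult_assoc:
  assumes s: "s \<in> carrier P" and t: "t \<in> carrier P" and u: "u \<in> carrier P"
  shows "(s \<otimes>\<^bsub>P\<^esub> t) \<otimes>\<^bsub>P\<^esub> u = s \<otimes>\<^bsub>P\<^esub> (t \<otimes>\<^bsub>P\<^esub> u)"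
proof (rule series_eqI)
  fix m assume m: "m \<in> E"
  let ?A = "Sigma (splits m) (\<lambda>x. splits (fst x))"
  \<comment> \<open>Here \<open>a = i + j\<close> and \<open>m = a + c\<close>; the image regroups
    the same three exponents as \<open>m = (j + c) + i\<close>.\<close>
  let ?h = "\<lambda>((a, c), (i, j)). ((esum j c, i), (j, c))"
  have bij: "bij_betw ?h ?A ?A"
    by (rule bij_betwI[of _ _ _ "\<lambda>((b, i), (j, c)). ((esum i j, c), (i, j))"])
      (auto simp: splits_def esum_comm esum_left_comm)
  have E: "i \<in> E" "j \<in> E" "c \<in> E" if "((a, c), (i, j)) \<in> ?A" for a c i j
    using that m by (auto simp: splits_def)
  \<comment> \<open>By commutativity the right-hand side also has the shape (product of two) times
    third, to which \<open>coeff_mult3\<close> applies.\<close>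
  have "(s \<otimes>\<^bsub>P\<^esub> (t \<otimes>\<^bsub>P\<^esub> u)) m = ((t \<otimes>\<^bsub>P\<^esub> u) \<otimes>\<^bsub>P\<^esub> s) m"
    using s t u P_mult_comm P_mult_closed by simp
  also have "\<dots> = (\<Oplus>z\<in>?A. t (fst (snd z)) \<otimes> u (snd (snd z)) \<otimes> s (snd (fst z)))"
    using s t u m by (intro coeff_mult3)
  also have "\<dots> = (\<Oplus>z\<in>?A. t (fst (snd (?h z))) \<otimes> u (snd (snd (?h z))) \<otimes> s (snd (fst (?h z))))"
  proof (rule finsum_bij[OF bij, symmetric])
    fix z assume "z \<in> ?A"
    moreover obtain a c i j where "z = ((a, c), (i, j))"
      by (metis surj_pair)
    ultimately show "t (fst (snd z)) \<otimes> u (snd (snd z)) \<otimes> s (snd (fst z)) \<in> carrier R"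
      using E s t u by simp
  qed
  also have "\<dots> = (\<Oplus>z\<in>?A. s (fst (snd z)) \<otimes> t (snd (snd z)) \<otimes> u (snd (fst z)))"
  proof (rule finsum_cong')
    fix z assume z: "z \<in> ?A"
    obtain a c i j where eq: "z = ((a, c), (i, j))"
      by (metis surj_pair)
    have "s i \<in> carrier R" "t j \<in> carrier R" "u c \<in> carrier R"
      using E z s t u by (simp_all add: eq)
    then show "t (fst (snd (?h z))) \<otimes> u (snd (snd (?h z))) \<otimes> s (snd (fst (?h z))) =
        s (fst (snd z)) \<otimes> t (snd (snd z)) \<otimes> u (snd (fst z))"
      by (simp add: eq m_ac)
  next
    show "(\<lambda>z. s (fst (snd z)) \<otimes> t (snd (snd z)) \<otimes> u (snd (fst z))) \<in> ?A \<rightarrow> carrier R"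
    proof
      fix z assume "z \<in> ?A"
      moreover obtain a c i j where "z = ((a, c), (i, j))"
        by (metis surj_pair)
      ultimately show "s (fst (snd z)) \<otimes> t (snd (snd z)) \<otimes> u (snd (fst z)) \<in> carrier R"
        using E s t u by simp
    qed
  qed simp
  also have "\<dots> = ((s \<otimes>\<^bsub>P\<^esub> t) \<otimes>\<^bsub>P\<^esub> u) m"
    using s t u m by (intro coeff_mult3[symmetric])
  finally show "((s \<otimes>\<^bsub>P\<^esub> t) \<otimes>\<^bsub>P\<^esub> u) m = (s \<otimes>\<^bsub>P\<^esub> (t \<otimes>\<^bsub>P\<^esub> u)) m"
    by simp
qed (use assms P_mult_closed in auto)

text \<open>For \<open>k\<close> outside \<open>E\<close> this is the zero series, so it always
  belongs to the ring when \<open>a\<close> is a scalar.\<close>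

definition pmonom :: "'a \<Rightarrow> ('v \<Rightarrow> nat) \<Rightarrow> ('v \<Rightarrow> nat) \<Rightarrow> 'a" where
  "pmonom a k = (\<lambda>m\<in>E. if m = k then a else \<zero>)"

lemma monom_closed [simp, intro]: "a \<in> carrier R \<Longrightarrow> pmonom a k \<in> carrier P"
  by (auto simp: pmonom_def carrier_P)

lemma coeff_monom: "m \<in> E \<Longrightarrow> pmonom a k m = (if m = k then a else \<zero>)"
  by (simp add: pmonom_def)

lemma P_one_monom: "\<one>\<^bsub>P\<^esub> = pmonom \<one> ezero"
  by (simp add: pmonom_def power_series_ring_def)

lemma coeff_monom_mult:
  assumes "a \<in> carrier R" "k \<in> E" "s \<in> carrier P" "m \<in> E"
  shows "(pmonom a k \<otimes>\<^bsub>P\<^esub> s) m = (if k \<in> below m then a \<otimes> s (ediff m k) else \<zero>)"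
proof -
  have "pmonom a k j \<otimes> s (ediff m j) = (if j = k then a \<otimes> s (ediff m k) else \<zero>)" if "j \<in> below m" for j
    using below_exponents[OF assms(4) that] assms by (simp add: coeff_monom)
  then have "(pmonom a k \<otimes>\<^bsub>P\<^esub> s) m = (\<Oplus>j\<in>below m. if j = k then a \<otimes> s (ediff m k) else \<zero>)"
    using assms by (auto simp: coeff_mult_below intro!: finsum_cong')
  also have "\<dots> = (if k \<in> below m then a \<otimes> s (ediff m k) else \<zero>)"
  proof (cases "k \<in> below m")
    case True
    then show ?thesis
      using finsum_single[of "below m" k] finite_below[OF finite_vars assms(4)] assms by simp
  qed (auto intro!: finsum_zeroI)
  finally show ?thesis .
qed

sublocale P: cring P
proof (rule cringI)
  show "abelian_group P"
  proof (rule abelian_groupI)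
    fix s assume s: "s \<in> carrier P"
    have "restrict (\<lambda>m. \<ominus> s m) E \<oplus>\<^bsub>P\<^esub> s = \<zero>\<^bsub>P\<^esub>"
      using s by (intro series_eqI P_add_closed P_zero_closed series_closedI) (auto simp: l_neg)
    then show "\<exists>t\<in>carrier P. t \<oplus>\<^bsub>P\<^esub> s = \<zero>\<^bsub>P\<^esub>"
      using s by (metis (no_types, lifting) a_inv_closed coeff_closed series_closedI)
  qed (auto intro!: series_eqI P_add_closed P_zero_closed simp: a_ac)
  show "comm_monoid P"
  proof (rule comm_monoidI)
    fix s assume s: "s \<in> carrier P"
    show "\<one>\<^bsub>P\<^esub> \<otimes>\<^bsub>P\<^esub> s = s"
      using s by (intro series_eqI P_mult_closed P_one_closed)
        (auto simp: P_one_monom coeff_monom_mult)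
  qed (auto intro: P_mult_closed P_one_closed P_mult_assoc P_mult_comm)
  fix s t u assume stu: "s \<in> carrier P" "t \<in> carrier P" "u \<in> carrier P"
  show "(s \<oplus>\<^bsub>P\<^esub> t) \<otimes>\<^bsub>P\<^esub> u = s \<otimes>\<^bsub>P\<^esub> u \<oplus>\<^bsub>P\<^esub> t \<otimes>\<^bsub>P\<^esub> u"
  proof (rule series_eqI)
    fix m assume m: "m \<in> E"
    have "((s \<oplus>\<^bsub>P\<^esub> t) \<otimes>\<^bsub>P\<^esub> u) m =
        (\<Oplus>x\<in>splits m. s (fst x) \<otimes> u (snd x) \<oplus> t (fst x) \<otimes> u (snd x))"
      using stu m P_add_closed splits_exponents[of _ m V]
      by (subst coeff_mult) (auto simp: l_distr simp del: finsum_addf intro!: finsum_cong')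
    also have "\<dots> = (s \<otimes>\<^bsub>P\<^esub> u \<oplus>\<^bsub>P\<^esub> t \<otimes>\<^bsub>P\<^esub> u) m"
      using stu m splits_exponents[of _ m V]
      by (subst finsum_addf) (auto simp: coeff_mult)
    finally show "((s \<oplus>\<^bsub>P\<^esub> t) \<otimes>\<^bsub>P\<^esub> u) m = (s \<otimes>\<^bsub>P\<^esub> u \<oplus>\<^bsub>P\<^esub> t \<otimes>\<^bsub>P\<^esub> u) m" .
  qed (use stu P_add_closed P_mult_closed in auto)
qed

lemma coeff_minus [simp]:
  assumes "s \<in> carrier P" "m \<in> E"
  shows "(\<ominus>\<^bsub>P\<^esub> s) m = \<ominus> s m"
proof -
  have "(\<ominus>\<^bsub>P\<^esub> s \<oplus>\<^bsub>P\<^esub> s) m = \<zero>"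
    using assms by (simp add: P.l_neg del: coeff_add)
  then show ?thesis
    using assms by (simp add: minus_equality)
qed

lemma coeff_diff [simp]:
  assumes "s \<in> carrier P" "t \<in> carrier P" "m \<in> E"
  shows "(s \<ominus>\<^bsub>P\<^esub> t) m = s m \<ominus> t m"
  using assms by (simp add: a_minus_def)

lemma coeff_finsum:
  assumes "finite A" "f \<in> A \<rightarrow> carrier P" "m \<in> E"
  shows "(\<Oplus>\<^bsub>P\<^esub>i\<in>A. f i) m = (\<Oplus>i\<in>A. f i m)"
  using assms
proof (induction A rule: finite_induct)
  case (insert a A)
  then show ?case
    by (subst P.finsum_insert) (auto simp: Pi_iff)
qed simp

lemma monom_mult:
  assumes "a \<in> carrier R" "b \<in> carrier R" "k \<in> E" "l \<in> E"
  shows "pmonom a k \<otimes>\<^bsub>P\<^esub> pmonom b l = pmonom (a \<otimes> b) (esum k l)"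
proof (rule series_eqI)
  fix m assume m: "m \<in> E"
  have "k \<in> below m \<and> ediff m k = l \<longleftrightarrow> m = esum k l"
    by auto
  then show "(pmonom a k \<otimes>\<^bsub>P\<^esub> pmonom b l) m = pmonom (a \<otimes> b) (esum k l) m"
    using assms m by (auto simp: coeff_monom_mult coeff_monom)
qed (use assms in auto)

lemma monom_pow:
  assumes "a \<in> carrier R" "k \<in> E"
  shows "pmonom a k [^]\<^bsub>P\<^esub> (n::nat) = pmonom (a [^] n) (\<lambda>v. n * k v)"
proof (induction n)
  case (Suc n)
  have "(\<lambda>v. n * k v) \<in> E"
    using assms by (auto simp: exponents_def)
  then show ?case
    using assms Suc by (auto simp: monom_mult esum_def add.commute)
qed (simp add: P_one_monom)

lemma ps_const_monom: "ps_const V R a = pmonom a ezero"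
  by (simp add: ps_const_def pmonom_def)

lemma ps_var_monom: "ps_var V R v = pmonom \<one> ((\<lambda>_. 0)(v := 1))"
  by (simp add: ps_var_def pmonom_def)

lemma coeff_const_mult:
  assumes "a \<in> carrier R" "s \<in> carrier P" "m \<in> E"
  shows "(ps_const V R a \<otimes>\<^bsub>P\<^esub> s) m = a \<otimes> s m"
  using coeff_monom_mult[OF assms(1) exponents_zero assms(2,3)] by (simp add: ps_const_monom)

lemma monom_add:
  "a \<in> carrier R \<Longrightarrow> b \<in> carrier R \<Longrightarrow> pmonom (a \<oplus> b) k = pmonom a k \<oplus>\<^bsub>P\<^esub> pmonom b k"
  by (rule series_eqI) (auto simp: coeff_monom)

lemma ps_const_hom: "ps_const V R \<in> ring_hom R P"
  by (rule ring_hom_memI)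
    (auto simp: ps_const_monom monom_mult monom_add P_one_monom)

lemma coeff_zero_hom: "(\<lambda>s. s ezero) \<in> ring_hom P R"
proof (rule ring_hom_memI)
  fix s t assume st: "s \<in> carrier P" "t \<in> carrier P"
  have "below ezero = {ezero :: 'v \<Rightarrow> nat}"
    by (auto simp: below_def)
  then show "(s \<otimes>\<^bsub>P\<^esub> t) ezero = s ezero \<otimes> t ezero"
    using st by (simp add: coeff_mult_below)
qed (auto simp: coeff_one)

end

section \<open>Recursion along the degree and invertible series\<close>

text \<open>A functional that consults only arguments of smaller rank is admissible for well-founded
  recursion. It delivers all coefficients of a series at once, in place of successive approximations
  and a limit.\<close>

lemma recursive_solution:
  fixes r :: "'a \<Rightarrow> nat"
  assumes "\<And>f g x. (\<And>y. r y < r x \<Longrightarrow> f y = g y) \<Longrightarrow> F f x = F g x"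
  shows "\<exists>z. \<forall>x. z x = F z x"
proof -
  have "wfrec (measure r) F x = F (wfrec (measure r) F) x" for x
    by (subst wfrec_fixpoint) (auto simp: adm_wf_def intro!: assms)
  then show ?thesis
    by blast
qed

definition edeg :: "'v set \<Rightarrow> ('v \<Rightarrow> nat) \<Rightarrow> nat" where
  "edeg V m = (\<Sum>v\<in>V. m v)"

lemma edeg_esum [simp]: "edeg V (esum a b) = edeg V a + edeg V b"
  by (simp add: edeg_def esum_def sum.distrib)

lemma edeg_zero [simp]: "edeg V ezero = 0"
  by (simp add: edeg_def)

lemma edeg_eq_0: "finite V \<Longrightarrow> m \<in> exponents V \<Longrightarrow> edeg V m = 0 \<longleftrightarrow> m = ezero"
  by (auto simp: edeg_def exponents_def fun_eq_iff)

text \<open>The descent behind the recursion for inverses and behind Weierstrass division.\<close>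

lemma edeg_ediff_less:
  assumes "finite V" "m \<in> exponents V" "k \<in> below m" "k \<noteq> ezero"
  shows "edeg V (ediff m k) < edeg V m"
proof -
  have "edeg V k > 0"
    using edeg_eq_0[OF assms(1) below_exponents[OF assms(2,3)]] assms(4) by simp
  moreover have "edeg V m = edeg V k + edeg V (ediff m k)"
    using edeg_esum[of V k "ediff m k"] assms(3) by simp
  ultimately show ?thesis
    by simp
qed

context power_series
begin

lemma finite_edeg: "finite {m \<in> E. edeg V m < N}"
proof -
  have "{m \<in> E. edeg V m < N} \<subseteq> below (\<lambda>v. if v \<in> V then N else 0)"
  proof
    fix m assume m: "m \<in> {m \<in> E. edeg V m < N}"
    have "m v \<le> N" if "v \<in> V" for v
      using member_le_sum[OF that, of m] m finite_vars by (auto simp: edeg_def)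
    then show "m \<in> below (\<lambda>v. if v \<in> V then N else 0)"
      using m by (auto simp: below_def exponents_def)
  qed
  moreover have "finite (below (\<lambda>v. if v \<in> V then N else 0))"
    by (intro finite_below[OF finite_vars]) (auto simp: exponents_def)
  ultimately show ?thesis
    by (rule finite_subset)
qed

lemma finsum_pmonom:
  assumes "finite A" "A \<subseteq> E" "\<And>m. m \<in> A \<Longrightarrow> c m \<in> carrier R" "k \<in> E"
  shows "(\<Oplus>\<^bsub>P\<^esub>m\<in>A. pmonom (c m) m) k = (if k \<in> A then c k else \<zero>)"
proof -
  have "(\<Oplus>\<^bsub>P\<^esub>m\<in>A. pmonom (c m) m) k = (\<Oplus>m\<in>A. if k = m then c m else \<zero>)"
    using assms by (subst coeff_finsum) (auto simp: coeff_monom intro!: finsum_cong')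
  also have "\<dots> = (if k \<in> A then c k else \<zero>)"
    using finsum_single[of A k "\<lambda>m. if k = m then c m else \<zero>"] assms(1,3)
    by (auto intro!: finsum_zeroI)
  finally show ?thesis .
qed

lemma low_coeff_mult:
  assumes "s \<in> carrier P" "t \<in> carrier P" "\<And>m. m \<in> E \<Longrightarrow> edeg V m < N \<Longrightarrow> s m = \<zero>"
    and m: "m \<in> E" "edeg V m < N"
  shows "(s \<otimes>\<^bsub>P\<^esub> t) m = \<zero>"
proof -
  have "s (fst x) \<otimes> t (snd x) = \<zero>" if "x \<in> splits m" for x
  proof -
    have "edeg V (fst x) \<le> edeg V m"
      using that by (auto simp: splits_def)
    then have "s (fst x) = \<zero>" "snd x \<in> E"
      using assms(3) splits_exponents[OF that m(1)] m by auto
    then show ?thesis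
      using assms by auto
  qed
  then show ?thesis
    using assms m by (auto simp: coeff_mult intro: finsum_zeroI)
qed

text \<open>The coefficients of the inverse are determined by recursion on the degree.\<close>

lemma series_Units:
  assumes s: "s \<in> carrier P" and u: "s ezero \<in> Units R"
  shows "s \<in> Units P"
proof -
  define i where "i = inv (s ezero)"
  have i: "i \<in> carrier R" "s ezero \<otimes> i = \<one>"
    using u by (auto simp: i_def)
  define B where "B m = below m - {ezero}" for m :: "'v \<Rightarrow> nat"
  \<comment> \<open>The equation for the coefficient at \<open>m\<close> of the product with
    \<open>s\<close>, solved for the unknown \<open>z m\<close>. The carrier test supplies a default
    value as long as the solution is not known to be closed; afterwards it is always
    satisfied.\<close>
  define F where "F z m = (if m \<in> E then
      i \<otimes> (\<one>\<^bsub>P\<^esub> m \<ominus> (\<Oplus>k\<in>B m. s k \<otimes> (if z (ediff m k) \<in> carrier R then z (ediff m k) else \<zero>))) else \<zero>)"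
    for z m
  have adm: "F f m = F g m" if fg: "\<And>k. edeg V k < edeg V m \<Longrightarrow> f k = g k" for f g m
  proof (cases "m \<in> E")
    case True
    have "f (ediff m k) = g (ediff m k)" if k: "k \<in> B m" for k
      using k True by (intro fg edeg_ediff_less finite_vars) (auto simp: B_def)
    moreover have "s k \<in> carrier R" if "k \<in> B m" for k
      using that s True below_exponents by (auto simp: B_def)
    ultimately have "(\<Oplus>k\<in>B m. s k \<otimes> (if f (ediff m k) \<in> carrier R then f (ediff m k) else \<zero>)) =
       (\<Oplus>k\<in>B m. s k \<otimes> (if g (ediff m k) \<in> carrier R then g (ediff m k) else \<zero>))"
      by (intro finsum_cong') auto
    then show ?thesis
      by (simp add: F_def)
  qed (simp add: F_def)
  obtain z where z: "\<And>m. z m = F z m"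
    using recursive_solution[of "edeg V" F] adm by blast
  have sB: "s k \<in> carrier R" if "m \<in> E" "k \<in> B m" for k m
    using that s below_exponents by (auto simp: B_def)
  have zc: "z m \<in> carrier R" for m
  proof (cases "m \<in> E")
    case True
    then have "(\<Oplus>k\<in>B m. s k \<otimes> (if z (ediff m k) \<in> carrier R then z (ediff m k) else \<zero>)) \<in> carrier R"
      using sB by (intro finsum_closed) auto
    moreover have "\<one>\<^bsub>P\<^esub> m \<in> carrier R"
      using True P_one_closed by blast
    ultimately show ?thesis
      unfolding z[of m] F_def using i True by simp
  qed (simp add: z[of m] F_def)
  define t where "t = restrict z E"
  have t: "t \<in> carrier P"
    using zc by (auto simp: t_def intro: series_closedI)
  have "s \<otimes>\<^bsub>P\<^esub> t = \<one>\<^bsub>P\<^esub>"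
  proof (rule series_eqI)
    fix m assume m: "m \<in> E"
    note sB = sB[OF m]
    define w where "w = (\<Oplus>k\<in>B m. s k \<otimes> z (ediff m k))"
    have w: "w \<in> carrier R"
      using sB zc by (auto simp: w_def)
    have "below m = insert ezero (B m)" "ezero \<notin> B m" "finite (B m)"
      using finite_below[OF finite_vars m] by (auto simp: B_def)
    then have "(s \<otimes>\<^bsub>P\<^esub> t) m = s ezero \<otimes> z m \<oplus> (\<Oplus>k\<in>B m. s k \<otimes> t (ediff m k))"
      using m s t zc sB by (simp add: coeff_mult_below t_def)
    also have "(\<Oplus>k\<in>B m. s k \<otimes> t (ediff m k)) = w"
      using m sB zc unfolding w_def by (intro finsum_cong') (auto simp: t_def)
    also have "z m = i \<otimes> (\<one>\<^bsub>P\<^esub> m \<ominus> w)"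
      using m zc by (subst z) (simp add: F_def w_def)
    also have "s ezero \<otimes> (i \<otimes> (\<one>\<^bsub>P\<^esub> m \<ominus> w)) = (s ezero \<otimes> i) \<otimes> (\<one>\<^bsub>P\<^esub> m \<ominus> w)"
      using s i w m P_one_closed by (intro m_assoc[symmetric]) auto
    also have "\<dots> \<oplus> w = \<one>\<^bsub>P\<^esub> m"
      using i w m P_one_closed by (simp add: a_minus_def a_assoc l_neg)
    finally show "(s \<otimes>\<^bsub>P\<^esub> t) m = \<one>\<^bsub>P\<^esub> m" .
  qed (use s t in auto)
  then show ?thesis
    using s t P.m_comm[OF s t] by (auto simp: Units_def)
qed

end

subsection \<open>Division by leading monomials\<close>

text \<open>Degree lexicographic order, encoded by the position of a monomial in it.\<close>

lemma exists_monomial_rank: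
  fixes V :: "'v::linorder set"
  assumes fin: "finite V"
  shows "\<exists>\<rho> :: ('v \<Rightarrow> nat) \<Rightarrow> nat. inj_on \<rho> (exponents V) \<and>
    (\<forall>a\<in>exponents V. \<forall>b\<in>exponents V. \<forall>c\<in>exponents V. \<rho> a < \<rho> b \<longrightarrow> \<rho> (esum a c) < \<rho> (esum b c)) \<and>
    (\<forall>a\<in>exponents V. \<forall>b\<in>exponents V. edeg V a < edeg V b \<longrightarrow> \<rho> a < \<rho> b)"
proof -
  let ?E = "exponents V"
  define lt where "lt a b \<longleftrightarrow> edeg V a < edeg V b \<or> (edeg V a = edeg V b \<and> less_fun a b)" for a b
  \<comment> \<open>As the degree is compared before the lexicographic tie-break, every monomial has
    finitely many predecessors, and counting them embeds the order into the natural numbers.\<close>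
  define \<rho> where "\<rho> b = card {a \<in> ?E. lt a b}" for b
  have finE: "finite {a \<in> ?E. lt a b}" for b
  proof -
    have "{a \<in> ?E. lt a b} \<subseteq> below (\<lambda>v. if v \<in> V then edeg V b else 0)"
    proof
      fix a assume a: "a \<in> {a \<in> ?E. lt a b}"
      have "a v \<le> edeg V b" if "v \<in> V" for v
        using member_le_sum[OF that, of a] a fin by (auto simp: edeg_def lt_def)
      then show "a \<in> below (\<lambda>v. if v \<in> V then edeg V b else 0)"
        using a by (auto simp: below_def exponents_def)
    qed
    moreover have "finite (below (\<lambda>v. if v \<in> V then edeg V b else 0))"
      by (intro finite_below[OF fin]) (auto simp: exponents_def)
    ultimately show ?thesis
      by (rule finite_subset)
  qed
  have irrefl: "\<not> lt a a" for a
    by (simp add: lt_def less_fun_irrefl)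
  have trans: "lt a b \<Longrightarrow> lt b c \<Longrightarrow> lt a c" for a b c
    using less_fun_trans[of a b c] by (auto simp: lt_def)
  have mono: "\<rho> a < \<rho> b" if "lt a b" "a \<in> ?E" for a b
  proof -
    have "{x \<in> ?E. lt x a} \<subseteq> {x \<in> ?E. lt x b}"
      using that(1) trans by blast
    moreover have "a \<in> {x \<in> ?E. lt x b}" "a \<notin> {x \<in> ?E. lt x a}"
      using that irrefl by simp_all
    ultimately show ?thesis
      unfolding \<rho>_def by (intro psubset_card_mono finE) blast
  qed
  have total: "lt a b \<or> a = b \<or> lt b a" if "a \<in> ?E" "b \<in> ?E" for a b
  proof -
    \<comment> \<open>\<open>less_fun\<close> compares two functions only if they differ at finitely
      many places; exponents differ inside \<open>V\<close>.\<close>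
    have "{k. a k \<noteq> b k} \<subseteq> V"
    proof
      fix v assume v: "v \<in> {k. a k \<noteq> b k}"
      show "v \<in> V"
      proof (rule ccontr)
        assume "v \<notin> V"
        then have "a v = 0" "b v = 0"
          using that by (simp_all add: exponents_def)
        then show False
          using v by simp
      qed
    qed
    then have "finite {k. a k \<noteq> b k}"
      using fin by (rule finite_subset)
    then show ?thesis
      using less_fun_trichotomy[of a b] by (auto simp: lt_def)
  qed
  have iff: "lt a b \<longleftrightarrow> \<rho> a < \<rho> b" if "a \<in> ?E" "b \<in> ?E" for a b
    using total[OF that] mono[of a b] mono[of b a] that by fastforce
  have "inj_on \<rho> ?E"
  proof (rule inj_onI)
    fix a b assume "a \<in> ?E" "b \<in> ?E" "\<rho> a = \<rho> b"
    then show "a = b"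
      using total[of a b] mono[of a b] mono[of b a] by fastforce
  qed
  moreover have "less_fun (esum a c) (esum b c)" if "less_fun a b" for a b c
    using that unfolding less_fun_def by (simp add: esum_def)
  then have "lt (esum a c) (esum b c)" if "lt a b" for a b c
    using that by (auto simp: lt_def)
  then have "\<forall>a\<in>?E. \<forall>b\<in>?E. \<forall>c\<in>?E. \<rho> a < \<rho> b \<longrightarrow> \<rho> (esum a c) < \<rho> (esum b c)"
    by (simp flip: iff)
  moreover have "\<forall>a\<in>?E. \<forall>b\<in>?E. edeg V a < edeg V b \<longrightarrow> \<rho> a < \<rho> b"
    using mono by (simp add: lt_def)
  ultimately show ?thesis
    by blast
qed

text \<open>Induction on the variables. A finite set \<open>B\<close> dominating all of
  \<open>D\<close> in the old variables also works in the new variable \<open>w\<close> for every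
  \<open>d\<close> whose \<open>w\<close>-entry is large; the finitely many slices with a small
  \<open>w\<close>-entry are treated separately.\<close>

lemma Dickson:
  fixes D :: "('v \<Rightarrow> nat) set"
  assumes "finite V"
  shows "\<exists>B. finite B \<and> B \<subseteq> D \<and> (\<forall>d\<in>D. \<exists>b\<in>B. \<forall>v\<in>V. b v \<le> d v)"
  using assms
proof (induction V arbitrary: D rule: finite_induct)
  case empty
  show ?case
  proof (cases "D = {}")
    case False
    then obtain d where "d \<in> D"
      by blast
    then show ?thesis
      by (intro exI[of _ "{d}"]) auto
  qed auto
next
  case (insert w V)
  obtain B where B: "finite B" "B \<subseteq> D" "\<And>d. d \<in> D \<Longrightarrow> \<exists>b\<in>B. \<forall>v\<in>V. b v \<le> d v"
    using insert.IH[of D] by blast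
  have "\<forall>j. \<exists>C. finite C \<and> C \<subseteq> {d \<in> D. d w = j} \<and>
      (\<forall>d\<in>{d \<in> D. d w = j}. \<exists>b\<in>C. \<forall>v\<in>V. b v \<le> d v)"
    using insert.IH by blast
  then obtain C where "\<forall>j. finite (C j) \<and> C j \<subseteq> {d \<in> D. d w = j} \<and>
      (\<forall>d\<in>{d \<in> D. d w = j}. \<exists>b\<in>C j. \<forall>v\<in>V. b v \<le> d v)"
    by (rule choice[THEN exE])
  then have C: "\<And>j. finite (C j)" "\<And>j. C j \<subseteq> {d \<in> D. d w = j}"
    "\<And>j d. d \<in> D \<Longrightarrow> d w = j \<Longrightarrow> \<exists>b\<in>C j. \<forall>v\<in>V. b v \<le> d v"
    by blast+
  \<comment> \<open>Any bound on the \<open>w\<close>-entries of \<open>B\<close> would do; the sum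
    is one that also makes sense for empty \<open>B\<close>.\<close>
  define N where "N = (\<Sum>b\<in>B. b w)"
  show ?case
  proof (intro exI[of _ "B \<union> (\<Union>j<N. C j)"] conjI ballI)
    show "B \<union> (\<Union>j<N. C j) \<subseteq> D"
      using B C(2) by blast
  next
    fix d assume d: "d \<in> D"
    show "\<exists>b\<in>B \<union> (\<Union>j<N. C j). \<forall>v\<in>insert w V. b v \<le> d v"
    proof (cases "d w < N")
      case True
      obtain b where "b \<in> C (d w)" "\<forall>v\<in>V. b v \<le> d v"
        using C(3)[OF d refl] by blast
      moreover have "b w = d w"
        using C(2) \<open>b \<in> C (d w)\<close> by blast
      ultimately show ?thesis
        using True by (intro bexI[of _ b]) auto
    next
      case False
      obtain b where b: "b \<in> B" "\<forall>v\<in>V. b v \<le> d v"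
        using B(3)[OF d] by blast
      then have "b w \<le> N"
        using member_le_sum[of b B "\<lambda>b. b w"] B(1) by (simp add: N_def)
      then show ?thesis
        using b False by (intro bexI[of _ b]) auto
    qed
  qed (use B C in auto)
qed

locale ranked_series = power_series R V + field R for R (structure) and V :: "'v set" +
  fixes \<rho> :: "('v \<Rightarrow> nat) \<Rightarrow> nat"
  assumes rank_inj: "inj_on \<rho> E"
    and rank_esum: "a \<in> E \<Longrightarrow> b \<in> E \<Longrightarrow> c \<in> E \<Longrightarrow> \<rho> a < \<rho> b \<Longrightarrow> \<rho> (esum a c) < \<rho> (esum b c)"
    and rank_edeg: "a \<in> E \<Longrightarrow> b \<in> E \<Longrightarrow> edeg V a < edeg V b \<Longrightarrow> \<rho> a < \<rho> b"
begin

lemma rank_cases: "a \<in> E \<Longrightarrow> b \<in> E \<Longrightarrow> a = b \<or> \<rho> a < \<rho> b \<or> \<rho> b < \<rho> a"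
  using rank_inj by (metis inj_onD nat_neq_iff)

text \<open>Otherwise \<open>i\<close> would lie above \<open>a\<close> and \<open>j\<close> not
  below \<open>b\<close>, and the sum would grow. This is why the product of two lowest terms cannot
  be cancelled by other terms.\<close>

lemma rank_split:
  assumes "i \<in> E" "j \<in> E" "a \<in> E" "b \<in> E" "esum i j = esum a b" "i \<noteq> a"
  shows "\<rho> i < \<rho> a \<or> \<rho> j < \<rho> b"
proof (rule ccontr)
  assume *: "\<not> ?thesis"
  then have 1: "\<rho> a < \<rho> i"
    using rank_cases[of i a] assms by auto
  have "b = j \<or> \<rho> b < \<rho> j"
    using rank_cases[of b j] assms * by auto
  then have "\<rho> (esum b i) \<le> \<rho> (esum j i)"
    using rank_esum[of b j i] assms by auto
  moreover have "\<rho> (esum a b) < \<rho> (esum i b)"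
    using rank_esum[of a i b] assms 1 by auto
  ultimately show False
    using assms(5) by (simp add: esum_comm)
qed

text \<open>The \<open>N\<close>-th power of the maximal ideal of the series ring, described by
  coefficients.\<close>

definition ord_ge :: "nat \<Rightarrow> (('v \<Rightarrow> nat) \<Rightarrow> 'a) set" where
  "ord_ge N = {s \<in> carrier P. \<forall>m\<in>E. edeg V m < N \<longrightarrow> s m = \<zero>}"

text \<open>The leading monomial is the lowest one, as for a local order; ranks being natural
  numbers, every nonzero series has one.\<close>

definition is_lead :: "(('v \<Rightarrow> nat) \<Rightarrow> 'a) \<Rightarrow> ('v \<Rightarrow> nat) \<Rightarrow> bool" where
  "is_lead s m \<longleftrightarrow> m \<in> E \<and> s m \<noteq> \<zero> \<and> (\<forall>k\<in>E. \<rho> k < \<rho> m \<longrightarrow> s k = \<zero>)"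

definition leads :: "(('v \<Rightarrow> nat) \<Rightarrow> 'a) set \<Rightarrow> ('v \<Rightarrow> nat) set" where
  "leads M = {m. \<exists>s\<in>M. is_lead s m}"

lemma least_rank:
  assumes "m \<in> E" "Q m"
  obtains k where "k \<in> E" "Q k" "\<And>j. j \<in> E \<Longrightarrow> \<rho> j < \<rho> k \<Longrightarrow> \<not> Q j"
  using ex_has_least_nat[of "\<lambda>m. m \<in> E \<and> Q m" m \<rho>] assms by (metis leD)

lemma lead_exists:
  assumes "s \<in> carrier P" "s \<noteq> \<zero>\<^bsub>P\<^esub>"
  shows "\<exists>m. is_lead s m"
proof -
  obtain m where "m \<in> E" "s m \<noteq> \<zero>"
    using assms series_eqI[of s "\<zero>\<^bsub>P\<^esub>"] by auto
  then show ?thesis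
    using least_rank[of m "\<lambda>m. s m \<noteq> \<zero>"] unfolding is_lead_def by metis
qed

text \<open>A nonzero element of \<open>M\<close> has a nonzero coefficient at its own leading
  monomial, which belongs to \<open>leads M\<close>.\<close>

lemma series_zeroI:
  assumes M: "ideal M P" and s: "s \<in> M" and z: "\<And>m. m \<in> leads M \<Longrightarrow> s m = \<zero>"
  shows "s = \<zero>\<^bsub>P\<^esub>"
  using lead_exists[of s] ideal.Icarr[OF M s] s z by (auto simp: leads_def is_lead_def)

text \<open>This is the ideal generated by the variables in \<open>W\<close>: each monomial that
  occurs is divisible by one of them. Modulo it, a series is determined by its \<open>W\<close>-free
  monomials, and the lowest \<open>W\<close>-free terms of two factors multiply to a term that
  survives.\<close>

lemma primeideal_vars:
  "primeideal {s \<in> carrier P. \<forall>m\<in>E. (\<forall>v\<in>W. m v = 0) \<longrightarrow> s m = \<zero>} P" (is "primeideal ?I P")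
proof (rule primeidealI)
  have sub: "(\<forall>v\<in>W. fst x v = 0) \<and> (\<forall>v\<in>W. snd x v = 0)"
    if "x \<in> splits m" "\<forall>v\<in>W. m v = 0" for x m
    using that by (auto simp: splits_def esum_def)
  have mult: "s \<otimes>\<^bsub>P\<^esub> t \<in> ?I" if "s \<in> ?I" "t \<in> carrier P" for s t
  proof -
    have "s (fst x) \<otimes> t (snd x) = \<zero>" if "x \<in> splits m" "m \<in> E" "\<forall>v\<in>W. m v = 0" for x m
      using \<open>s \<in> ?I\<close> \<open>t \<in> carrier P\<close> splits_exponents[OF that(1,2)] sub[OF that(1,3)] by simp
    then show ?thesis
      using that by (auto simp: coeff_mult intro!: finsum_zeroI)
  qed
  show "ideal ?I P"
  proof (rule idealI)
    show "subgroup ?I (add_monoid P)"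
    proof (rule P.add.subgroupI)
      show "?I \<noteq> {}"
        using P_zero_closed by (auto intro: exI[of _ "\<zero>\<^bsub>P\<^esub>"])
    qed (auto simp flip: a_inv_def)
    show "x \<otimes>\<^bsub>P\<^esub> a \<in> ?I" if "a \<in> ?I" "x \<in> carrier P" for a x
      using mult[OF that] P.m_comm[of x a] that by simp
  qed (use mult P.ring_axioms in auto)
  show "carrier P \<noteq> ?I"
  proof
    assume "carrier P = ?I"
    then have "\<one>\<^bsub>P\<^esub> \<in> ?I"
      using P_one_closed by simp
    then have "\<one>\<^bsub>P\<^esub> ezero = \<zero>"
      by simp
    then show False
      by (simp add: coeff_one)
  qed
  show "s \<in> ?I \<or> t \<in> ?I" if s: "s \<in> carrier P" and t: "t \<in> carrier P" and st: "s \<otimes>\<^bsub>P\<^esub> t \<in> ?I" for s t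
  proof (rule ccontr)
    assume *: "\<not> ?thesis"
    obtain m where m: "m \<in> E" "(\<forall>v\<in>W. m v = 0) \<and> s m \<noteq> \<zero>"
      using * s by auto
    obtain a where a: "a \<in> E" "(\<forall>v\<in>W. a v = 0) \<and> s a \<noteq> \<zero>"
      "\<And>j. j \<in> E \<Longrightarrow> \<rho> j < \<rho> a \<Longrightarrow> \<not> ((\<forall>v\<in>W. j v = 0) \<and> s j \<noteq> \<zero>)"
      using least_rank[of m "\<lambda>m. (\<forall>v\<in>W. m v = 0) \<and> s m \<noteq> \<zero>", OF m] by metis
    obtain n where n: "n \<in> E" "(\<forall>v\<in>W. n v = 0) \<and> t n \<noteq> \<zero>"
      using * t by auto
    obtain b where b: "b \<in> E" "(\<forall>v\<in>W. b v = 0) \<and> t b \<noteq> \<zero>"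
      "\<And>j. j \<in> E \<Longrightarrow> \<rho> j < \<rho> b \<Longrightarrow> \<not> ((\<forall>v\<in>W. j v = 0) \<and> t j \<noteq> \<zero>)"
      using least_rank[of n "\<lambda>m. (\<forall>v\<in>W. m v = 0) \<and> t m \<noteq> \<zero>", OF n] by metis
    have ab: "esum a b \<in> E" "\<forall>v\<in>W. esum a b v = 0"
      using a(1,2) b(1,2) by simp (use a(2) b(2) in \<open>simp add: esum_def\<close>)
    \<comment> \<open>In any other splitting of \<open>a + b\<close> one component lies below
      \<open>a\<close> or below \<open>b\<close>, where the \<open>W\<close>-free coefficients of
      \<open>s\<close> and of \<open>t\<close> vanish.\<close>
    have "s (fst x) \<otimes> t (snd x) = \<zero>" if x: "x \<in> splits (esum a b)" "x \<noteq> (a, b)" for x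
    proof -
      obtain i j where ij: "x = (i, j)"
        by force
      then have "esum i j = esum a b" and "i \<noteq> a"
        using x by (auto simp: splits_def)
      moreover have "i \<in> E" "j \<in> E" "\<forall>v\<in>W. i v = 0" "\<forall>v\<in>W. j v = 0"
        using splits_exponents[OF x(1) ab(1)] sub[OF x(1) ab(2)] ij by auto
      ultimately have "s i = \<zero> \<or> t j = \<zero>"
        using rank_split[of i j a b] a b by blast
      then show ?thesis
        using ij s t \<open>i \<in> E\<close> \<open>j \<in> E\<close> by auto
    qed
    then have "(s \<otimes>\<^bsub>P\<^esub> t) (esum a b) = s a \<otimes> t b"
      using finsum_single[of "splits (esum a b)" "(a, b)" "\<lambda>x. s (fst x) \<otimes> t (snd x)"]
        finite_splits[OF finite_vars ab(1)] s t a(1) b(1) ab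
      by (auto simp: coeff_mult splits_def)
    moreover have "s a \<otimes> t b \<noteq> \<zero>"
      using a b s t integral_iff by auto
    ultimately show False
      using st ab by auto
  qed
qed (use P.is_cring in simp)

text \<open>Division with remainder: all coefficients of the quotients are determined by one recursion along
  the monomial order, because \<open>sel\<close> assigns every monomial of \<open>\<Delta>\<close> to a single divisor.\<close>

lemma division:
  assumes B: "finite B" and g: "\<And>\<beta>. \<beta> \<in> B \<Longrightarrow> g \<beta> \<in> carrier P"
    and lead: "\<And>\<beta>. \<beta> \<in> B \<Longrightarrow> is_lead (g \<beta>) \<beta>" "\<And>\<beta>. \<beta> \<in> B \<Longrightarrow> g \<beta> \<beta> = \<one>"
    and sel: "\<Delta> \<subseteq> E" "\<And>\<delta>. \<delta> \<in> \<Delta> \<Longrightarrow> sel \<delta> \<in> B" "\<And>\<delta>. \<delta> \<in> \<Delta> \<Longrightarrow> sel \<delta> \<in> below \<delta>"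
    and w: "w \<in> carrier P"
  shows "\<exists>h. (\<forall>\<beta>\<in>B. h \<beta> \<in> carrier P) \<and> (\<forall>\<delta>\<in>\<Delta>. (\<Oplus>\<^bsub>P\<^esub>\<beta>\<in>B. h \<beta> \<otimes>\<^bsub>P\<^esub> g \<beta>) \<delta> = w \<delta>) \<and>
    (\<forall>N. w \<in> ord_ge N \<longrightarrow> (\<forall>\<beta>\<in>B. \<forall>\<gamma>\<in>E. edeg V \<gamma> + edeg V \<beta> < N \<longrightarrow> h \<beta> \<gamma> = \<zero>))"
proof -
  have BE: "\<beta> \<in> E" if "\<beta> \<in> B" for \<beta>
    using lead that by (auto simp: is_lead_def)
  \<comment> \<open>The unknown \<open>z \<delta>\<close> serves as the coefficient of the quotient
    for \<open>sel \<delta>\<close> at \<open>\<delta> - sel \<delta>\<close>; all other quotient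
    coefficients are zero. The carrier test again gives a default until \<open>z\<close> is known to
    be closed.\<close>
  define H where "H z \<beta> \<gamma> = (if esum \<gamma> \<beta> \<in> \<Delta> \<and> sel (esum \<gamma> \<beta>) = \<beta> \<and> z (esum \<gamma> \<beta>) \<in> carrier R
    then z (esum \<gamma> \<beta>) else \<zero>)" for z and \<beta> \<gamma> :: "'v \<Rightarrow> nat"
  \<comment> \<open>The terms of the coefficient at \<open>\<delta>\<close> that involve only
    unknowns of rank smaller than that of \<open>\<delta>\<close>.\<close>
  define L where "L \<delta> \<beta> = {\<gamma> \<in> below \<delta>. \<rho> (esum \<gamma> \<beta>) < \<rho> \<delta>}" for \<delta> \<beta>
  define S where "S z \<delta> = (\<Oplus>\<beta>\<in>B. \<Oplus>\<gamma>\<in>L \<delta> \<beta>. H z \<beta> \<gamma> \<otimes> g \<beta> (ediff \<delta> \<gamma>))" for z \<delta>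
  define F where "F z \<delta> = (if \<delta> \<in> \<Delta> then w \<delta> \<ominus> S z \<delta> else \<zero>)" for z \<delta>
  have Hc[simp]: "H z \<beta> \<gamma> \<in> carrier R" for z \<beta> \<gamma>
    by (simp add: H_def)
  have inner: "(\<Oplus>\<gamma>\<in>A. H z \<beta> \<gamma> \<otimes> g \<beta> (ediff \<delta> \<gamma>)) \<in> carrier R" if "\<beta> \<in> B" "\<delta> \<in> E" for A z \<beta> \<delta>
    using g[OF that(1)] that by (intro finsum_closed) auto
  have Sc[simp]: "S z \<delta> \<in> carrier R" if "\<delta> \<in> \<Delta>" for z \<delta>
    unfolding S_def using inner that sel by (intro finsum_closed) auto
  have "F f \<delta> = F f' \<delta>" if ff': "\<And>k. \<rho> k < \<rho> \<delta> \<Longrightarrow> f k = f' k" for f f' \<delta>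
  proof (cases "\<delta> \<in> \<Delta>")
    case True
    have "H f \<beta> \<gamma> = H f' \<beta> \<gamma>" if "\<gamma> \<in> L \<delta> \<beta>" for \<beta> \<gamma>
      using that ff' by (simp add: H_def L_def)
    then have "S f \<delta> = S f' \<delta>"
      unfolding S_def using True inner sel(1) g
      by (intro finsum_cong' refl Pi_I) auto
    then show ?thesis
      by (simp add: F_def)
  qed (simp add: F_def)
  then obtain z where z: "\<And>\<delta>. z \<delta> = F z \<delta>"
    using recursive_solution[of \<rho> F] by blast
  have zc: "z \<delta> \<in> carrier R" for \<delta>
    unfolding z[of \<delta>] F_def using sel(1) w by auto
  define h where "h \<beta> = restrict (H z \<beta>) E" for \<beta>
  have h: "h \<beta> \<in> carrier P" for \<beta>
    unfolding h_def by (intro series_closedI) simp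
  have coeff: "(h \<beta> \<otimes>\<^bsub>P\<^esub> g \<beta>) \<delta> = (\<Oplus>\<gamma>\<in>L \<delta> \<beta>. H z \<beta> \<gamma> \<otimes> g \<beta> (ediff \<delta> \<gamma>)) \<oplus> (if sel \<delta> = \<beta> then z \<delta> else \<zero>)"
    if "\<beta> \<in> B" "\<delta> \<in> \<Delta>" for \<beta> \<delta>
  proof -
    note \<beta> = BE[OF that(1)]
    have \<delta>: "\<delta> \<in> E"
      using that sel(1) by blast
    let ?f = "\<lambda>\<gamma>. H z \<beta> \<gamma> \<otimes> g \<beta> (ediff \<delta> \<gamma>)"
    have f: "?f \<gamma> \<in> carrier R" for \<gamma>
      using g[OF that(1)] \<delta> by auto
    have "(h \<beta> \<otimes>\<^bsub>P\<^esub> g \<beta>) \<delta> = finsum R ?f (below \<delta>)"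
      using \<delta> f below_exponents[OF \<delta>] by (auto simp: coeff_mult_below h_def intro!: finsum_cong')
    also have "\<dots> = finsum R ?f (L \<delta> \<beta> \<union> {\<gamma> \<in> below \<delta>. esum \<gamma> \<beta> = \<delta>})"
    proof (rule finsum_neutral_right)
      fix \<gamma> assume \<gamma>: "\<gamma> \<in> below \<delta> - (L \<delta> \<beta> \<union> {\<gamma> \<in> below \<delta>. esum \<gamma> \<beta> = \<delta>})"
      then have \<gamma>E: "\<gamma> \<in> E" and eq: "esum \<gamma> (ediff \<delta> \<gamma>) = \<delta>" and ne: "esum \<gamma> \<beta> \<noteq> \<delta>"
        using below_exponents[OF \<delta>] by auto
      have "\<not> \<rho> (esum \<gamma> \<beta>) < \<rho> \<delta>"
        using \<gamma> by (auto simp: L_def)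
      then have lt: "\<rho> \<delta> < \<rho> (esum \<gamma> \<beta>)"
        using rank_cases[of "esum \<gamma> \<beta>" \<delta>] \<gamma>E \<beta> \<delta> ne by auto
      \<comment> \<open>If \<gamma> + \<beta> comes after \<delta>, the complementary exponent
        \<delta> - \<gamma> lies below the leading exponent \<beta>, where \<open>g \<beta>\<close>
        has no coefficient. Such unknowns do not enter the equation at \<delta>.\<close>
      have "\<not> \<rho> \<beta> < \<rho> (ediff \<delta> \<gamma>)" "\<beta> \<noteq> ediff \<delta> \<gamma>"
        using rank_esum[of \<beta> "ediff \<delta> \<gamma>" \<gamma>] \<beta> \<gamma>E \<delta> eq lt by (auto simp: esum_comm)
      then have "\<rho> (ediff \<delta> \<gamma>) < \<rho> \<beta>"
        using rank_cases[of \<beta> "ediff \<delta> \<gamma>"] \<beta> \<delta> by auto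
      then have "g \<beta> (ediff \<delta> \<gamma>) = \<zero>"
        using lead(1)[OF that(1)] \<delta> by (auto simp: is_lead_def)
      then show "?f \<gamma> = \<zero>"
        by simp
    qed (use finite_below[OF finite_vars \<delta>] f in \<open>auto simp: L_def\<close>)
    also have "\<dots> = finsum R ?f (L \<delta> \<beta>) \<oplus> finsum R ?f {\<gamma> \<in> below \<delta>. esum \<gamma> \<beta> = \<delta>}"
      using finite_below[OF finite_vars \<delta>] f by (intro finsum_Un_disjoint) (auto simp: L_def)
    \<comment> \<open>In the remaining term the coefficient of \<open>g \<beta>\<close> is its
      leading one, which is \<open>\<one>\<close>. So the new unknown \<open>z \<delta>\<close>
      enters the equation at \<delta> exactly once and with coefficient one, namely for
      \<open>\<beta> = sel \<delta>\<close>.\<close>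
    also have "finsum R ?f {\<gamma> \<in> below \<delta>. esum \<gamma> \<beta> = \<delta>} = (if sel \<delta> = \<beta> then z \<delta> else \<zero>)"
    proof (cases "\<beta> \<in> below \<delta>")
      case True
      then have "esum \<gamma> \<beta> = \<delta> \<longleftrightarrow> \<gamma> = ediff \<delta> \<beta>" for \<gamma>
        by auto
      moreover have "ediff \<delta> \<beta> \<in> below \<delta>"
        by (auto simp: below_def ediff_def)
      ultimately have "{\<gamma> \<in> below \<delta>. esum \<gamma> \<beta> = \<delta>} = {ediff \<delta> \<beta>}"
        by auto
      moreover have "ediff \<delta> (ediff \<delta> \<beta>) = \<beta>"
        using True by (auto simp: below_def ediff_def)
      ultimately have "finsum R ?f {\<gamma> \<in> below \<delta>. esum \<gamma> \<beta> = \<delta>} = H z \<beta> (ediff \<delta> \<beta>)"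
        using f[of "ediff \<delta> \<beta>"] lead(2)[OF that(1)] by simp
      then show ?thesis
        using True that zc by (simp add: H_def)
    next
      case False
      then have "{\<gamma> \<in> below \<delta>. esum \<gamma> \<beta> = \<delta>} = {}"
        by auto
      moreover have "sel \<delta> \<noteq> \<beta>"
        using False sel(3)[OF that(2)] by auto
      ultimately show ?thesis
        by (simp only: finsum_empty if_False)
    qed
    finally show ?thesis .
  qed
  have "(\<Oplus>\<^bsub>P\<^esub>\<beta>\<in>B. h \<beta> \<otimes>\<^bsub>P\<^esub> g \<beta>) \<delta> = w \<delta>" if "\<delta> \<in> \<Delta>" for \<delta>
  proof -
    have \<delta>: "\<delta> \<in> E"
      using that sel(1) by blast
    have "(\<Oplus>\<^bsub>P\<^esub>\<beta>\<in>B. h \<beta> \<otimes>\<^bsub>P\<^esub> g \<beta>) \<delta> = (\<Oplus>\<beta>\<in>B. (h \<beta> \<otimes>\<^bsub>P\<^esub> g \<beta>) \<delta>)"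
      using g h B \<delta> by (intro coeff_finsum) auto
    also have "\<dots> = (\<Oplus>\<beta>\<in>B. (\<Oplus>\<gamma>\<in>L \<delta> \<beta>. H z \<beta> \<gamma> \<otimes> g \<beta> (ediff \<delta> \<gamma>)) \<oplus> (if sel \<delta> = \<beta> then z \<delta> else \<zero>))"
      using coeff that inner zc \<delta> by (intro finsum_cong') auto
    also have "\<dots> = S z \<delta> \<oplus> (\<Oplus>\<beta>\<in>B. if sel \<delta> = \<beta> then z \<delta> else \<zero>)"
      unfolding S_def using inner zc \<delta> by (intro finsum_addf) auto
    also have "(\<Oplus>\<beta>\<in>B. if sel \<delta> = \<beta> then z \<delta> else \<zero>) = z \<delta>"
      using finsum_single[of B "sel \<delta>" "\<lambda>\<beta>. if sel \<delta> = \<beta> then z \<delta> else \<zero>"] B sel that zc by auto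
    also have "S z \<delta> \<oplus> z \<delta> = w \<delta>"
    proof -
      have "z \<delta> = w \<delta> \<ominus> S z \<delta>"
        using z[of \<delta>] that by (simp add: F_def)
      moreover have "w \<delta> \<in> carrier R" "S z \<delta> \<in> carrier R"
        using w \<delta> that by auto
      ultimately show ?thesis
        by (simp add: a_minus_def a_lcomm r_neg)
    qed
    finally show ?thesis .
  qed
  \<comment> \<open>The rank refines the degree, so up to degree below \<open>N\<close> the
    recursion only meets zero data. The unknowns of degree below \<open>N\<close> vanish, and the
    quotient loses at most the degree of \<beta> in order.\<close>
  moreover have "h \<beta> \<gamma> = \<zero>" if wN: "w \<in> ord_ge N" and "\<beta> \<in> B" "\<gamma> \<in> E" "edeg V \<gamma> + edeg V \<beta> < N" for N \<beta> \<gamma>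
  proof -
    have "\<delta> \<in> \<Delta> \<Longrightarrow> edeg V \<delta> < N \<Longrightarrow> z \<delta> = \<zero>" for \<delta>
    proof (induction "\<rho> \<delta>" arbitrary: \<delta> rule: less_induct)
      case less
      have \<delta>: "\<delta> \<in> E"
        using less sel(1) by blast
      have "H z \<beta> \<gamma> = \<zero>" if "\<gamma> \<in> L \<delta> \<beta>" "\<beta> \<in> B" for \<beta> \<gamma>
      proof -
        have *: "\<rho> (esum \<gamma> \<beta>) < \<rho> \<delta>" "esum \<gamma> \<beta> \<in> E"
          using that BE below_exponents[OF \<delta>] by (auto simp: L_def)
        then have "edeg V (esum \<gamma> \<beta>) \<le> edeg V \<delta>"
          using rank_edeg[of \<delta> "esum \<gamma> \<beta>"] \<delta> by (metis leI less_asym)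
        then show ?thesis
          using less * by (auto simp: H_def)
      qed
      then have "S z \<delta> = \<zero>"
        unfolding S_def using g \<delta> by (auto intro!: finsum_zeroI)
      then show ?case
        using z[of \<delta>] less wN \<delta> by (simp add: F_def ord_ge_def a_minus_def)
    qed
    then show ?thesis
      using that by (simp add: h_def H_def)
  qed
  ultimately show ?thesis
    using h by blast
qed

end

context ranked_series
begin

lemma leads_exponents: "leads M \<subseteq> E"
  by (auto simp: leads_def is_lead_def)

text \<open>Dickson's lemma yields finitely many leading exponents dividing all others. Over a field
  their series can be made monic, and \<open>sel\<close> chooses one divisor for each leading
  exponent.\<close>

lemma standard_basis:
  assumes M: "ideal M P"
  obtains B g sel where "finite B" "\<And>\<beta>. \<beta> \<in> B \<Longrightarrow> g \<beta> \<in> M"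
    "\<And>\<beta>. \<beta> \<in> B \<Longrightarrow> is_lead (g \<beta>) \<beta>" "\<And>\<beta>. \<beta> \<in> B \<Longrightarrow> g \<beta> \<beta> = \<one>"
    "\<And>\<delta>. \<delta> \<in> leads M \<Longrightarrow> sel \<delta> \<in> B" "\<And>\<delta>. \<delta> \<in> leads M \<Longrightarrow> sel \<delta> \<in> below \<delta>"
proof -
  interpret M: ideal M P by fact
  obtain B where B: "finite B" "B \<subseteq> leads M" "\<forall>\<delta>\<in>leads M. \<exists>\<beta>\<in>B. \<forall>v\<in>V. \<beta> v \<le> \<delta> v"
    using Dickson[OF finite_vars, of "leads M"] by blast
  have "\<exists>s\<in>M. is_lead s \<beta> \<and> s \<beta> = \<one>" if "\<beta> \<in> B" for \<beta>
  proof -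
    have "\<beta> \<in> leads M"
      using that B(2) by blast
    then obtain s where s: "s \<in> M" "is_lead s \<beta>"
      by (auto simp: leads_def)
    have \<beta>: "\<beta> \<in> E" "s \<beta> \<noteq> \<zero>" "s \<in> carrier P"
      using s M.Icarr by (auto simp: is_lead_def)
    then have u: "s \<beta> \<in> Units R"
      by (simp add: field_Units)
    define t where "t = ps_const V R (inv (s \<beta>)) \<otimes>\<^bsub>P\<^esub> s"
    have c: "ps_const V R (inv (s \<beta>)) \<in> carrier P"
      using u by (simp add: ps_const_monom)
    have t: "t m = inv (s \<beta>) \<otimes> s m" if "m \<in> E" for m
      unfolding t_def using u \<beta> that by (intro coeff_const_mult) auto
    have "t \<in> M"
      unfolding t_def using c s by (intro M.I_l_closed) auto
    moreover have "t \<beta> = \<one>"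
      using t \<beta> u by simp
    moreover have "is_lead t \<beta>"
      using s t \<open>t \<beta> = \<one>\<close> u by (auto simp: is_lead_def)
    ultimately show ?thesis
      by blast
  qed
  then obtain g where g: "\<forall>\<beta>\<in>B. g \<beta> \<in> M \<and> is_lead (g \<beta>) \<beta> \<and> g \<beta> \<beta> = \<one>"
    by metis
  obtain sel where sel: "\<forall>\<delta>\<in>leads M. sel \<delta> \<in> B \<and> (\<forall>v\<in>V. sel \<delta> v \<le> \<delta> v)"
    using bchoice[OF B(3)[unfolded Bex_def]] by blast
  have "sel \<delta> \<in> below \<delta>" if "\<delta> \<in> leads M" for \<delta>
  proof -
    have "sel \<delta> \<in> E"
      using sel that B leads_exponents by blast
    then have "sel \<delta> v \<le> \<delta> v" for v
      using sel that by (cases "v \<in> V") (auto simp: exponents_def)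
    then show ?thesis
      by (simp add: below_def)
  qed
  then show ?thesis
    using that[of B g sel] B(1) g sel by blast
qed

lemma ord_ge_I: "s \<in> carrier P \<Longrightarrow> (\<And>m. m \<in> E \<Longrightarrow> edeg V m < N \<Longrightarrow> s m = \<zero>) \<Longrightarrow> s \<in> ord_ge N"
  by (simp add: ord_ge_def)

lemma ord_ge_mult:
  assumes "s \<in> carrier P" "t \<in> carrier P" "\<And>m. m \<in> E \<Longrightarrow> edeg V m < N \<Longrightarrow> s m = \<zero>"
  shows "s \<otimes>\<^bsub>P\<^esub> t \<in> ord_ge N"
  using low_coeff_mult[OF assms] assms(1,2) by (intro ord_ge_I) auto

lemma ord_ge_finsum:
  assumes "finite A" "\<And>a. a \<in> A \<Longrightarrow> f a \<in> ord_ge N"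
  shows "(\<Oplus>\<^bsub>P\<^esub>a\<in>A. f a) \<in> ord_ge N"
proof (rule ord_ge_I)
  have f: "f \<in> A \<rightarrow> carrier P"
    using assms by (auto simp: ord_ge_def)
  then show "(\<Oplus>\<^bsub>P\<^esub>a\<in>A. f a) \<in> carrier P"
    by (rule P.finsum_closed)
  fix m assume "m \<in> E" "edeg V m < N"
  then show "(\<Oplus>\<^bsub>P\<^esub>a\<in>A. f a) m = \<zero>"
    using coeff_finsum[OF assms(1) f] assms(2) by (auto simp: ord_ge_def intro!: finsum_zeroI)
qed

text \<open>The remainder of division by a standard basis. By \<open>series_zeroI\<close> it is the
  only representative of \<open>w\<close> modulo \<open>M\<close> without monomials in
  \<open>leads M\<close>.\<close>

lemma normal_form:
  assumes M: "ideal M P" and w: "w \<in> carrier P"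
  obtains r where "r \<in> carrier P" "w \<ominus>\<^bsub>P\<^esub> r \<in> M" "\<And>\<delta>. \<delta> \<in> leads M \<Longrightarrow> r \<delta> = \<zero>"
proof -
  interpret M: ideal M P by fact
  obtain B g sel where B: "finite B" "\<And>\<beta>. \<beta> \<in> B \<Longrightarrow> g \<beta> \<in> M"
    "\<And>\<beta>. \<beta> \<in> B \<Longrightarrow> is_lead (g \<beta>) \<beta>" "\<And>\<beta>. \<beta> \<in> B \<Longrightarrow> g \<beta> \<beta> = \<one>"
    "\<And>\<delta>. \<delta> \<in> leads M \<Longrightarrow> sel \<delta> \<in> B" "\<And>\<delta>. \<delta> \<in> leads M \<Longrightarrow> sel \<delta> \<in> below \<delta>"
    using standard_basis[OF M] by blast
  have gc: "\<And>\<beta>. \<beta> \<in> B \<Longrightarrow> g \<beta> \<in> carrier P"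
    using B(2) M.Icarr by blast
  obtain h where h: "\<forall>\<beta>\<in>B. h \<beta> \<in> carrier P"
    "\<forall>\<delta>\<in>leads M. (\<Oplus>\<^bsub>P\<^esub>\<beta>\<in>B. h \<beta> \<otimes>\<^bsub>P\<^esub> g \<beta>) \<delta> = w \<delta>"
    using division[OF B(1) gc B(3,4) leads_exponents B(5,6) w] by blast
  define s where "s = (\<Oplus>\<^bsub>P\<^esub>\<beta>\<in>B. h \<beta> \<otimes>\<^bsub>P\<^esub> g \<beta>)"
  have s: "s \<in> M"
    unfolding s_def using h B(2) by (intro M.finsum_ideal_closed M.I_l_closed) auto
  then have sc: "s \<in> carrier P"
    by (rule M.Icarr)
  show ?thesis
  proof (rule that[of "w \<ominus>\<^bsub>P\<^esub> s"])
    have "w \<ominus>\<^bsub>P\<^esub> (w \<ominus>\<^bsub>P\<^esub> s) = s"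
      using w sc by algebra
    then show "w \<ominus>\<^bsub>P\<^esub> (w \<ominus>\<^bsub>P\<^esub> s) \<in> M"
      using s by simp
    show "(w \<ominus>\<^bsub>P\<^esub> s) \<delta> = \<zero>" if "\<delta> \<in> leads M" for \<delta>
    proof -
      have "\<delta> \<in> E" "s \<delta> = w \<delta>"
        using that leads_exponents h(2) by (auto simp: s_def)
      then show ?thesis
        using w sc coeff_closed[OF w] by (simp add: a_minus_def r_neg)
    qed
  qed (use w sc in auto)
qed

text \<open>The Artin-Rees lemma with a linear bound, read off from division by a standard basis of \<open>Q + (t)\<close>.\<close>

lemma Artin_Rees:
  assumes Q: "primeideal Q P" and t: "t \<in> carrier P" "t \<notin> Q"
  shows "\<exists>c. \<forall>N. \<forall>a\<in>carrier P. \<forall>u\<in>Q. t \<otimes>\<^bsub>P\<^esub> a \<ominus>\<^bsub>P\<^esub> u \<in> ord_ge (N + c) \<longrightarrow>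
    (\<exists>u\<in>Q. a \<ominus>\<^bsub>P\<^esub> u \<in> ord_ge N)"
proof -
  interpret Q: primeideal Q P by fact
  define M where "M = Q <+>\<^bsub>P\<^esub> (PIdl\<^bsub>P\<^esub> t)"
  have M: "ideal M P"
    unfolding M_def using Q.is_ideal t P.cgenideal_ideal by (intro P.add_ideals) auto
  interpret M: ideal M P by fact
  have Mmem: "s \<in> M \<longleftrightarrow> (\<exists>u\<in>Q. \<exists>a\<in>carrier P. s = u \<oplus>\<^bsub>P\<^esub> a \<otimes>\<^bsub>P\<^esub> t)" for s
    unfolding M_def set_add_def' cgenideal_def by blast
  obtain B g sel where B: "finite B" "\<And>\<beta>. \<beta> \<in> B \<Longrightarrow> g \<beta> \<in> M"
    "\<And>\<beta>. \<beta> \<in> B \<Longrightarrow> is_lead (g \<beta>) \<beta>" "\<And>\<beta>. \<beta> \<in> B \<Longrightarrow> g \<beta> \<beta> = \<one>"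
    "\<And>\<delta>. \<delta> \<in> leads M \<Longrightarrow> sel \<delta> \<in> B" "\<And>\<delta>. \<delta> \<in> leads M \<Longrightarrow> sel \<delta> \<in> below \<delta>"
    using standard_basis[OF M] by blast
  have gc: "\<And>\<beta>. \<beta> \<in> B \<Longrightarrow> g \<beta> \<in> carrier P"
    using B(2) M.Icarr by blast
  have "\<forall>\<beta>\<in>B. \<exists>x. fst x \<in> Q \<and> snd x \<in> carrier P \<and> g \<beta> = fst x \<oplus>\<^bsub>P\<^esub> snd x \<otimes>\<^bsub>P\<^esub> t"
  proof
    fix \<beta> assume "\<beta> \<in> B"
    then obtain u a where "u \<in> Q" "a \<in> carrier P" "g \<beta> = u \<oplus>\<^bsub>P\<^esub> a \<otimes>\<^bsub>P\<^esub> t"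
      using B(2) Mmem[of "g \<beta>"] by blast
    then show "\<exists>x. fst x \<in> Q \<and> snd x \<in> carrier P \<and> g \<beta> = fst x \<oplus>\<^bsub>P\<^esub> snd x \<otimes>\<^bsub>P\<^esub> t"
      by (intro exI[of _ "(u, a)"]) simp
  qed
  then obtain x where x: "\<forall>\<beta>\<in>B. fst (x \<beta>) \<in> Q \<and> snd (x \<beta>) \<in> carrier P \<and> g \<beta> = fst (x \<beta>) \<oplus>\<^bsub>P\<^esub> snd (x \<beta>) \<otimes>\<^bsub>P\<^esub> t"
    by (rule bchoice[THEN exE])
  define q a where "q \<beta> = fst (x \<beta>)" and "a \<beta> = snd (x \<beta>)" for \<beta>
  have q: "q \<beta> \<in> Q" "q \<beta> \<in> carrier P" and a: "a \<beta> \<in> carrier P" and gqa: "g \<beta> = q \<beta> \<oplus>\<^bsub>P\<^esub> a \<beta> \<otimes>\<^bsub>P\<^esub> t"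
    if "\<beta> \<in> B" for \<beta>
    using x that Q.Icarr by (auto simp: q_def a_def)
  \<comment> \<open>Division by a basis element lowers the order by at most the degree of its
    leading exponent; the sum bounds all these degrees and does not depend on
    \<open>N\<close>.\<close>
  define c where "c = (\<Sum>\<beta>\<in>B. edeg V \<beta>)"
  have cB: "edeg V \<beta> \<le> c" if "\<beta> \<in> B" for \<beta>
    unfolding c_def by (rule member_le_sum[OF that]) (use B(1) in auto)
  have "\<exists>u'\<in>Q. b \<ominus>\<^bsub>P\<^esub> u' \<in> ord_ge N"
    if b: "b \<in> carrier P" and u: "u \<in> Q" and w: "t \<otimes>\<^bsub>P\<^esub> b \<ominus>\<^bsub>P\<^esub> u \<in> ord_ge (N + c)" for N b u
  proof -
    define w where "w = t \<otimes>\<^bsub>P\<^esub> b \<ominus>\<^bsub>P\<^esub> u"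
    have uc: "u \<in> carrier P"
      using u Q.Icarr by blast
    have wc: "w \<in> carrier P"
      using b uc t by (simp add: w_def)
    have wN: "w \<in> ord_ge (N + c)"
      using that by (simp add: w_def)
    obtain h where h: "\<forall>\<beta>\<in>B. h \<beta> \<in> carrier P"
      "\<forall>\<delta>\<in>leads M. (\<Oplus>\<^bsub>P\<^esub>\<beta>\<in>B. h \<beta> \<otimes>\<^bsub>P\<^esub> g \<beta>) \<delta> = w \<delta>"
      and hord: "\<forall>N. w \<in> ord_ge N \<longrightarrow> (\<forall>\<beta>\<in>B. \<forall>\<gamma>\<in>E. edeg V \<gamma> + edeg V \<beta> < N \<longrightarrow> h \<beta> \<gamma> = \<zero>)"
      using division[OF B(1) gc B(3,4) leads_exponents B(5,6) wc] by blast
    have hc: "\<And>\<beta>. \<beta> \<in> B \<Longrightarrow> h \<beta> \<in> carrier P"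
      using h by blast
    define sq where "sq = (\<Oplus>\<^bsub>P\<^esub>\<beta>\<in>B. h \<beta> \<otimes>\<^bsub>P\<^esub> q \<beta>)"
    define sa where "sa = (\<Oplus>\<^bsub>P\<^esub>\<beta>\<in>B. h \<beta> \<otimes>\<^bsub>P\<^esub> a \<beta>)"
    have sqQ: "sq \<in> Q"
      unfolding sq_def using q hc by (intro Q.finsum_ideal_closed Q.I_l_closed)
    then have sq: "sq \<in> carrier P"
      by (rule Q.Icarr)
    have sa: "sa \<in> carrier P"
      unfolding sa_def using a hc by (intro P.finsum_closed) auto
    have hN: "h \<beta> \<otimes>\<^bsub>P\<^esub> a \<beta> \<in> ord_ge N" if \<beta>: "\<beta> \<in> B" for \<beta>
    proof (rule ord_ge_mult[OF hc[OF \<beta>] a[OF \<beta>]])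
      fix m assume m: "m \<in> E" "edeg V m < N"
      show "h \<beta> m = \<zero>"
        using hord[rule_format, OF wN \<beta> m(1)] m(2) cB[OF \<beta>] by linarith
    qed
    have saN: "sa \<in> ord_ge N"
      unfolding sa_def using B(1) hN by (rule ord_ge_finsum)
    have "(\<Oplus>\<^bsub>P\<^esub>\<beta>\<in>B. h \<beta> \<otimes>\<^bsub>P\<^esub> g \<beta>) = (\<Oplus>\<^bsub>P\<^esub>\<beta>\<in>B. h \<beta> \<otimes>\<^bsub>P\<^esub> q \<beta> \<oplus>\<^bsub>P\<^esub> (h \<beta> \<otimes>\<^bsub>P\<^esub> a \<beta>) \<otimes>\<^bsub>P\<^esub> t)"
      using hc q a t gqa by (intro P.finsum_cong') (auto simp: P.r_distr P.m_assoc)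
    also have "\<dots> = sq \<oplus>\<^bsub>P\<^esub> (\<Oplus>\<^bsub>P\<^esub>\<beta>\<in>B. (h \<beta> \<otimes>\<^bsub>P\<^esub> a \<beta>) \<otimes>\<^bsub>P\<^esub> t)"
      unfolding sq_def using hc q a t by (intro P.finsum_addf) auto
    also have "(\<Oplus>\<^bsub>P\<^esub>\<beta>\<in>B. (h \<beta> \<otimes>\<^bsub>P\<^esub> a \<beta>) \<otimes>\<^bsub>P\<^esub> t) = sa \<otimes>\<^bsub>P\<^esub> t"
      unfolding sa_def using B(1) hc a t by (intro P.finsum_ldistr[symmetric]) auto
    finally have sum: "(\<Oplus>\<^bsub>P\<^esub>\<beta>\<in>B. h \<beta> \<otimes>\<^bsub>P\<^esub> g \<beta>) = sq \<oplus>\<^bsub>P\<^esub> sa \<otimes>\<^bsub>P\<^esub> t" .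
    \<comment> \<open>The remainder of \<open>w\<close>. It lies in \<open>M\<close>, as
      \<open>w\<close> and the combination do, and has no coefficient on \<open>leads M\<close>;
      hence it is zero.\<close>
    define r where "r = w \<ominus>\<^bsub>P\<^esub> (sq \<oplus>\<^bsub>P\<^esub> sa \<otimes>\<^bsub>P\<^esub> t)"
    have "r = \<ominus>\<^bsub>P\<^esub> (u \<oplus>\<^bsub>P\<^esub> sq) \<oplus>\<^bsub>P\<^esub> (b \<ominus>\<^bsub>P\<^esub> sa) \<otimes>\<^bsub>P\<^esub> t"
      unfolding r_def w_def using b uc t sq sa by algebra
    moreover have "\<ominus>\<^bsub>P\<^esub> (u \<oplus>\<^bsub>P\<^esub> sq) \<in> Q" "b \<ominus>\<^bsub>P\<^esub> sa \<in> carrier P"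
      using u sqQ b sa by (auto intro: Q.a_closed)
    ultimately have "r \<in> M"
      unfolding Mmem by blast
    moreover have "r \<delta> = \<zero>" if "\<delta> \<in> leads M" for \<delta>
    proof -
      have \<delta>: "\<delta> \<in> E"
        using that leads_exponents by blast
      have "(sq \<oplus>\<^bsub>P\<^esub> sa \<otimes>\<^bsub>P\<^esub> t) \<delta> = w \<delta>"
        using h(2) that sum by simp
      then show ?thesis
        unfolding r_def using wc sq sa t \<delta> coeff_closed[OF wc \<delta>]
        by (subst coeff_diff) (auto simp: a_minus_def r_neg simp del: coeff_add)
    qed
    ultimately have "r = \<zero>\<^bsub>P\<^esub>"
      using series_zeroI[OF M] by blast
    \<comment> \<open>Sorting the expansion of \<open>w\<close> into its parts in \<open>Q\<close>
      and in \<open>(t)\<close> puts \<open>t\<close> times \<open>b - sa\<close> into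
      \<open>Q\<close>. As \<open>t\<close> is outside the prime \<open>Q\<close>, the series
      \<open>b\<close> is congruent to \<open>sa\<close>, whose order is at least
      \<open>N\<close>.\<close>
    have "t \<otimes>\<^bsub>P\<^esub> (b \<ominus>\<^bsub>P\<^esub> sa) = u \<oplus>\<^bsub>P\<^esub> sq \<oplus>\<^bsub>P\<^esub> r"
      unfolding r_def w_def using b uc t sq sa by algebra
    also have "\<dots> = u \<oplus>\<^bsub>P\<^esub> sq"
      using \<open>r = \<zero>\<^bsub>P\<^esub>\<close> uc sq by simp
    finally have "t \<otimes>\<^bsub>P\<^esub> (b \<ominus>\<^bsub>P\<^esub> sa) \<in> Q"
      using u sqQ by (simp add: Q.a_closed)
    then have "b \<ominus>\<^bsub>P\<^esub> sa \<in> Q"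
      using Q.I_prime[OF t(1)] t(2) b sa by blast
    moreover have "b \<ominus>\<^bsub>P\<^esub> (b \<ominus>\<^bsub>P\<^esub> sa) = sa"
      using b sa by algebra
    ultimately show ?thesis
      using saN by (intro bexI[of _ "b \<ominus>\<^bsub>P\<^esub> sa"]) auto
  qed
  then show ?thesis
    by blast
qed

section \<open>Hilbert functions and lengths of chains of primes\<close>

text \<open>For an ideal \<open>M\<close> these monomials represent a basis of S/(M + m^N), with m
  the maximal ideal of the series ring. Their number is the value at \<open>N\<close> of the
  Hilbert-Samuel function of S/M.\<close>

definition standard :: "(('v \<Rightarrow> nat) \<Rightarrow> 'a) set \<Rightarrow> nat \<Rightarrow> ('v \<Rightarrow> nat) set" where
  "standard M N = {m \<in> E. edeg V m < N \<and> m \<notin> leads M}"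

lemma finite_standard: "finite (standard M N)"
  using finite_edeg[of N] by (rule finite_subset[rotated]) (auto simp: standard_def)

text \<open>In degrees below \<open>N\<close> the series \<open>s\<close> and \<open>u\<close>
  agree. The leading monomial of \<open>s\<close> has such a degree, and so have all monomials of
  smaller rank; it would therefore lead \<open>u\<close>, an element of \<open>M\<close>, although
  it is standard.\<close>

lemma standard_independent:
  assumes M: "ideal M P" and s: "s \<in> carrier P" "\<And>m. m \<in> E \<Longrightarrow> m \<notin> standard M N \<Longrightarrow> s m = \<zero>"
    and u: "u \<in> M" "s \<ominus>\<^bsub>P\<^esub> u \<in> ord_ge N"
  shows "s = \<zero>\<^bsub>P\<^esub>"
proof (rule ccontr)
  assume "s \<noteq> \<zero>\<^bsub>P\<^esub>"
  then obtain m where m: "is_lead s m"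
    using lead_exists s by blast
  then have mE: "m \<in> E" "s m \<noteq> \<zero>"
    by (auto simp: is_lead_def)
  then have st: "m \<in> standard M N"
    using s by blast
  have uc: "u \<in> carrier P"
    using u ideal.Icarr[OF M] by blast
  have eq: "u k = s k" if "k \<in> E" "edeg V k < N" for k
  proof -
    have "s k \<ominus> u k = \<zero>"
      using u that s uc by (auto simp: ord_ge_def)
    then show ?thesis
      using that s uc by simp
  qed
  have "is_lead u m"
    unfolding is_lead_def
  proof (intro conjI ballI impI)
    show "u m \<noteq> \<zero>"
      using eq[of m] mE st by (simp add: standard_def)
    fix k assume k: "k \<in> E" "\<rho> k < \<rho> m"
    have "edeg V k \<le> edeg V m"
      using rank_edeg[of m k] k mE by (metis leI less_asym)
    then have "u k = s k"
      using eq[of k] k st by (simp add: standard_def)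
    then show "u k = \<zero>"
      using m k by (simp add: is_lead_def)
  qed (use mE in auto)
  then have "m \<in> leads M"
    using u by (auto simp: leads_def)
  then show False
    using st by (simp add: standard_def)
qed

text \<open>For \<open>t \<in> Q2 - Q1\<close>, multiplication by \<open>t\<close> embeds \<open>S/Q1\<close> into itself with cokernel mapping onto \<open>S/Q2\<close>.\<close>

lemma Hilbert_function_step:
  assumes Q1: "primeideal Q1 P" and Q2: "ideal Q2 P" and sub: "Q1 \<subset> Q2"
  shows "\<exists>c. \<forall>N. card (standard Q1 N) + card (standard Q2 (N + c)) \<le> card (standard Q1 (N + c))"
proof -
  interpret Q1: primeideal Q1 P by fact
  interpret Q2: ideal Q2 P by fact
  obtain t where t: "t \<in> Q2" "t \<notin> Q1" "t \<in> carrier P"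
    using sub Q2.Icarr by blast
  obtain c where c: "\<And>N a u. a \<in> carrier P \<Longrightarrow> u \<in> Q1 \<Longrightarrow> t \<otimes>\<^bsub>P\<^esub> a \<ominus>\<^bsub>P\<^esub> u \<in> ord_ge (N + c) \<Longrightarrow>
      \<exists>u\<in>Q1. a \<ominus>\<^bsub>P\<^esub> u \<in> ord_ge N"
    using Artin_Rees[OF Q1 t(3,2)] by blast
  have "card (standard Q1 N) + card (standard Q2 (N + c)) \<le> card (standard Q1 (N + c))" for N
  proof (rule ccontr)
    assume *: "\<not> ?thesis"
    define A1 A2 B where "A1 = standard Q1 N" and "A2 = standard Q2 (N + c)" and "B = standard Q1 (N + c)"
    have fin: "finite A1" "finite A2" "finite B"
      by (simp_all add: A1_def A2_def B_def finite_standard)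
    have sE: "A1 \<subseteq> E" "A2 \<subseteq> E" "B \<subseteq> E"
      by (auto simp: A1_def A2_def B_def standard_def)
    \<comment> \<open>The images under multiplication by \<open>t\<close> of a basis for
      \<open>Q1\<close>, together with a basis for \<open>Q2\<close>. The claim is that these
      elements are independent modulo \<open>Q1\<close> up to order \<open>N + c\<close>.\<close>
    define e where "e a = (case a of Inl m \<Rightarrow> t \<otimes>\<^bsub>P\<^esub> pmonom \<one> m | Inr m \<Rightarrow> pmonom \<one> m)" for a
    have e: "e a \<in> carrier P" for a
      using t by (auto simp: e_def split: sum.split)
    have "\<exists>r. r \<in> carrier P \<and> e a \<ominus>\<^bsub>P\<^esub> r \<in> Q1 \<and> (\<forall>\<delta>\<in>leads Q1. r \<delta> = \<zero>)" for a
      using normal_form[OF Q1.is_ideal e[of a]] by metis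
    then obtain nf where nf: "\<And>a. nf a \<in> carrier P" "\<And>a. e a \<ominus>\<^bsub>P\<^esub> nf a \<in> Q1"
      "\<And>a \<delta>. \<delta> \<in> leads Q1 \<Longrightarrow> nf a \<delta> = \<zero>"
      by metis
    \<comment> \<open>Modulo the zero ideal of the field, elimination is linear algebra over
      \<open>R\<close>: if there are more normal forms than monomials in \<open>B\<close>, some
      combination \<open>s\<close> of them vanishes on \<open>B\<close>, hence in all degrees below
      \<open>N + c\<close>.\<close>
    interpret Z: primeideal "{\<zero>}" R
      by (rule zeroprimeideal)
    have "card B < card (A1 <+> A2)"
      using * fin by (simp add: A1_def A2_def B_def card_Plus)
    then have "\<exists>y\<in>(A1 <+> A2) \<rightarrow> carrier R. (\<exists>a\<in>A1 <+> A2. y a \<notin> {\<zero>}) \<and>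
        (\<forall>b\<in>B. (\<Oplus>a\<in>A1 <+> A2. y a \<otimes> nf a b) \<in> {\<zero>})"
      using fin nf(1) sE(3) by (intro Z.dependent_rows) auto
    then obtain y where y: "y \<in> (A1 <+> A2) \<rightarrow> carrier R" "\<exists>a\<in>A1 <+> A2. y a \<noteq> \<zero>"
      "\<And>b. b \<in> B \<Longrightarrow> (\<Oplus>a\<in>A1 <+> A2. y a \<otimes> nf a b) = \<zero>"
      by auto
    have yc: "y (Inl m) \<in> carrier R" if "m \<in> A1" for m
      using y(1) that by auto
    have yc': "y (Inr m) \<in> carrier R" if "m \<in> A2" for m
      using y(1) that by auto
    let ?k = "\<lambda>a. ps_const V R (y a)"
    have k: "?k a \<in> carrier P" if "a \<in> A1 <+> A2" for a
      using y(1) that by (auto simp: ps_const_monom)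
    have finA: "finite (A1 <+> A2)"
      using fin by simp
    define s where "s = (\<Oplus>\<^bsub>P\<^esub>a\<in>A1 <+> A2. ?k a \<otimes>\<^bsub>P\<^esub> nf a)"
    define d where "d = (\<Oplus>\<^bsub>P\<^esub>a\<in>A1 <+> A2. ?k a \<otimes>\<^bsub>P\<^esub> (e a \<ominus>\<^bsub>P\<^esub> nf a))"
    define f where "f = (\<Oplus>\<^bsub>P\<^esub>m\<in>A1. pmonom (y (Inl m)) m)"
    define g where "g = (\<Oplus>\<^bsub>P\<^esub>m\<in>A2. pmonom (y (Inr m)) m)"
    have dQ: "d \<in> Q1"
      unfolding d_def using k nf(2) by (intro Q1.finsum_ideal_closed Q1.I_l_closed)
    then have d: "d \<in> carrier P"
      by (rule Q1.Icarr)
    have s: "s \<in> carrier P"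
      unfolding s_def using k nf(1) by (intro P.finsum_closed) auto
    have f: "f \<in> carrier P" and g: "g \<in> carrier P"
      unfolding f_def g_def using yc yc' by (auto intro!: P.finsum_closed)
    have fm: "f m = (if m \<in> A1 then y (Inl m) else \<zero>)" if "m \<in> E" for m
      unfolding f_def using fin(1) sE(1) yc that by (rule finsum_pmonom)
    have gm: "g m = (if m \<in> A2 then y (Inr m) else \<zero>)" if "m \<in> E" for m
      unfolding g_def using fin(2) sE(2) yc' that by (rule finsum_pmonom)
    have "d \<oplus>\<^bsub>P\<^esub> s = (\<Oplus>\<^bsub>P\<^esub>a\<in>A1 <+> A2. ?k a \<otimes>\<^bsub>P\<^esub> (e a \<ominus>\<^bsub>P\<^esub> nf a) \<oplus>\<^bsub>P\<^esub> ?k a \<otimes>\<^bsub>P\<^esub> nf a)"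
      unfolding d_def s_def using k nf(1) e by (intro P.finsum_addf[symmetric]) auto
    also have "\<dots> = (\<Oplus>\<^bsub>P\<^esub>a\<in>A1 <+> A2. ?k a \<otimes>\<^bsub>P\<^esub> e a)"
    proof (rule P.finsum_cong')
      fix a assume a: "a \<in> A1 <+> A2"
      show "?k a \<otimes>\<^bsub>P\<^esub> (e a \<ominus>\<^bsub>P\<^esub> nf a) \<oplus>\<^bsub>P\<^esub> ?k a \<otimes>\<^bsub>P\<^esub> nf a = ?k a \<otimes>\<^bsub>P\<^esub> e a"
        using k[OF a] e[of a] nf(1)[of a] by algebra
    qed (use k e in auto)
    also have "\<dots> = (\<Oplus>\<^bsub>P\<^esub>a\<in>Inl ` A1. ?k a \<otimes>\<^bsub>P\<^esub> e a) \<oplus>\<^bsub>P\<^esub> (\<Oplus>\<^bsub>P\<^esub>a\<in>Inr ` A2. ?k a \<otimes>\<^bsub>P\<^esub> e a)"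
      unfolding Plus_def using k e fin by (intro P.finsum_Un_disjoint) (auto simp: Plus_def)
    also have "(\<Oplus>\<^bsub>P\<^esub>a\<in>Inl ` A1. ?k a \<otimes>\<^bsub>P\<^esub> e a) = (\<Oplus>\<^bsub>P\<^esub>m\<in>A1. ?k (Inl m) \<otimes>\<^bsub>P\<^esub> e (Inl m))"
      using k e by (intro P.finsum_reindex) (auto simp: inj_on_def)
    also have "\<dots> = (\<Oplus>\<^bsub>P\<^esub>m\<in>A1. t \<otimes>\<^bsub>P\<^esub> pmonom (y (Inl m)) m)"
    proof (rule P.finsum_cong')
      fix m assume m: "m \<in> A1"
      have "?k (Inl m) \<otimes>\<^bsub>P\<^esub> pmonom \<one> m = pmonom (y (Inl m)) m"
        using yc[OF m] sE m by (subst ps_const_monom, subst monom_mult) auto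
      moreover have "?k (Inl m) \<in> carrier P" "pmonom \<one> m \<in> carrier P"
        using k m by auto
      ultimately show "?k (Inl m) \<otimes>\<^bsub>P\<^esub> e (Inl m) = t \<otimes>\<^bsub>P\<^esub> pmonom (y (Inl m)) m"
        using t(3) by (simp add: e_def P.m_lcomm)
    qed (use t yc in auto)
    also have "\<dots> = t \<otimes>\<^bsub>P\<^esub> f"
      unfolding f_def using fin t yc by (intro P.finsum_rdistr[symmetric]) auto
    also have "(\<Oplus>\<^bsub>P\<^esub>a\<in>Inr ` A2. ?k a \<otimes>\<^bsub>P\<^esub> e a) = (\<Oplus>\<^bsub>P\<^esub>m\<in>A2. ?k (Inr m) \<otimes>\<^bsub>P\<^esub> e (Inr m))"
      using k e by (intro P.finsum_reindex) (auto simp: inj_on_def)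
    also have "\<dots> = g"
      unfolding g_def
    proof (rule P.finsum_cong')
      fix m assume m: "m \<in> A2"
      show "?k (Inr m) \<otimes>\<^bsub>P\<^esub> e (Inr m) = pmonom (y (Inr m)) m"
        unfolding e_def sum.case using yc'[OF m] sE m by (subst ps_const_monom, subst monom_mult) auto
    qed (use yc' in auto)
    finally have ds: "d \<oplus>\<^bsub>P\<^esub> s = t \<otimes>\<^bsub>P\<^esub> f \<oplus>\<^bsub>P\<^esub> g" .
    have sN: "s \<in> ord_ge (N + c)"
    proof (rule ord_ge_I[OF s])
      fix m assume m: "m \<in> E" "edeg V m < N + c"
      have "s m = (\<Oplus>a\<in>A1 <+> A2. (?k a \<otimes>\<^bsub>P\<^esub> nf a) m)"
        unfolding s_def using finA k nf(1) m by (intro coeff_finsum) auto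
      also have "\<dots> = (\<Oplus>a\<in>A1 <+> A2. y a \<otimes> nf a m)"
        using y(1) nf(1) m by (intro finsum_cong' coeff_const_mult) auto
      also have "\<dots> = \<zero>"
      proof (cases "m \<in> leads Q1")
        case True
        have "y a \<otimes> nf a m = \<zero>" if "a \<in> A1 <+> A2" for a
          using nf(3)[OF True] funcset_mem[OF y(1) that] by simp
        then show ?thesis
          by (rule finsum_zeroI)
      next
        case False
        then show ?thesis
          using y(3)[of m] m by (auto simp: B_def standard_def)
      qed
      finally show "s m = \<zero>" .
    qed
    \<comment> \<open>Modulo \<open>Q2\<close> both \<open>d\<close> and the multiple of
      \<open>t\<close> disappear, so \<open>g\<close> alone lies in \<open>Q2\<close> up to order
      \<open>N + c\<close>, and its coefficients vanish.\<close>
    have "g \<ominus>\<^bsub>P\<^esub> (d \<ominus>\<^bsub>P\<^esub> t \<otimes>\<^bsub>P\<^esub> f) = t \<otimes>\<^bsub>P\<^esub> f \<oplus>\<^bsub>P\<^esub> g \<ominus>\<^bsub>P\<^esub> d"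
      using g d t f by algebra
    also have "\<dots> = d \<oplus>\<^bsub>P\<^esub> s \<ominus>\<^bsub>P\<^esub> d"
      by (simp only: ds)
    also have "\<dots> = s"
      using d s by algebra
    finally have "g \<ominus>\<^bsub>P\<^esub> (d \<ominus>\<^bsub>P\<^esub> t \<otimes>\<^bsub>P\<^esub> f) \<in> ord_ge (N + c)"
      using sN by simp
    moreover have "d \<ominus>\<^bsub>P\<^esub> t \<otimes>\<^bsub>P\<^esub> f \<in> Q2"
      using dQ sub t f Q2.I_r_closed[of t f] by (auto simp: a_minus_def intro!: Q2.a_closed)
    moreover have "g m = \<zero>" if "m \<in> E" "m \<notin> standard Q2 (N + c)" for m
      using that gm by (simp add: A2_def)
    ultimately have g0: "g = \<zero>\<^bsub>P\<^esub>"
      using standard_independent[OF Q2 g] by blast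
    \<comment> \<open>With \<open>g\<close> gone, \<open>t f\<close> lies in \<open>Q1\<close> up to
      order \<open>N + c\<close>. The Artin-Rees bound cancels \<open>t\<close> at the cost of
      \<open>c\<close>, so \<open>f\<close> lies in \<open>Q1\<close> up to order
      \<open>N\<close>.\<close>
    have "d \<oplus>\<^bsub>P\<^esub> s \<ominus>\<^bsub>P\<^esub> d = s"
      using d s by algebra
    then have "t \<otimes>\<^bsub>P\<^esub> f \<ominus>\<^bsub>P\<^esub> d = s"
      using ds t f g0 by simp
    then obtain u where "u \<in> Q1" "f \<ominus>\<^bsub>P\<^esub> u \<in> ord_ge N"
      using c[OF f dQ, of N] sN by auto
    moreover have "f m = \<zero>" if "m \<in> E" "m \<notin> standard Q1 N" for m
      using that fm by (simp add: A1_def)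
    ultimately have f0: "f = \<zero>\<^bsub>P\<^esub>"
      using standard_independent[OF Q1.is_ideal f] by blast
    have "y (Inl m) = \<zero>" if "m \<in> A1" for m
      using fm[of m] f0 that sE by auto
    moreover have "y (Inr m) = \<zero>" if "m \<in> A2" for m
      using gm[of m] g0 that sE by auto
    ultimately show False
      using y(2) by auto
  qed
  then show ?thesis
    by blast
qed

lemma standard_mono: "N \<le> N' \<Longrightarrow> standard M N \<subseteq> standard M N'"
  by (auto simp: standard_def)

text \<open>Going down one step in the chain sums up: the increments of the Hilbert function of
  \<open>Q i\<close> dominate values of that of \<open>Q (Suc i)\<close>, and Pascal's rule turns
  the lower bound \<open>N choose j\<close> into \<open>N choose Suc j\<close>. The argument is
  stretched by a factor \<open>D\<close> at each step.\<close>

lemma Hilbert_function_chain: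
  assumes prime: "\<And>i. i \<le> l \<Longrightarrow> primeideal (Q i) P" and chain: "\<And>i. i < l \<Longrightarrow> Q i \<subset> Q (Suc i)"
  shows "j \<le> l \<Longrightarrow> \<exists>D. \<forall>N. N choose j \<le> card (standard (Q (l - j)) (D * Suc N))"
proof (induction j)
  case 0
  interpret Ql: primeideal "Q l" P
    using prime by simp
  \<comment> \<open>An element led by the constant monomial would be a unit of the proper ideal
    \<open>Q l\<close>. So the monomial 1 is standard, which is the bound for
    \<open>j = 0\<close>.\<close>
  have "ezero \<notin> leads (Q l)"
  proof
    assume "ezero \<in> leads (Q l)"
    then obtain s where s: "s \<in> Q l" "s ezero \<noteq> \<zero>"
      by (auto simp: leads_def is_lead_def)
    then have "s \<in> Units P"
      using Ql.Icarr by (intro series_Units) (auto simp: field_Units)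
    then have "\<one>\<^bsub>P\<^esub> \<in> Q l"
      using Ql.I_l_closed[OF s(1), of "inv\<^bsub>P\<^esub> s"] by auto
    then show False
      using Ql.one_imp_carrier Ql.I_notcarr by blast
  qed
  then have "ezero \<in> standard (Q l) (1 * Suc N)" for N
    by (simp add: standard_def)
  then have "1 \<le> card (standard (Q l) (1 * Suc N))" for N
    using finite_standard[of "Q l" "1 * Suc N"] by (metis One_nat_def Suc_leI card_gt_0_iff empty_iff)
  then show ?case
    by (intro exI[of _ 1]) simp
next
  case (Suc j)
  then obtain D where D: "\<And>N. N choose j \<le> card (standard (Q (l - j)) (D * Suc N))"
    by auto
  define i where "i = l - Suc j"
  have i: "Suc i = l - j" "i < l"
    using Suc.prems by (auto simp: i_def)
  obtain c where c: "\<And>N. card (standard (Q i) N) + card (standard (Q (Suc i)) (N + c)) \<le> card (standard (Q i) (N + c))"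
    using Hilbert_function_step[of "Q i" "Q (Suc i)"] prime[of i] prime[of "Suc i"] chain[of i] i
    by (auto simp: primeideal_def)
  \<comment> \<open>One step length that covers both the shift \<open>c\<close> of the present
    comparison and the scale \<open>D\<close> of the previous bound.\<close>
  define D' where "D' = D + c"
  have mono: "card (standard M N) \<le> card (standard M N')" if "N \<le> N'" for M N N'
    using standard_mono[OF that] finite_standard by (rule card_mono[rotated])
  have step: "card (standard (Q i) N) + card (standard (Q (Suc i)) (N + D')) \<le> card (standard (Q i) (N + D'))" for N
    using c[of "N + D"] mono[of N "N + D" "Q i"] by (simp add: D'_def add.assoc)
  have "N choose Suc j \<le> card (standard (Q i) (D' * Suc N))" for N
  proof (induction N)
    case (Suc N)
    have "Suc N choose Suc j \<le> (N choose Suc j) + (Suc N choose j)"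
      by (cases j) simp_all
    also have "\<dots> \<le> card (standard (Q i) (D' * Suc N)) + card (standard (Q (Suc i)) (D * Suc (Suc N)))"
      using Suc D[of "Suc N"] i by (intro add_mono) auto
    also have "\<dots> \<le> card (standard (Q i) (D' * Suc N)) + card (standard (Q (Suc i)) (D' * Suc N + D'))"
      by (intro add_left_mono mono) (simp add: D'_def algebra_simps)
    also have "\<dots> \<le> card (standard (Q i) (D' * Suc (Suc N)))"
      using step[of "D' * Suc N"] by (simp add: algebra_simps)
    finally show ?case .
  qed simp
  then show ?case
    by (auto simp: i_def)
qed

lemma card_standard_le: "card (standard M N) \<le> N ^ card V"
proof -
  have "inj_on (\<lambda>m. restrict m V) (standard M N)"
  proof (rule inj_onI)
    fix m k assume mk: "m \<in> standard M N" "k \<in> standard M N" "restrict m V = restrict k V"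
    have "m v = k v" for v
    proof (cases "v \<in> V")
      case True
      then show ?thesis
        using fun_cong[OF mk(3), of v] by simp
    qed (use mk in \<open>auto simp: standard_def exponents_def\<close>)
    then show "m = k" ..
  qed
  moreover have "(\<lambda>m. restrict m V) ` standard M N \<subseteq> PiE V (\<lambda>_. {..<N})"
  proof
    fix x assume "x \<in> (\<lambda>m. restrict m V) ` standard M N"
    then obtain m where m: "m \<in> standard M N" "x = restrict m V"
      by blast
    have "m v < N" if "v \<in> V" for v
      using member_le_sum[OF that, of m] m finite_vars by (auto simp: standard_def edeg_def)
    then show "x \<in> PiE V (\<lambda>_. {..<N})"
      using m by auto
  qed
  ultimately have "card (standard M N) \<le> card (PiE V (\<lambda>_. {..<N}))"
    using finite_vars by (intro card_inj_on_le) (auto intro!: finite_PiE)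
  then show ?thesis
    using finite_vars by (simp add: card_PiE)
qed

text \<open>A longer chain would give a Hilbert function that grows at least like N^(n+1), whereas
  there are at most N^n monomials of degree less than \<open>N\<close> in \<open>n\<close>
  variables.\<close>

lemma prime_chain_length:
  assumes prime: "\<And>i. i \<le> l \<Longrightarrow> primeideal (Q i) P" and chain: "\<And>i. i < l \<Longrightarrow> Q i \<subset> Q (Suc i)"
  shows "l \<le> card V"
proof (rule ccontr)
  assume long: "\<not> l \<le> card V"
  define n where "n = card V"
  define k where "k = Suc n"
  have k: "k \<le> l" "k > 0"
    using long by (auto simp: k_def n_def)
  \<comment> \<open>Only the first \<open>k\<close> steps of the chain are used; cutting it there
    makes the estimate speak of \<open>Q 0\<close>.\<close>
  obtain D where D: "\<And>N. N choose k \<le> card (standard (Q 0) (D * Suc N))"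
    using Hilbert_function_chain[of k Q k] prime chain k by auto
  \<comment> \<open>Larger than the constant that survives when the two bounds are compared and N^n
    is cancelled; the summand \<open>k\<close> ensures \<open>k \<le> N\<close>, which the lower
    bound on the binomial coefficient needs.\<close>
  define N where "N = Suc ((2 * D) ^ n * k ^ k) + k"
  have N: "N > 0" "k \<le> N"
    by (auto simp: N_def)
  have "(real N / real k) ^ k \<le> real (N choose k)"
    using binomial_ge_n_over_k_pow_k[of k N] N by simp
  also have "\<dots> \<le> real ((D * Suc N) ^ n)"
    using D[of N] card_standard_le[of "Q 0" "D * Suc N"] by (simp add: n_def del: mult_Suc_right of_nat_power)
  also have "\<dots> \<le> real ((2 * D * N) ^ n)"
    using N by (intro of_nat_mono power_mono) (auto simp: algebra_simps)
  finally have "real N ^ k / real k ^ k \<le> real ((2 * D) ^ n) * real N ^ n"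
    by (simp add: power_divide power_mult_distrib)
  then have "real N ^ k \<le> real ((2 * D) ^ n) * real N ^ n * real k ^ k"
    using k by (simp add: divide_le_eq)
  then have "real N * real N ^ n \<le> (real ((2 * D) ^ n) * real k ^ k) * real N ^ n"
    by (simp add: k_def mult_ac)
  then have "real N \<le> real ((2 * D) ^ n) * real k ^ k"
    using N by (simp add: mult_le_cancel_right)
  also have "\<dots> = real ((2 * D) ^ n * k ^ k)"
    by simp
  finally have "N \<le> (2 * D) ^ n * k ^ k"
    using of_nat_le_iff by blast
  then show False
    by (simp add: N_def)
qed

end

section \<open>The dimension of a power series ring over a field\<close>

lemma krull_dim_power_series:
  fixes V :: "'v::linorder set"
  assumes K: "field K" and V: "finite V"
  shows "krull_dim (power_series_ring V K) = enat (card V)"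
proof -
  interpret field K by fact
  interpret power_series K V
    using V by unfold_locales
  obtain \<rho> :: "('v \<Rightarrow> nat) \<Rightarrow> nat" where \<rho>: "inj_on \<rho> (exponents V)"
    "\<forall>a\<in>exponents V. \<forall>b\<in>exponents V. \<forall>c\<in>exponents V. \<rho> a < \<rho> b \<longrightarrow> \<rho> (esum a c) < \<rho> (esum b c)"
    "\<forall>a\<in>exponents V. \<forall>b\<in>exponents V. edeg V a < edeg V b \<longrightarrow> \<rho> a < \<rho> b"
    using exists_monomial_rank[OF V] by blast
  interpret ranked_series K V \<rho>
    using \<rho> by unfold_locales auto
  define C where "C l \<longleftrightarrow> (\<exists>Q. (\<forall>i\<le>l. primeideal (Q i) P) \<and> (\<forall>i<l. Q i \<subset> Q (Suc i)))" for l
  have upper: "l \<le> card V" if "C l" for l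
    using that prime_chain_length unfolding C_def by blast
  have "C (card V)"
  proof -
    obtain vs where vs: "set vs = V" "distinct vs" "length vs = card V"
      using finite_distinct_list[OF V] distinct_card by metis
    \<comment> \<open>The ideal generated by the first \<open>i\<close> variables. The next variable
      itself shows that the inclusion into its successor is strict.\<close>
    define Q where "Q i = {s \<in> carrier P. \<forall>m\<in>E. (\<forall>v\<in>set (take i vs). m v = 0) \<longrightarrow> s m = \<zero>\<^bsub>K\<^esub>}" for i
    have "Q i \<subset> Q (Suc i)" if i: "i < card V" for i
    proof
      have "set (take i vs) \<subseteq> set (take (Suc i) vs)"
        by (rule set_take_subset_set_take) simp
      then show "Q i \<subseteq> Q (Suc i)"
        unfolding Q_def by auto
      define e where "e = (\<lambda>_. 0)(vs ! i := (1 :: nat))"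
      have eE: "e \<in> E"
        using vs i nth_mem[of i vs] by (auto simp: e_def exponents_def)
      have notin: "vs ! i \<notin> set (take i vs)"
        using vs i by (auto simp: in_set_conv_nth nth_eq_iff_index_eq)
      have isin: "vs ! i \<in> set (take (Suc i) vs)"
        using vs i by (simp add: take_Suc_conv_app_nth)
      have "pmonom \<one>\<^bsub>K\<^esub> e \<in> Q (Suc i)"
        using isin by (auto simp: Q_def coeff_monom e_def)
      moreover have "pmonom \<one>\<^bsub>K\<^esub> e \<notin> Q i"
        using notin eE by (auto simp: Q_def coeff_monom e_def intro!: bexI[of _ e])
      ultimately show "Q i \<noteq> Q (Suc i)"
        by blast
    qed
    moreover have "primeideal (Q i) P" for i
      unfolding Q_def by (rule primeideal_vars)
    ultimately show ?thesis
      unfolding C_def by blast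
  qed
  then have "Sup {enat l | l. C l} = enat (card V)"
    using upper by (intro antisym Sup_least Sup_upper) auto
  then show ?thesis
    by (simp add: krull_dim_def C_def)
qed

subsection \<open>Free direct summands and dual systems\<close>

definition linear_form :: "('a, 'm) ring_scheme \<Rightarrow> ('a, 'b, 'n) module_scheme \<Rightarrow> ('b \<Rightarrow> 'a) \<Rightarrow> bool" where
  "linear_form A M \<phi> \<longleftrightarrow> (\<forall>x\<in>carrier M. \<phi> x \<in> carrier A) \<and>
    (\<forall>x\<in>carrier M. \<forall>y\<in>carrier M. \<phi> (x \<oplus>\<^bsub>M\<^esub> y) = \<phi> x \<oplus>\<^bsub>A\<^esub> \<phi> y) \<and>
    (\<forall>a\<in>carrier A. \<forall>x\<in>carrier M. \<phi> (a \<odot>\<^bsub>M\<^esub> x) = a \<otimes>\<^bsub>A\<^esub> \<phi> x)"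

definition linear_map ::
    "('a, 'm) ring_scheme \<Rightarrow> ('a, 'b, 'n) module_scheme \<Rightarrow> ('a, 'c, 'o) module_scheme \<Rightarrow> ('b \<Rightarrow> 'c) \<Rightarrow> bool" where
  "linear_map A M N h \<longleftrightarrow> (\<forall>x\<in>carrier M. h x \<in> carrier N) \<and>
    (\<forall>x\<in>carrier M. \<forall>y\<in>carrier M. h (x \<oplus>\<^bsub>M\<^esub> y) = h x \<oplus>\<^bsub>N\<^esub> h y) \<and>
    (\<forall>a\<in>carrier A. \<forall>x\<in>carrier M. h (a \<odot>\<^bsub>M\<^esub> x) = a \<odot>\<^bsub>N\<^esub> h x)"

definition dual_system ::
    "('a, 'm) ring_scheme \<Rightarrow> ('a, 'b, 'n) module_scheme \<Rightarrow> nat \<Rightarrow> (nat \<Rightarrow> 'b) \<Rightarrow> (nat \<Rightarrow> 'b \<Rightarrow> 'a) \<Rightarrow> bool" where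
  "dual_system A M r w \<phi> \<longleftrightarrow> (\<forall>i<r. w i \<in> carrier M) \<and> (\<forall>i<r. linear_form A M (\<phi> i)) \<and>
    (\<forall>i<r. \<forall>j<r. \<phi> i (w j) = (if i = j then \<one>\<^bsub>A\<^esub> else \<zero>\<^bsub>A\<^esub>))"

lemma (in cring) sum_diff_sum:
  assumes "a \<in> carrier R" "b \<in> carrier R" "c \<in> carrier R" "d \<in> carrier R"
  shows "(a \<oplus> b) \<ominus> (c \<oplus> d) = (a \<ominus> c) \<oplus> (b \<ominus> d)"
  using assms by algebra

lemma (in cring) mult_diff_mult:
  assumes "a \<in> carrier R" "b \<in> carrier R" "c \<in> carrier R"
  shows "a \<otimes> b \<ominus> a \<otimes> c = a \<otimes> (b \<ominus> c)"
  using assms by algebra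

lemma linear_form_comp: "linear_map A M N h \<Longrightarrow> linear_form A N \<phi> \<Longrightarrow> linear_form A M (\<lambda>x. \<phi> (h x))"
  by (simp add: linear_map_def linear_form_def)

context module
begin

lemma linear_form_closed: "linear_form R M \<phi> \<Longrightarrow> x \<in> carrier M \<Longrightarrow> \<phi> x \<in> carrier R"
  and linear_form_add: "linear_form R M \<phi> \<Longrightarrow> x \<in> carrier M \<Longrightarrow> y \<in> carrier M \<Longrightarrow>
    \<phi> (x \<oplus>\<^bsub>M\<^esub> y) = \<phi> x \<oplus> \<phi> y"
  and linear_form_smult: "linear_form R M \<phi> \<Longrightarrow> a \<in> carrier R \<Longrightarrow> x \<in> carrier M \<Longrightarrow>
    \<phi> (a \<odot>\<^bsub>M\<^esub> x) = a \<otimes> \<phi> x"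
  by (simp_all add: linear_form_def)

lemma linear_form_zero:
  assumes "linear_form R M \<phi>"
  shows "\<phi> \<zero>\<^bsub>M\<^esub> = \<zero>"
  using linear_form_smult[OF assms, of \<zero> "\<zero>\<^bsub>M\<^esub>"] linear_form_closed[OF assms, of "\<zero>\<^bsub>M\<^esub>"] by simp

lemma linear_form_minus:
  assumes "linear_form R M \<phi>" "x \<in> carrier M"
  shows "\<phi> (\<ominus>\<^bsub>M\<^esub> x) = \<ominus> \<phi> x"
proof -
  have "\<phi> (\<ominus>\<^bsub>M\<^esub> x) \<oplus> \<phi> x = \<zero>"
    using linear_form_add[OF assms(1), of "\<ominus>\<^bsub>M\<^esub> x" x] linear_form_zero[OF assms(1)] assms(2)
    by (simp add: M.l_neg)
  then show ?thesis
    using linear_form_closed[OF assms(1)] assms(2) by (intro R.minus_equality[symmetric]) auto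
qed

lemma linear_form_finsum:
  assumes "linear_form R M \<phi>" "finite J" "x \<in> J \<rightarrow> carrier M"
  shows "\<phi> (\<Oplus>\<^bsub>M\<^esub>j\<in>J. x j) = (\<Oplus>j\<in>J. \<phi> (x j))"
  using assms(2,3)
proof (induction J rule: finite_induct)
  case (insert i J)
  then show ?case
    using assms(1) by (simp add: linear_form_add linear_form_closed Pi_iff M.finsum_closed)
qed (use linear_form_zero[OF assms(1)] in simp)

lemma linear_form_combination:
  assumes "linear_form R M \<phi>" "finite J" "\<And>j. j \<in> J \<Longrightarrow> c j \<in> carrier R" "\<And>j. j \<in> J \<Longrightarrow> x j \<in> carrier M"
  shows "\<phi> (\<Oplus>\<^bsub>M\<^esub>j\<in>J. c j \<odot>\<^bsub>M\<^esub> x j) = (\<Oplus>j\<in>J. c j \<otimes> \<phi> (x j))"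
proof -
  have "\<phi> (\<Oplus>\<^bsub>M\<^esub>j\<in>J. c j \<odot>\<^bsub>M\<^esub> x j) = (\<Oplus>j\<in>J. \<phi> (c j \<odot>\<^bsub>M\<^esub> x j))"
    using assms by (intro linear_form_finsum) auto
  also have "\<dots> = (\<Oplus>j\<in>J. c j \<otimes> \<phi> (x j))"
    using assms by (intro R.finsum_cong') (auto simp: linear_form_smult linear_form_closed)
  finally show ?thesis .
qed

lemma dual_coordinates:
  assumes sys: "dual_system R M r w \<phi>" and i: "i < r" and c: "\<And>j. j < r \<Longrightarrow> c j \<in> carrier R"
  shows "\<phi> i (\<Oplus>\<^bsub>M\<^esub>j\<in>{..<r}. c j \<odot>\<^bsub>M\<^esub> w j) = c i"
proof -
  have "\<phi> i (\<Oplus>\<^bsub>M\<^esub>j\<in>{..<r}. c j \<odot>\<^bsub>M\<^esub> w j) = (\<Oplus>j\<in>{..<r}. c j \<otimes> \<phi> i (w j))"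
    using sys i c by (intro linear_form_combination) (auto simp: dual_system_def)
  also have "\<dots> = c i \<otimes> \<phi> i (w i)"
    using sys i c by (intro R.finsum_single) (auto simp: dual_system_def)
  finally show ?thesis
    using sys i c by (simp add: dual_system_def)
qed

text \<open>This common kernel is the complement of the free summand generated by the
  \<open>w i\<close>.\<close>

lemma dual_system_kernel_submodule:
  assumes sys: "dual_system R M r w \<phi>"
  shows "submodule {x \<in> carrier M. \<forall>i<r. \<phi> i x = \<zero>} R M"
proof (rule submoduleI)
  have lin: "linear_form R M (\<phi> i)" if "i < r" for i
    using sys that by (simp add: dual_system_def)
  show "\<ominus>\<^bsub>M\<^esub> a \<in> {x \<in> carrier M. \<forall>i<r. \<phi> i x = \<zero>}" if "a \<in> {x \<in> carrier M. \<forall>i<r. \<phi> i x = \<zero>}" for a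
    using that linear_form_minus[OF lin] by auto
qed (use sys in \<open>auto simp: dual_system_def linear_form_zero linear_form_add linear_form_smult\<close>)

end

text \<open>The preimages of the standard basis vectors are dual to the coordinate functions of the
  free part.\<close>

lemma free_summand_imp_dual_system:
  fixes A :: "('a, 'm) ring_scheme" and M :: "('a, 'b) module" and N :: "('a, 'c) module"
  assumes M: "module A M" and N: "module A N" and h: "h \<in> module_iso A M (module_sum (free_module A r) N)"
  shows "\<exists>w \<phi>. dual_system A M r w \<phi>"
proof -
  interpret module A M by fact
  interpret N: module A N by fact
  let ?S = "module_sum (free_module A r) N"
  have car: "carrier ?S = ({..<r} \<rightarrow>\<^sub>E carrier A) \<times> carrier N"
    by (simp add: module_sum_def free_module_def)
  have bij: "bij_betw h (carrier M) (carrier ?S)"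
    using h by (simp add: module_iso_def)
  have add: "h (x \<oplus>\<^bsub>M\<^esub> y) = h x \<oplus>\<^bsub>?S\<^esub> h y" if "x \<in> carrier M" "y \<in> carrier M" for x y
    using h that unfolding module_iso_def by blast
  have sm: "h (a \<odot>\<^bsub>M\<^esub> x) = a \<odot>\<^bsub>?S\<^esub> h x" if "a \<in> carrier A" "x \<in> carrier M" for a x
    using h that unfolding module_iso_def by blast
  define e where "e j = (\<lambda>i\<in>{..<r}. if i = j then \<one>\<^bsub>A\<^esub> else \<zero>\<^bsub>A\<^esub>, \<zero>\<^bsub>N\<^esub>)" for j
  define w where "w j = inv_into (carrier M) h (e j)" for j
  define \<phi> where "\<phi> i x = fst (h x) i" for i x
  have e: "e j \<in> carrier ?S" for j
    by (auto simp: car e_def)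
  have w: "w j \<in> carrier M" "h (w j) = e j" for j
    using bij e[of j] unfolding w_def bij_betw_def by (auto intro: inv_into_into f_inv_into_f)
  have hx: "h x \<in> ({..<r} \<rightarrow>\<^sub>E carrier A) \<times> carrier N" if "x \<in> carrier M" for x
    using bij_betwE[OF bij] that unfolding car by blast
  have "linear_form A M (\<phi> i)" if i: "i < r" for i
    unfolding linear_form_def
  proof (intro conjI ballI)
    fix x assume x: "x \<in> carrier M"
    have "fst (h x) \<in> {..<r} \<rightarrow>\<^sub>E carrier A"
      using hx[OF x] by (simp add: mem_Times_iff)
    then show "\<phi> i x \<in> carrier A"
      using PiE_mem[of "fst (h x)" "{..<r}" "\<lambda>_. carrier A" i] i by (simp add: \<phi>_def)
    fix y assume y: "y \<in> carrier M"
    show "\<phi> i (x \<oplus>\<^bsub>M\<^esub> y) = \<phi> i x \<oplus>\<^bsub>A\<^esub> \<phi> i y"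
      using add[OF x y] i by (simp add: \<phi>_def module_sum_def free_module_def split_beta)
  next
    fix a x assume "a \<in> carrier A" "x \<in> carrier M"
    then show "\<phi> i (a \<odot>\<^bsub>M\<^esub> x) = a \<otimes>\<^bsub>A\<^esub> \<phi> i x"
      using sm[of a x] i by (simp add: \<phi>_def module_sum_def free_module_def split_beta)
  qed
  then have "dual_system A M r w \<phi>"
    using w by (auto simp: dual_system_def \<phi>_def e_def)
  then show ?thesis
    by blast
qed

text \<open>Conversely, a dual system splits each element into the combination of the
  \<open>w i\<close> with coefficients \<open>\<phi> i x\<close> and a rest in the common kernel.
  The criterion replaces complements and isomorphisms by elements and forms, which can be counted by
  matrices.\<close>

lemma has_free_summand_iff:
  fixes A :: "('a, 'm) ring_scheme" and M :: "('a, 'b) module"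
  assumes "module A M"
  shows "has_free_summand A M r \<longleftrightarrow> (\<exists>w \<phi>. dual_system A M r w \<phi>)"
proof
  interpret module A M by fact
  show "\<exists>w \<phi>. dual_system A M r w \<phi>" if "has_free_summand A M r"
    using that free_summand_imp_dual_system[OF assms] unfolding has_free_summand_def by blast
  assume "\<exists>w \<phi>. dual_system A M r w \<phi>"
  then obtain w \<phi> where sys: "dual_system A M r w \<phi>"
    by blast
  have w: "w i \<in> carrier M" and lin: "linear_form A M (\<phi> i)" if "i < r" for i
    using sys that by (auto simp: dual_system_def)
  define H where "H = {x \<in> carrier M. \<forall>i<r. \<phi> i x = \<zero>\<^bsub>A\<^esub>}"
  define N where "N = M\<lparr>carrier := H\<rparr>"
  interpret H: submodule H A M
    unfolding H_def by (rule dual_system_kernel_submodule[OF sys])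
  have N: "module A N"
    unfolding N_def by (rule H.submodule_is_module[OF assms])
  have carN: "carrier N = H"
    by (simp add: N_def)
  have HM: "x \<in> carrier M" if "x \<in> H" for x
    using that by (simp add: H_def)
  let ?S = "module_sum (free_module A r) N"
  have car: "carrier ?S = ({..<r} \<rightarrow>\<^sub>E carrier A) \<times> H"
    by (simp add: module_sum_def free_module_def carN)
  define s where "s c = (\<Oplus>\<^bsub>M\<^esub>j\<in>{..<r}. c j \<odot>\<^bsub>M\<^esub> w j)" for c
  have s: "s c \<in> carrier M" if "\<And>j. j < r \<Longrightarrow> c j \<in> carrier A" for c
    unfolding s_def using that w by (intro M.finsum_closed) auto
  define f where "f x = (\<lambda>i\<in>{..<r}. \<phi> i x)" for x
  have f: "f x j \<in> carrier A" if "x \<in> carrier M" "j < r" for x j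
    using that lin linear_form_closed by (simp add: f_def)
  have sf: "s (f x) \<in> carrier M" if "x \<in> carrier M" for x
    using that f by (intro s)
  have s_add: "s (f (x \<oplus>\<^bsub>M\<^esub> y)) = s (f x) \<oplus>\<^bsub>M\<^esub> s (f y)" if "x \<in> carrier M" "y \<in> carrier M" for x y
  proof -
    have "s (f (x \<oplus>\<^bsub>M\<^esub> y)) = (\<Oplus>\<^bsub>M\<^esub>j\<in>{..<r}. f x j \<odot>\<^bsub>M\<^esub> w j \<oplus>\<^bsub>M\<^esub> f y j \<odot>\<^bsub>M\<^esub> w j)"
      unfolding s_def using that w f lin
      by (intro M.finsum_cong') (auto simp: f_def linear_form_add smult_l_distr linear_form_closed)
    also have "\<dots> = s (f x) \<oplus>\<^bsub>M\<^esub> s (f y)"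
      unfolding s_def using that w f by (intro M.finsum_addf) auto
    finally show ?thesis .
  qed
  have s_smult: "s (f (a \<odot>\<^bsub>M\<^esub> x)) = a \<odot>\<^bsub>M\<^esub> s (f x)" if "a \<in> carrier A" "x \<in> carrier M" for a x
  proof -
    have "s (f (a \<odot>\<^bsub>M\<^esub> x)) = (\<Oplus>\<^bsub>M\<^esub>j\<in>{..<r}. a \<odot>\<^bsub>M\<^esub> (f x j \<odot>\<^bsub>M\<^esub> w j))"
      unfolding s_def using that w f lin
      by (intro M.finsum_cong') (auto simp: f_def linear_form_smult smult_assoc1 linear_form_closed)
    also have "\<dots> = a \<odot>\<^bsub>M\<^esub> s (f x)"
      unfolding s_def using that w f by (intro finsum_smult_ldistr[symmetric]) auto
    finally show ?thesis .
  qed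
  define h where "h x = (f x, x \<ominus>\<^bsub>M\<^esub> s (f x))" for x
  have fs: "\<phi> i (s c) = c i" if "i < r" "\<And>j. j < r \<Longrightarrow> c j \<in> carrier A" for c i
    unfolding s_def using dual_coordinates[OF sys] that by blast
  have nH: "x \<ominus>\<^bsub>M\<^esub> s (f x) \<in> H" if "x \<in> carrier M" for x
  proof -
    have "\<phi> i (x \<ominus>\<^bsub>M\<^esub> s (f x)) = \<zero>\<^bsub>A\<^esub>" if i: "i < r" for i
    proof -
      have "\<phi> i (x \<ominus>\<^bsub>M\<^esub> s (f x)) = \<phi> i x \<oplus>\<^bsub>A\<^esub> \<ominus>\<^bsub>A\<^esub> \<phi> i (s (f x))"
        using lin[OF i] \<open>x \<in> carrier M\<close> sf by (simp add: a_minus_def linear_form_add linear_form_minus)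
      also have "\<phi> i (s (f x)) = \<phi> i x"
        using fs[OF i] f \<open>x \<in> carrier M\<close> i by (simp add: f_def)
      finally show ?thesis
        using lin[OF i] \<open>x \<in> carrier M\<close> by (simp add: linear_form_closed R.r_neg)
    qed
    then show ?thesis
      using that sf by (simp add: H_def)
  qed
  have "bij_betw h (carrier M) (carrier ?S)"
  proof (rule bij_betwI[of _ _ _ "\<lambda>(c, x). s c \<oplus>\<^bsub>M\<^esub> x"])
    show "h \<in> carrier M \<rightarrow> carrier ?S"
      unfolding car using f nH by (auto simp: h_def f_def restrict_PiE_iff)
    show "(\<lambda>(c, x). s c \<oplus>\<^bsub>M\<^esub> x) \<in> carrier ?S \<rightarrow> carrier M"
      unfolding car using s HM by auto
    show "(\<lambda>(c, x). s c \<oplus>\<^bsub>M\<^esub> x) (h x) = x" if "x \<in> carrier M" for x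
      using that sf[OF that] by (simp add: h_def M.minus_eq M.a_lcomm M.r_neg)
    fix y assume "y \<in> carrier ?S"
    then obtain c x where y: "y = (c, x)" "c \<in> {..<r} \<rightarrow>\<^sub>E carrier A" "x \<in> H"
      unfolding car by auto
    have c: "c j \<in> carrier A" if "j < r" for j
      using y that by auto
    have "\<phi> i (s c \<oplus>\<^bsub>M\<^esub> x) = c i" if "i < r" for i
    proof -
      have "\<phi> i x = \<zero>\<^bsub>A\<^esub>"
        using y(3) that by (simp add: H_def)
      then show ?thesis
        using lin[OF that] s[OF c] HM[OF y(3)] fs[OF that c] c[OF that] by (simp add: linear_form_add)
    qed
    then have "f (s c \<oplus>\<^bsub>M\<^esub> x) = c"
      using y(2) by (auto simp: f_def fun_eq_iff PiE_def extensional_def)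
    moreover have "s c \<oplus>\<^bsub>M\<^esub> x \<ominus>\<^bsub>M\<^esub> s c = x"
      using s[OF c] HM[OF y(3)] by (simp add: M.minus_eq M.a_ac M.r_neg2 M.r_neg1 M.r_neg)
    ultimately show "h ((\<lambda>(c, x). s c \<oplus>\<^bsub>M\<^esub> x) y) = y"
      by (simp add: y h_def)
  qed
  moreover have "h (x \<oplus>\<^bsub>M\<^esub> y) = h x \<oplus>\<^bsub>?S\<^esub> h y" if "x \<in> carrier M" "y \<in> carrier M" for x y
  proof -
    have "f (x \<oplus>\<^bsub>M\<^esub> y) = (\<lambda>i\<in>{..<r}. f x i \<oplus>\<^bsub>A\<^esub> f y i)"
      using that lin by (auto simp: f_def linear_form_add)
    moreover have "x \<oplus>\<^bsub>M\<^esub> y \<ominus>\<^bsub>M\<^esub> s (f (x \<oplus>\<^bsub>M\<^esub> y)) = (x \<ominus>\<^bsub>M\<^esub> s (f x)) \<oplus>\<^bsub>M\<^esub> (y \<ominus>\<^bsub>M\<^esub> s (f y))"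
      using that sf by (simp add: s_add M.minus_eq M.minus_add M.a_ac)
    ultimately show ?thesis
      by (simp add: h_def module_sum_def free_module_def N_def)
  qed
  moreover have "h (a \<odot>\<^bsub>M\<^esub> x) = a \<odot>\<^bsub>?S\<^esub> h x" if "a \<in> carrier A" "x \<in> carrier M" for a x
  proof -
    have "f (a \<odot>\<^bsub>M\<^esub> x) = (\<lambda>i\<in>{..<r}. a \<otimes>\<^bsub>A\<^esub> f x i)"
      using that lin by (auto simp: f_def linear_form_smult)
    moreover have "a \<odot>\<^bsub>M\<^esub> x \<ominus>\<^bsub>M\<^esub> s (f (a \<odot>\<^bsub>M\<^esub> x)) = a \<odot>\<^bsub>M\<^esub> (x \<ominus>\<^bsub>M\<^esub> s (f x))"
      using that sf by (simp add: s_smult M.minus_eq smult_r_distr smult_r_minus)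
    ultimately show ?thesis
      by (simp add: h_def module_sum_def free_module_def N_def)
  qed
  ultimately have "h \<in> module_iso A M ?S"
    by (simp add: module_iso_def)
  then show "has_free_summand A M r"
    using N unfolding has_free_summand_def by blast
qed

section \<open>Bounds for free ranks and their additivity over a local ring\<close>

text \<open>A product through \<open>J\<close> has rank at most \<open>card J\<close> modulo a
  prime. If \<open>r\<close> were larger, a row relation \<open>x\<close> for \<open>B\<close>
  modulo \<open>I\<close> would exist; multiplied by \<open>C\<close> it becomes a row relation for
  the identity matrix, which puts every \<open>x l\<close> into \<open>I\<close>.\<close>

lemma (in primeideal) identity_factors_imp_le:
  assumes J: "finite J"
    and B: "\<And>k j. k < r \<Longrightarrow> j \<in> J \<Longrightarrow> B k j \<in> carrier R"
    and C: "\<And>l j. l < r \<Longrightarrow> j \<in> J \<Longrightarrow> C j l \<in> carrier R"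
    and id: "\<And>k l. k < r \<Longrightarrow> l < r \<Longrightarrow>
      (if k = l then \<one> else \<zero>) \<ominus> (\<Oplus>j\<in>J. B k j \<otimes> C j l) \<in> I"
  shows "r \<le> card J"
proof (rule ccontr)
  assume "\<not> r \<le> card J"
  then have "\<exists>x \<in> {..<r} \<rightarrow> carrier R. (\<exists>k\<in>{..<r}. x k \<notin> I) \<and>
      (\<forall>j\<in>J. (\<Oplus>k\<in>{..<r}. x k \<otimes> B k j) \<in> I)"
    using J B by (intro dependent_rows) auto
  then obtain x l where x: "x \<in> {..<r} \<rightarrow> carrier R" and l: "l < r" "x l \<notin> I"
    and xB: "\<And>j. j \<in> J \<Longrightarrow> (\<Oplus>k\<in>{..<r}. x k \<otimes> B k j) \<in> I"
    by auto
  have xc: "x k \<in> carrier R" if "k < r" for k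
    using x that by auto
  define D where "D k = (\<Oplus>j\<in>J. B k j \<otimes> C j l)" for k
  have D: "D k \<in> carrier R" if "k < r" for k
    unfolding D_def using B C l that by (intro finsum_closed) auto
  define d where "d k = (if k = l then \<one> else \<zero>)" for k
  have d: "d k \<in> carrier R" for k
    by (simp add: d_def)
  have "(\<Oplus>k\<in>{..<r}. x k \<otimes> (d k \<ominus> D k)) \<in> I"
    using id[of _ l] l xc D by (intro finsum_ideal_closed I_l_closed) (auto simp: D_def d_def)
  moreover have "(\<Oplus>k\<in>{..<r}. x k \<otimes> D k) \<in> I"
  proof -
    have "(\<Oplus>k\<in>{..<r}. x k \<otimes> D k) = (\<Oplus>k\<in>{..<r}. \<Oplus>j\<in>J. x k \<otimes> B k j \<otimes> C j l)"
    proof (rule finsum_cong')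
      fix k assume k: "k \<in> {..<r}"
      have "x k \<otimes> D k = (\<Oplus>j\<in>J. x k \<otimes> (B k j \<otimes> C j l))"
        unfolding D_def using k J B C l xc by (intro finsum_rdistr) auto
      also have "\<dots> = (\<Oplus>j\<in>J. x k \<otimes> B k j \<otimes> C j l)"
        using k B C l xc by (intro finsum_cong') (auto simp: m_assoc)
      finally show "x k \<otimes> D k = (\<Oplus>j\<in>J. x k \<otimes> B k j \<otimes> C j l)" .
    qed (use B C l xc in \<open>auto intro!: finsum_closed m_closed\<close>)
    also have "\<dots> = (\<Oplus>j\<in>J. \<Oplus>k\<in>{..<r}. x k \<otimes> B k j \<otimes> C j l)"
      using J B C l xc by (intro finsum_swap) auto
    also have "\<dots> = (\<Oplus>j\<in>J. (\<Oplus>k\<in>{..<r}. x k \<otimes> B k j) \<otimes> C j l)"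
    proof (rule finsum_cong')
      fix j assume j: "j \<in> J"
      show "(\<Oplus>k\<in>{..<r}. x k \<otimes> B k j \<otimes> C j l) = (\<Oplus>k\<in>{..<r}. x k \<otimes> B k j) \<otimes> C j l"
        using j B C l xc by (intro finsum_ldistr[symmetric]) auto
    qed (use B C l xc in \<open>auto intro!: finsum_closed m_closed\<close>)
    also have "\<dots> \<in> I"
    proof (rule finsum_ideal_closed)
      fix j assume "j \<in> J"
      then show "(\<Oplus>k\<in>{..<r}. x k \<otimes> B k j) \<otimes> C j l \<in> I"
        using xB C l by (intro I_r_closed)
    qed
    finally show ?thesis .
  qed
  ultimately have "(\<Oplus>k\<in>{..<r}. x k \<otimes> (d k \<ominus> D k)) \<oplus> (\<Oplus>k\<in>{..<r}. x k \<otimes> D k) \<in> I"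
    by (rule additive_subgroup.a_closed[OF additive_subgroup_axioms])
  also have "(\<Oplus>k\<in>{..<r}. x k \<otimes> (d k \<ominus> D k)) \<oplus> (\<Oplus>k\<in>{..<r}. x k \<otimes> D k) =
      (\<Oplus>k\<in>{..<r}. x k \<otimes> (d k \<ominus> D k) \<oplus> x k \<otimes> D k)"
    using xc D d by (intro finsum_addf[symmetric]) auto
  also have "\<dots> = (\<Oplus>k\<in>{..<r}. x k \<otimes> d k)"
  proof (rule finsum_cong')
    fix k assume "k \<in> {..<r}"
    then have "x k \<in> carrier R" "D k \<in> carrier R" "d k \<in> carrier R"
      using xc D d by auto
    then show "x k \<otimes> (d k \<ominus> D k) \<oplus> x k \<otimes> D k = x k \<otimes> d k"
      by algebra
  qed (use xc d in auto)
  also have "\<dots> = x l"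
    using finsum_single[of "{..<r}" l "\<lambda>k. x k \<otimes> d k"] l xc by (simp add: d_def)
  finally show False
    using l by simp
qed

text \<open>Writing the \<open>w k\<close> in terms of the generators and applying the forms factors
  the identity matrix through \<open>J\<close>.\<close>

lemma dual_system_le_generators:
  assumes M: "module A M" and I: "primeideal I A" and J: "finite J"
    and g: "\<And>j. j \<in> J \<Longrightarrow> g j \<in> carrier M"
    and gen: "\<And>x. x \<in> carrier M \<Longrightarrow> \<exists>c \<in> J \<rightarrow> carrier A. x = (\<Oplus>\<^bsub>M\<^esub>j\<in>J. c j \<odot>\<^bsub>M\<^esub> g j)"
    and sys: "dual_system A M r w \<phi>"
  shows "r \<le> card J"
proof -
  interpret module A M by fact
  interpret I: primeideal I A by fact
  have "\<exists>c. c \<in> J \<rightarrow> carrier A \<and> (k < r \<longrightarrow> w k = (\<Oplus>\<^bsub>M\<^esub>j\<in>J. c j \<odot>\<^bsub>M\<^esub> g j))" for k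
    using gen[of "w k"] sys by (cases "k < r") (auto simp: dual_system_def)
  then obtain c where c: "\<And>k. c k \<in> J \<rightarrow> carrier A" "\<And>k. k < r \<Longrightarrow> w k = (\<Oplus>\<^bsub>M\<^esub>j\<in>J. c k j \<odot>\<^bsub>M\<^esub> g j)"
    by metis
  show ?thesis
  proof (rule I.identity_factors_imp_le[OF J, of r c "\<lambda>j l. \<phi> l (g j)"])
    fix k l assume kl: "k < r" "l < r"
    have "(\<Oplus>\<^bsub>A\<^esub>j\<in>J. c k j \<otimes>\<^bsub>A\<^esub> \<phi> l (g j)) = \<phi> l (w k)"
      unfolding c(2)[OF kl(1)] using sys kl J g c(1)
      by (intro linear_form_combination[symmetric]) (auto simp: dual_system_def)
    also have "\<dots> = (if k = l then \<one>\<^bsub>A\<^esub> else \<zero>\<^bsub>A\<^esub>)"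
      using sys kl by (auto simp: dual_system_def)
    finally show "(if k = l then \<one>\<^bsub>A\<^esub> else \<zero>\<^bsub>A\<^esub>) \<ominus>\<^bsub>A\<^esub> (\<Oplus>\<^bsub>A\<^esub>j\<in>J. c k j \<otimes>\<^bsub>A\<^esub> \<phi> l (g j)) \<in> I"
      by (simp add: a_minus_def R.r_neg)
  qed (use c(1) g sys in \<open>auto simp: dual_system_def linear_form_closed\<close>)
qed

text \<open>A form with a unit value on the common kernel would extend the dual system.\<close>

lemma maximal_dual_system:
  assumes M: "module A M" and local: "\<And>a. a \<in> carrier A \<Longrightarrow> a \<notin> I \<Longrightarrow> a \<in> Units A"
    and sys: "dual_system A M r w \<phi>" and max: "\<And>w \<phi>. \<not> dual_system A M (Suc r) w \<phi>"
    and x: "x \<in> carrier M" and \<chi>: "linear_form A M \<chi>"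
  shows "\<chi> x \<ominus>\<^bsub>A\<^esub> (\<Oplus>\<^bsub>A\<^esub>j\<in>{..<r}. \<phi> j x \<otimes>\<^bsub>A\<^esub> \<chi> (w j)) \<in> I"
proof (rule ccontr)
  assume *: "\<not> ?thesis"
  interpret module A M by fact
  have w: "w i \<in> carrier M" and lin: "linear_form A M (\<phi> i)" if "i < r" for i
    using sys that by (auto simp: dual_system_def)
  \<comment> \<open>The form \<chi> corrected by the dual system so that it vanishes on every
    \<open>w j\<close>. Its value at \<open>x\<close> is the element to be shown to lie in
    \<open>I\<close>.\<close>
  define u where "u y = \<chi> y \<ominus>\<^bsub>A\<^esub> (\<Oplus>\<^bsub>A\<^esub>j\<in>{..<r}. \<phi> j y \<otimes>\<^bsub>A\<^esub> \<chi> (w j))" for y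
  have sc: "(\<Oplus>\<^bsub>A\<^esub>j\<in>{..<r}. \<phi> j y \<otimes>\<^bsub>A\<^esub> \<chi> (w j)) \<in> carrier A" if "y \<in> carrier M" for y
    using that w lin \<chi> by (intro R.finsum_closed) (auto simp: linear_form_closed)
  have uc: "u y \<in> carrier A" if "y \<in> carrier M" for y
    using sc that \<chi> by (simp add: u_def linear_form_closed)
  have u_lin: "linear_form A M u"
    unfolding linear_form_def
  proof (intro conjI ballI uc)
    fix y z assume yz: "y \<in> carrier M" "z \<in> carrier M"
    have "(\<Oplus>\<^bsub>A\<^esub>j\<in>{..<r}. \<phi> j (y \<oplus>\<^bsub>M\<^esub> z) \<otimes>\<^bsub>A\<^esub> \<chi> (w j)) =
        (\<Oplus>\<^bsub>A\<^esub>j\<in>{..<r}. \<phi> j y \<otimes>\<^bsub>A\<^esub> \<chi> (w j) \<oplus>\<^bsub>A\<^esub> \<phi> j z \<otimes>\<^bsub>A\<^esub> \<chi> (w j))"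
      using yz w lin \<chi> by (intro R.finsum_cong') (auto simp: linear_form_add linear_form_closed l_distr)
    also have "\<dots> = (\<Oplus>\<^bsub>A\<^esub>j\<in>{..<r}. \<phi> j y \<otimes>\<^bsub>A\<^esub> \<chi> (w j)) \<oplus>\<^bsub>A\<^esub> (\<Oplus>\<^bsub>A\<^esub>j\<in>{..<r}. \<phi> j z \<otimes>\<^bsub>A\<^esub> \<chi> (w j))"
      using yz w lin \<chi> by (intro R.finsum_addf) (auto simp: linear_form_closed)
    finally have eq: "(\<Oplus>\<^bsub>A\<^esub>j\<in>{..<r}. \<phi> j (y \<oplus>\<^bsub>M\<^esub> z) \<otimes>\<^bsub>A\<^esub> \<chi> (w j)) = \<dots>" .
    have "\<chi> y \<in> carrier A" "\<chi> z \<in> carrier A"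
      using yz \<chi> by (auto simp: linear_form_closed)
    then show "u (y \<oplus>\<^bsub>M\<^esub> z) = u y \<oplus>\<^bsub>A\<^esub> u z"
      unfolding u_def eq linear_form_add[OF \<chi> yz] using sc[OF yz(1)] sc[OF yz(2)] by (intro sum_diff_sum)
  next
    fix a y assume ay: "a \<in> carrier A" "y \<in> carrier M"
    have "(\<Oplus>\<^bsub>A\<^esub>j\<in>{..<r}. \<phi> j (a \<odot>\<^bsub>M\<^esub> y) \<otimes>\<^bsub>A\<^esub> \<chi> (w j)) =
        (\<Oplus>\<^bsub>A\<^esub>j\<in>{..<r}. a \<otimes>\<^bsub>A\<^esub> (\<phi> j y \<otimes>\<^bsub>A\<^esub> \<chi> (w j)))"
      using ay w lin \<chi> by (intro R.finsum_cong') (auto simp: linear_form_smult linear_form_closed m_assoc)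
    also have "\<dots> = a \<otimes>\<^bsub>A\<^esub> (\<Oplus>\<^bsub>A\<^esub>j\<in>{..<r}. \<phi> j y \<otimes>\<^bsub>A\<^esub> \<chi> (w j))"
      using ay w lin \<chi> by (intro finsum_rdistr[symmetric]) (auto simp: linear_form_closed)
    finally have eq: "(\<Oplus>\<^bsub>A\<^esub>j\<in>{..<r}. \<phi> j (a \<odot>\<^bsub>M\<^esub> y) \<otimes>\<^bsub>A\<^esub> \<chi> (w j)) = \<dots>" .
    have "\<chi> y \<in> carrier A"
      using ay \<chi> by (auto simp: linear_form_closed)
    then show "u (a \<odot>\<^bsub>M\<^esub> y) = a \<otimes>\<^bsub>A\<^esub> u y"
      unfolding u_def eq linear_form_smult[OF \<chi> ay] using sc[OF ay(2)] ay(1) by (intro mult_diff_mult)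
  qed
  have uw: "u (w i) = \<zero>\<^bsub>A\<^esub>" if "i < r" for i
  proof -
    have "(\<Oplus>\<^bsub>A\<^esub>j\<in>{..<r}. \<phi> j (w i) \<otimes>\<^bsub>A\<^esub> \<chi> (w j)) = \<phi> i (w i) \<otimes>\<^bsub>A\<^esub> \<chi> (w i)"
      using sys that \<chi> by (intro R.finsum_single) (auto simp: dual_system_def linear_form_closed)
    then show ?thesis
      using sys that \<chi> by (simp add: u_def dual_system_def linear_form_closed a_minus_def R.r_neg)
  qed
  have unit: "u x \<in> Units A"
    using local[of "u x"] uc[OF x] * by (simp add: u_def)
  \<comment> \<open>The component of \<open>x\<close> in the common kernel; \<open>u\<close> does
    not change when passing from \<open>x\<close> to \<open>n\<close>.\<close>
  define n where "n = x \<ominus>\<^bsub>M\<^esub> (\<Oplus>\<^bsub>M\<^esub>j\<in>{..<r}. \<phi> j x \<odot>\<^bsub>M\<^esub> w j)"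
  have Sc: "(\<Oplus>\<^bsub>M\<^esub>j\<in>{..<r}. \<phi> j x \<odot>\<^bsub>M\<^esub> w j) \<in> carrier M"
    using x w lin by (intro M.finsum_closed) (auto simp: linear_form_closed)
  have n: "n \<in> carrier M"
    using x Sc by (simp add: n_def)
  have form_n: "\<psi> n = \<psi> x \<ominus>\<^bsub>A\<^esub> \<psi> (\<Oplus>\<^bsub>M\<^esub>j\<in>{..<r}. \<phi> j x \<odot>\<^bsub>M\<^esub> w j)" if "linear_form A M \<psi>" for \<psi>
    unfolding n_def using that x Sc
    by (simp add: a_minus_def linear_form_add linear_form_minus)
  have \<phi>n: "\<phi> i n = \<zero>\<^bsub>A\<^esub>" if "i < r" for i
    using form_n[OF lin[OF that]] dual_coordinates[OF sys that, of "\<lambda>j. \<phi> j x"] lin x that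
    by (simp add: linear_form_closed a_minus_def R.r_neg)
  have un: "u n = u x"
  proof -
    have "u (\<Oplus>\<^bsub>M\<^esub>j\<in>{..<r}. \<phi> j x \<odot>\<^bsub>M\<^esub> w j) = (\<Oplus>\<^bsub>A\<^esub>j\<in>{..<r}. \<phi> j x \<otimes>\<^bsub>A\<^esub> u (w j))"
      using u_lin x w lin by (intro linear_form_combination) (auto simp: linear_form_closed)
    also have "\<dots> = \<zero>\<^bsub>A\<^esub>"
      using uw lin x by (intro R.finsum_zeroI) (auto simp: linear_form_closed)
    finally show ?thesis
      using form_n[OF u_lin] uc[OF x] by (simp add: a_minus_def)
  qed
  \<comment> \<open>Scaled to value one under \<open>u\<close>, the element extends the system by a
    new dual pair.\<close>
  define v where "v = inv\<^bsub>A\<^esub> (u x) \<odot>\<^bsub>M\<^esub> n"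
  have v: "v \<in> carrier M"
    using unit n by (simp add: v_def)
  have uv: "u v = \<one>\<^bsub>A\<^esub>"
    using unit n un by (simp add: v_def linear_form_smult[OF u_lin])
  have \<phi>v: "\<phi> i v = \<zero>\<^bsub>A\<^esub>" if "i < r" for i
    using unit n \<phi>n[OF that] by (simp add: v_def linear_form_smult[OF lin[OF that]])
  have "dual_system A M (Suc r) (w(r := v)) (\<phi>(r := u))"
    unfolding dual_system_def using sys w lin u_lin v uv \<phi>v uw
    by (auto simp: dual_system_def less_Suc_eq)
  then show False
    using max by blast
qed

lemma linear_map_in_carrier: "linear_map A M N h \<Longrightarrow> x \<in> carrier M \<Longrightarrow> h x \<in> carrier N"
  by (simp add: linear_map_def)

text \<open>The maps exhibit \<open>M'\<close> as a direct sum of \<open>c\<close> copies of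
  \<open>M\<close>. Dual systems of the copies combine to one of length \<open>c * a\<close>.
  Conversely, maximality in \<open>M\<close> makes each form on a copy congruent modulo
  \<open>I\<close> to a combination of its \<open>a\<close> dual forms, so the identity matrix of
  any dual system of \<open>M'\<close> factors modulo \<open>I\<close> through \<open>c * a\<close>
  coordinates. The second conclusion lets the lemma be iterated.\<close>

lemma max_free_rank_copies:
  fixes A :: "('a, 'm) ring_scheme" and M :: "('a, 'b) module" and M' :: "('a, 'c) module"
  assumes M: "module A M" and M': "module A M'"
    and I: "primeideal I A" and local: "\<And>a. a \<in> carrier A \<Longrightarrow> a \<notin> I \<Longrightarrow> a \<in> Units A"
    and bound: "\<And>r. has_free_summand A M r \<Longrightarrow> r \<le> b"
    and \<pi>: "\<And>i. i < c \<Longrightarrow> linear_map A M' M (\<pi> i)"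
    and \<kappa>: "\<And>i. i < c \<Longrightarrow> linear_map A M M' (\<kappa> i)"
    and \<pi>\<kappa>: "\<And>i j x. i < c \<Longrightarrow> j < c \<Longrightarrow> x \<in> carrier M \<Longrightarrow> \<pi> i (\<kappa> j x) = (if i = j then x else \<zero>\<^bsub>M\<^esub>)"
    and \<kappa>\<pi>: "\<And>x. x \<in> carrier M' \<Longrightarrow> (\<Oplus>\<^bsub>M'\<^esub>i\<in>{..<c}. \<kappa> i (\<pi> i x)) = x"
  shows "max_free_rank M' A = c * max_free_rank M A" "\<exists>b'. \<forall>r. has_free_summand A M' r \<longrightarrow> r \<le> b'"
proof -
  interpret M: module A M by fact
  interpret M': module A M' by fact
  interpret I: primeideal I A by fact
  define a where "a = max_free_rank M A"
  have "dual_system A M 0 undefined undefined"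
    by (simp add: dual_system_def)
  then have "has_free_summand A M 0"
    using has_free_summand_iff[OF M] by blast
  then have a: "has_free_summand A M a" "\<And>r. has_free_summand A M r \<Longrightarrow> r \<le> a"
    unfolding a_def max_free_rank_def using bound
    by (blast intro: GreatestI_nat Greatest_le_nat)+
  then obtain w \<phi> where sys: "dual_system A M a w \<phi>"
    using has_free_summand_iff[OF M] by blast
  have max: "\<not> dual_system A M (Suc a) w \<phi>" for w \<phi>
    using a(2)[of "Suc a"] has_free_summand_iff[OF M] by auto
  have w: "w i \<in> carrier M" and lin: "linear_form A M (\<phi> i)" if "i < a" for i
    using sys that by (auto simp: dual_system_def)
  have "has_free_summand A M' (c * a)"
  proof -
    \<comment> \<open>The pair (copy, position within the copy) is encoded as quotient and remainder
      of \<open>k\<close> by \<open>a\<close>.\<close>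
    have div: "k div a < c" "k mod a < a" if "k < c * a" for k
    proof -
      have "a > 0"
        using that by (cases "a = 0") auto
      then show "k div a < c" "k mod a < a"
        using that by (auto simp: less_mult_imp_div_less)
    qed
    define w' where "w' k = \<kappa> (k div a) (w (k mod a))" for k
    define \<psi> where "\<psi> k x = \<phi> (k mod a) (\<pi> (k div a) x)" for k x
    have "w' k \<in> carrier M'" if "k < c * a" for k
      unfolding w'_def using \<kappa>[OF div(1)[OF that]] w[OF div(2)[OF that]] by (rule linear_map_in_carrier)
    moreover have "linear_form A M' (\<psi> k)" if "k < c * a" for k
      unfolding \<psi>_def using \<pi>[OF div(1)[OF that]] lin[OF div(2)[OF that]] by (rule linear_form_comp)
    moreover have "\<psi> k (w' l) = (if k = l then \<one>\<^bsub>A\<^esub> else \<zero>\<^bsub>A\<^esub>)" if k: "k < c * a" and l: "l < c * a" for k l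
    proof (cases "k div a = l div a")
      case True
      then have "k = l \<longleftrightarrow> k mod a = l mod a"
        by (metis div_mult_mod_eq)
      moreover have "\<psi> k (w' l) = \<phi> (k mod a) (w (l mod a))"
        unfolding \<psi>_def w'_def using \<pi>\<kappa>[OF div(1)[OF k] div(1)[OF l] w[OF div(2)[OF l]]] True by simp
      ultimately show ?thesis
        using sys div(2)[OF k] div(2)[OF l] by (simp add: dual_system_def)
    next
      case False
      then have "\<psi> k (w' l) = \<phi> (k mod a) \<zero>\<^bsub>M\<^esub>"
        unfolding \<psi>_def w'_def using \<pi>\<kappa>[OF div(1)[OF k] div(1)[OF l] w[OF div(2)[OF l]]] by simp
      then show ?thesis
        using False M.linear_form_zero[OF lin[OF div(2)[OF k]]] by auto
    qed
    ultimately have "dual_system A M' (c * a) w' \<psi>"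
      unfolding dual_system_def by blast
    then show ?thesis
      using has_free_summand_iff[OF M'] by blast
  qed
  moreover have upper: "r \<le> c * a" if has: "has_free_summand A M' r" for r
  proof -
    obtain w' \<psi> where sys': "dual_system A M' r w' \<psi>"
      using has unfolding has_free_summand_iff[OF M'] by blast
    have w': "w' i \<in> carrier M'" if "i < r" for i
      using sys' that unfolding dual_system_def by blast
    have lin': "linear_form A M' (\<psi> i)" if "i < r" for i
      using sys' that unfolding dual_system_def by blast
    have \<pi>c: "\<pi> i x \<in> carrier M" if "i < c" "x \<in> carrier M'" for i x
      using \<pi>[OF that(1)] that(2) by (rule linear_map_in_carrier)
    have \<kappa>c: "\<kappa> i x \<in> carrier M'" if "i < c" "x \<in> carrier M" for i x
      using \<kappa>[OF that(1)] that(2) by (rule linear_map_in_carrier)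
    define B where "B k x = \<phi> (snd x) (\<pi> (fst x) (w' k))" for k x
    define C where "C x l = \<psi> l (\<kappa> (fst x) (w (snd x)))" for x l
    have B: "B k (i, j) \<in> carrier A" if "k < r" "i < c" "j < a" for k i j
      using M.linear_form_closed[OF lin[OF that(3)] \<pi>c[OF that(2) w'[OF that(1)]]] by (simp add: B_def)
    have C: "C (i, j) l \<in> carrier A" if "l < r" "i < c" "j < a" for l i j
      using M'.linear_form_closed[OF lin'[OF that(1)] \<kappa>c[OF that(2) w[OF that(3)]]] by (simp add: C_def)
    have "r \<le> card ({..<c} \<times> {..<a})"
    proof (rule I.identity_factors_imp_le[of _ _ B C])
      fix k l assume kl: "k < r" "l < r"
      define u where "u i = (\<Oplus>\<^bsub>A\<^esub>j\<in>{..<a}. B k (i, j) \<otimes>\<^bsub>A\<^esub> C (i, j) l)" for i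
      have u: "u i \<in> carrier A" if "i < c" for i
        unfolding u_def using B C kl that by (intro M.R.finsum_closed) auto
      define v where "v i = \<psi> l (\<kappa> i (\<pi> i (w' k)))" for i
      have v: "v i \<in> carrier A" if "i < c" for i
        using M'.linear_form_closed[OF lin'[OF kl(2)] \<kappa>c[OF that \<pi>c[OF that w'[OF kl(1)]]]] by (simp add: v_def)
      \<comment> \<open>Applied in each copy, maximality replaces the composite of
        \<open>\<psi> l\<close> with the \<open>i\<close>-th inclusion by its expansion in the forms
        of the maximal system. Summed over \<open>i\<close>, the left parts recombine to
        \<open>\<psi> l (w' k)\<close>.\<close>
      have mem: "(\<Oplus>\<^bsub>A\<^esub>i\<in>{..<c}. v i \<ominus>\<^bsub>A\<^esub> u i) \<in> I"
      proof (rule I.finsum_ideal_closed)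
        fix i assume "i \<in> {..<c}"
        then have i: "i < c"
          by simp
        have "linear_form A M (\<lambda>x. \<psi> l (\<kappa> i x))"
          using \<kappa>[OF i] lin'[OF kl(2)] by (rule linear_form_comp)
        from maximal_dual_system[OF M local sys max \<pi>c[OF i w'[OF kl(1)]] this]
        show "v i \<ominus>\<^bsub>A\<^esub> u i \<in> I"
          by (simp add: u_def v_def B_def C_def)
      qed
      have "(\<Oplus>\<^bsub>A\<^esub>i\<in>{..<c}. v i \<ominus>\<^bsub>A\<^esub> u i) = (\<Oplus>\<^bsub>A\<^esub>i\<in>{..<c}. v i) \<oplus>\<^bsub>A\<^esub> (\<Oplus>\<^bsub>A\<^esub>i\<in>{..<c}. \<ominus>\<^bsub>A\<^esub> u i)"
        unfolding a_minus_def using u v by (intro M.R.finsum_addf) auto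
      moreover have "(\<Oplus>\<^bsub>A\<^esub>i\<in>{..<c}. \<ominus>\<^bsub>A\<^esub> u i) = \<ominus>\<^bsub>A\<^esub> (\<Oplus>\<^bsub>A\<^esub>i\<in>{..<c}. u i)"
        using u by (intro M.R.finsum_minus) auto
      moreover have "(\<Oplus>\<^bsub>A\<^esub>i\<in>{..<c}. v i) = \<psi> l (\<Oplus>\<^bsub>M'\<^esub>i\<in>{..<c}. \<kappa> i (\<pi> i (w' k)))"
        unfolding v_def using w'[OF kl(1)] \<pi>c \<kappa>c lin'[OF kl(2)]
        by (intro M'.linear_form_finsum[symmetric]) auto
      moreover have "(\<Oplus>\<^bsub>M'\<^esub>i\<in>{..<c}. \<kappa> i (\<pi> i (w' k))) = w' k"
        using \<kappa>\<pi> w' kl by blast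
      moreover have "\<psi> l (w' k) = (if k = l then \<one>\<^bsub>A\<^esub> else \<zero>\<^bsub>A\<^esub>)"
        using sys' kl by (simp add: dual_system_def)
      moreover have "(\<Oplus>\<^bsub>A\<^esub>i\<in>{..<c}. u i) = (\<Oplus>\<^bsub>A\<^esub>x\<in>{..<c} \<times> {..<a}. B k (fst x, snd x) \<otimes>\<^bsub>A\<^esub> C (fst x, snd x) l)"
        unfolding u_def using B C kl by (intro M.R.finsum_Sigma) auto
      ultimately show "(if k = l then \<one>\<^bsub>A\<^esub> else \<zero>\<^bsub>A\<^esub>) \<ominus>\<^bsub>A\<^esub> (\<Oplus>\<^bsub>A\<^esub>x\<in>{..<c} \<times> {..<a}. B k x \<otimes>\<^bsub>A\<^esub> C x l) \<in> I"
        using mem by (simp only: a_minus_def prod.collapse)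
    next
      fix k x assume "k < r" "x \<in> {..<c} \<times> {..<a}"
      then show "B k x \<in> carrier A"
        using B[of k "fst x" "snd x"] by (simp add: mem_Times_iff)
    next
      fix l x assume "l < r" "x \<in> {..<c} \<times> {..<a}"
      then show "C x l \<in> carrier A"
        using C[of l "fst x" "snd x"] by (simp add: mem_Times_iff)
    qed simp
    then show ?thesis
      by simp
  qed
  ultimately have "max_free_rank M' A = c * a"
    unfolding max_free_rank_def by (intro Greatest_equality) auto
  then show "max_free_rank M' A = c * max_free_rank M A"
    by (simp add: a_def)
  show "\<exists>b'. \<forall>r. has_free_summand A M' r \<longrightarrow> r \<le> b'"
    using upper by blast
qed

subsection \<open>Bases over a subring and extensions with radical inclusion\<close>

text \<open>The maps \<open>m i\<close> are \<open>s \<mapsto> \<iota> s \<eta>\<^sup>i\<close> for the basis of \<open>R\<close> over \<open>S\<close>, and \<open>s \<mapsto> s\<^sup>p v\<^sub>i\<close> for a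
  basis of a ring over its subring of \<open>p\<close>-th powers.\<close>

locale additive_basis = S: ring S + G: ring G
  for S :: "('s, 'x) ring_scheme" and G :: "('g, 'y) ring_scheme" +
  fixes c :: nat and m :: "nat \<Rightarrow> 's \<Rightarrow> 'g"
  assumes m_in_carrier: "i < c \<Longrightarrow> s \<in> carrier S \<Longrightarrow> m i s \<in> carrier G"
    and m_add: "i < c \<Longrightarrow> s \<in> carrier S \<Longrightarrow> t \<in> carrier S \<Longrightarrow> m i (s \<oplus>\<^bsub>S\<^esub> t) = m i s \<oplus>\<^bsub>G\<^esub> m i t"
    and unique_repr: "x \<in> carrier G \<Longrightarrow>
      \<exists>!s. s \<in> {..<c} \<rightarrow>\<^sub>E carrier S \<and> x = (\<Oplus>\<^bsub>G\<^esub>i\<in>{..<c}. m i (s i))"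
begin

definition comb :: "(nat \<Rightarrow> 's) \<Rightarrow> 'g" where
  "comb s = (\<Oplus>\<^bsub>G\<^esub>i\<in>{..<c}. m i (s i))"

definition coord :: "'g \<Rightarrow> nat \<Rightarrow> 's" where
  "coord x = (THE s. s \<in> {..<c} \<rightarrow>\<^sub>E carrier S \<and> x = (\<Oplus>\<^bsub>G\<^esub>i\<in>{..<c}. m i (s i)))"

lemma comb_cong: "(\<And>i. i < c \<Longrightarrow> s i = t i) \<Longrightarrow> (\<And>i. i < c \<Longrightarrow> t i \<in> carrier S) \<Longrightarrow> comb s = comb t"
  unfolding comb_def using m_in_carrier by (intro G.finsum_cong') auto

lemma comb_closed: "(\<And>i. i < c \<Longrightarrow> s i \<in> carrier S) \<Longrightarrow> comb s \<in> carrier G"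
  unfolding comb_def using m_in_carrier by (intro G.finsum_closed) auto

lemma coord_props:
  assumes "x \<in> carrier G"
  shows "coord x \<in> {..<c} \<rightarrow>\<^sub>E carrier S" "comb (coord x) = x"
  using theI'[OF unique_repr[OF assms]] unfolding coord_def comb_def by auto

lemma coord_closed:
  assumes "x \<in> carrier G" "i < c"
  shows "coord x i \<in> carrier S"
  using PiE_mem[OF coord_props(1)[OF assms(1)], of i] assms(2) by simp

lemma coord_comb:
  assumes s: "\<And>i. i < c \<Longrightarrow> s i \<in> carrier S" and i: "i < c"
  shows "coord (comb s) i = s i"
proof -
  have x: "comb s \<in> carrier G"
    using s by (rule comb_closed)
  let ?Q = "\<lambda>t. t \<in> {..<c} \<rightarrow>\<^sub>E carrier S \<and> comb s = (\<Oplus>\<^bsub>G\<^esub>i\<in>{..<c}. m i (t i))"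
  have "comb (restrict s {..<c}) = comb s"
    using s by (intro comb_cong) auto
  then have "?Q (restrict s {..<c})"
    using s unfolding comb_def by auto
  moreover have "?Q (coord (comb s))"
    using coord_props[OF x] unfolding comb_def by auto
  ultimately have "restrict s {..<c} = coord (comb s)"
    using unique_repr[OF x] by blast
  then show ?thesis
    using i by (metis lessThan_iff restrict_apply')
qed

lemma comb_add:
  assumes "\<And>i. i < c \<Longrightarrow> s i \<in> carrier S" "\<And>i. i < c \<Longrightarrow> t i \<in> carrier S"
  shows "comb (\<lambda>i. s i \<oplus>\<^bsub>S\<^esub> t i) = comb s \<oplus>\<^bsub>G\<^esub> comb t"
proof -
  have "comb (\<lambda>i. s i \<oplus>\<^bsub>S\<^esub> t i) = (\<Oplus>\<^bsub>G\<^esub>i\<in>{..<c}. m i (s i) \<oplus>\<^bsub>G\<^esub> m i (t i))"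
    unfolding comb_def using assms m_in_carrier m_add by (intro G.finsum_cong') auto
  also have "\<dots> = comb s \<oplus>\<^bsub>G\<^esub> comb t"
    unfolding comb_def using assms m_in_carrier by (intro G.finsum_addf) auto
  finally show ?thesis .
qed

lemma m_zero:
  assumes "i < c"
  shows "m i \<zero>\<^bsub>S\<^esub> = \<zero>\<^bsub>G\<^esub>"
proof -
  have "m i \<zero>\<^bsub>S\<^esub> \<oplus>\<^bsub>G\<^esub> m i \<zero>\<^bsub>S\<^esub> = m i \<zero>\<^bsub>S\<^esub>"
    using m_add[OF assms, of "\<zero>\<^bsub>S\<^esub>" "\<zero>\<^bsub>S\<^esub>"] by simp
  then show ?thesis
    using m_in_carrier[OF assms, of "\<zero>\<^bsub>S\<^esub>"] by (metis G.add.l_cancel_one S.zero_closed)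
qed

lemma comb_single:
  assumes "i < c" "s \<in> carrier S"
  shows "comb (\<lambda>j. if j = i then s else \<zero>\<^bsub>S\<^esub>) = m i s"
  unfolding comb_def using assms m_zero m_in_carrier by (subst G.finsum_single[of _ i]) auto

lemma coord_m:
  assumes "i < c" "j < c" "s \<in> carrier S"
  shows "coord (m i s) j = (if j = i then s else \<zero>\<^bsub>S\<^esub>)"
proof -
  have "coord (comb (\<lambda>j. if j = i then s else \<zero>\<^bsub>S\<^esub>)) j = (if j = i then s else \<zero>\<^bsub>S\<^esub>)"
    using assms by (intro coord_comb) auto
  then show ?thesis
    using assms by (simp add: comb_single)
qed

lemma coord_add:
  assumes "x \<in> carrier G" "y \<in> carrier G" "i < c"
  shows "coord (x \<oplus>\<^bsub>G\<^esub> y) i = coord x i \<oplus>\<^bsub>S\<^esub> coord y i"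
proof -
  have "x \<oplus>\<^bsub>G\<^esub> y = comb (\<lambda>i. coord x i \<oplus>\<^bsub>S\<^esub> coord y i)"
    using comb_add[of "coord x" "coord y"] coord_closed[OF assms(1)] coord_closed[OF assms(2)]
      coord_props(2)[OF assms(1)] coord_props(2)[OF assms(2)] by simp
  then show ?thesis
    using coord_comb[of "\<lambda>i. coord x i \<oplus>\<^bsub>S\<^esub> coord y i" i] coord_closed[OF assms(1)] coord_closed[OF assms(2)] assms(3)
    by simp
qed

lemma additive_finsum:
  assumes add: "\<And>x y. x \<in> carrier G \<Longrightarrow> y \<in> carrier G \<Longrightarrow> \<beta> (x \<oplus>\<^bsub>G\<^esub> y) = \<beta> x \<oplus>\<^bsub>G\<^esub> \<beta> y"
    and closed: "\<And>x. x \<in> carrier G \<Longrightarrow> \<beta> x \<in> carrier G"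
    and A: "finite A" "\<And>a. a \<in> A \<Longrightarrow> f a \<in> carrier G"
  shows "\<beta> (\<Oplus>\<^bsub>G\<^esub>a\<in>A. f a) = (\<Oplus>\<^bsub>G\<^esub>a\<in>A. \<beta> (f a))"
  using A
proof (induction A rule: finite_induct)
  case empty
  have "\<beta> \<zero>\<^bsub>G\<^esub> \<oplus>\<^bsub>G\<^esub> \<beta> \<zero>\<^bsub>G\<^esub> = \<beta> \<zero>\<^bsub>G\<^esub>"
    using add[of "\<zero>\<^bsub>G\<^esub>" "\<zero>\<^bsub>G\<^esub>"] by simp
  then have "\<beta> \<zero>\<^bsub>G\<^esub> = \<zero>\<^bsub>G\<^esub>"
    using closed[of "\<zero>\<^bsub>G\<^esub>"] by (metis G.add.l_cancel_one G.zero_closed)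
  then show ?case
    by simp
next
  case (insert a A)
  have fA: "f \<in> A \<rightarrow> carrier G" "f a \<in> carrier G"
    using insert.prems by auto
  have "\<beta> (\<Oplus>\<^bsub>G\<^esub>a\<in>insert a A. f a) = \<beta> (f a) \<oplus>\<^bsub>G\<^esub> \<beta> (\<Oplus>\<^bsub>G\<^esub>a\<in>A. f a)"
    using insert.hyps fA add G.finsum_closed[OF fA(1)] by (simp add: G.finsum_insert)
  also have "\<dots> = \<beta> (f a) \<oplus>\<^bsub>G\<^esub> (\<Oplus>\<^bsub>G\<^esub>a\<in>A. \<beta> (f a))"
    using insert.IH insert.prems by simp
  also have "\<dots> = (\<Oplus>\<^bsub>G\<^esub>a\<in>insert a A. \<beta> (f a))"
    using insert.hyps fA closed by (intro G.finsum_insert[symmetric]) auto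
  finally show ?case .
qed

text \<open>The coordinate maps \<alpha> may differ from \<beta> in kind. This covers the semilinear
  case: multiplication by \<open>a^p\<close> on a ring acts on coordinates over its
  \<open>p\<close>-th powers as multiplication by \<open>a\<close>, since coordinates are taken as
  \<open>p\<close>-th roots.\<close>

lemma comb_map:
  assumes add: "\<And>x y. x \<in> carrier G \<Longrightarrow> y \<in> carrier G \<Longrightarrow> \<beta> (x \<oplus>\<^bsub>G\<^esub> y) = \<beta> x \<oplus>\<^bsub>G\<^esub> \<beta> y"
    and closed: "\<And>x. x \<in> carrier G \<Longrightarrow> \<beta> x \<in> carrier G"
    and m: "\<And>i s. i < c \<Longrightarrow> s \<in> carrier S \<Longrightarrow> \<beta> (m i s) = m i (\<alpha> i s)"
    and \<alpha>: "\<And>i s. i < c \<Longrightarrow> s \<in> carrier S \<Longrightarrow> \<alpha> i s \<in> carrier S"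
    and s: "\<And>i. i < c \<Longrightarrow> s i \<in> carrier S"
  shows "\<beta> (comb s) = comb (\<lambda>i. \<alpha> i (s i))"
proof -
  have "\<beta> (comb s) = (\<Oplus>\<^bsub>G\<^esub>i\<in>{..<c}. \<beta> (m i (s i)))"
    unfolding comb_def using s m_in_carrier by (intro additive_finsum[of \<beta>] add closed) auto
  also have "\<dots> = comb (\<lambda>i. \<alpha> i (s i))"
    unfolding comb_def using m s \<alpha> m_in_carrier by (intro G.finsum_cong') auto
  finally show ?thesis .
qed

lemma coord_map:
  assumes add: "\<And>x y. x \<in> carrier G \<Longrightarrow> y \<in> carrier G \<Longrightarrow> \<beta> (x \<oplus>\<^bsub>G\<^esub> y) = \<beta> x \<oplus>\<^bsub>G\<^esub> \<beta> y"
    and closed: "\<And>x. x \<in> carrier G \<Longrightarrow> \<beta> x \<in> carrier G"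
    and m: "\<And>i s. i < c \<Longrightarrow> s \<in> carrier S \<Longrightarrow> \<beta> (m i s) = m i (\<alpha> i s)"
    and \<alpha>: "\<And>i s. i < c \<Longrightarrow> s \<in> carrier S \<Longrightarrow> \<alpha> i s \<in> carrier S"
    and x: "x \<in> carrier G" and i: "i < c"
  shows "coord (\<beta> x) i = \<alpha> i (coord x i)"
proof -
  have "\<beta> (comb (coord x)) = comb (\<lambda>i. \<alpha> i (coord x i))"
    using add closed m \<alpha> coord_closed[OF x] by (rule comb_map)
  then show ?thesis
    using coord_props(2)[OF x] coord_comb[of "\<lambda>i. \<alpha> i (coord x i)" i] \<alpha> coord_closed[OF x] i by simp
qed

end

section \<open>Ring homomorphisms, chains of primes and the residue field\<close>

lemma hom_char_zero:
  assumes "ring R" "ring S" "h \<in> ring_hom R S" "[(n::nat)] \<cdot>\<^bsub>R\<^esub> \<one>\<^bsub>R\<^esub> = \<zero>\<^bsub>R\<^esub>"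
  shows "[n] \<cdot>\<^bsub>S\<^esub> \<one>\<^bsub>S\<^esub> = \<zero>\<^bsub>S\<^esub>"
proof -
  interpret ring_hom_ring R S h
    using assms(1-3) by (intro ring_hom_ringI2)
  have "h ([k] \<cdot>\<^bsub>R\<^esub> \<one>\<^bsub>R\<^esub>) = [k] \<cdot>\<^bsub>S\<^esub> \<one>\<^bsub>S\<^esub>" for k :: nat
    by (induction k) auto
  from this[of n] show ?thesis
    using assms(4) by simp
qed

lemma primeideal_vimage:
  assumes A: "cring A" and B: "cring B" and h: "h \<in> ring_hom A B" and Q: "primeideal Q B"
  shows "primeideal {a \<in> carrier A. h a \<in> Q} A"
proof -
  interpret ring_hom_cring A B h
    using A B h by (simp add: ring_hom_cring_def ring_hom_cring_axioms_def)
  interpret Q: primeideal Q B by fact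
  show ?thesis
  proof (rule primeidealI)
    show "ideal {a \<in> carrier A. h a \<in> Q} A"
      using ring_hom_ring.ideal_vimage[OF _ Q.is_ideal, of A h] A B h
      by (simp add: ring_hom_ringI2 cring.axioms(1))
    show "carrier A \<noteq> {a \<in> carrier A. h a \<in> Q}"
    proof
      assume "carrier A = {a \<in> carrier A. h a \<in> Q}"
      then have "h \<one>\<^bsub>A\<^esub> \<in> Q"
        by blast
      then show False
        using Q.one_imp_carrier Q.I_notcarr by simp
    qed
    fix a b assume ab: "a \<in> carrier A" "b \<in> carrier A" "a \<otimes>\<^bsub>A\<^esub> b \<in> {a \<in> carrier A. h a \<in> Q}"
    then show "a \<in> {a \<in> carrier A. h a \<in> Q} \<or> b \<in> {a \<in> carrier A. h a \<in> Q}"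
      using Q.I_prime[of "h a" "h b"] by auto
  qed (use A in simp)
qed

lemma (in primeideal) prime_nat_pow:
  assumes "a \<in> carrier R" "a [^] (n::nat) \<in> I"
  shows "a \<in> I"
  using assms(2)
proof (induction n)
  case 0
  then show ?case
    using one_imp_carrier I_notcarr by simp
next
  case (Suc n)
  then show ?case
    using I_prime[of "a [^] n" a] assms(1) by auto
qed

text \<open>Strictness is the point: for \<open>b\<close> in the larger but not in the smaller
  prime, \<open>k b\<close> maps to a power of \<open>b\<close> and so separates the two
  preimages.\<close>

lemma prime_chain_vimage:
  assumes A: "cring A" and B: "cring B" and h: "h \<in> ring_hom A B"
    and k: "\<And>b. b \<in> carrier B \<Longrightarrow> k b \<in> carrier A" "\<And>b. b \<in> carrier B \<Longrightarrow> h (k b) = b [^]\<^bsub>B\<^esub> N"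
    and N: "N > (0::nat)"
    and prime: "\<forall>i\<le>l. primeideal (Q i) B" and chain: "\<forall>i<l. Q i \<subset> Q (Suc i)"
  shows "\<exists>Q. (\<forall>i\<le>l. primeideal (Q i) A) \<and> (\<forall>i<l. Q i \<subset> Q (Suc i))"
proof (intro exI conjI allI impI)
  fix i assume i: "i < l"
  interpret Qi: primeideal "Q i" B
    using prime i by simp
  interpret Qs: primeideal "Q (Suc i)" B
    using prime i by simp
  obtain b where b: "b \<in> Q (Suc i)" "b \<notin> Q i" "b \<in> carrier B"
    using chain i Qs.Icarr by blast
  obtain N' where N': "N = Suc N'"
    using N by (cases N) auto
  have "b [^]\<^bsub>B\<^esub> N \<in> Q (Suc i)"
    unfolding N' using b Qs.I_l_closed[OF b(1), of "b [^]\<^bsub>B\<^esub> N'"] by simp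
  moreover have "b [^]\<^bsub>B\<^esub> N \<notin> Q i"
    using Qi.prime_nat_pow b by blast
  ultimately have "k b \<in> {a \<in> carrier A. h a \<in> Q (Suc i)} - {a \<in> carrier A. h a \<in> Q i}"
    using k b by simp
  then show "{a \<in> carrier A. h a \<in> Q i} \<subset> {a \<in> carrier A. h a \<in> Q (Suc i)}"
    using chain i by blast
qed (use prime primeideal_vimage[OF A B h] in auto)

text \<open>Both composites being \<open>N\<close>-th power maps, prime chains can be pulled back
  along \<open>h\<close> and along \<open>k\<close> with their length preserved.\<close>

lemma krull_dim_eq:
  assumes A: "cring A" and B: "cring B" and h: "h \<in> ring_hom A B" and k: "k \<in> ring_hom B A"
    and N: "N > (0::nat)"
    and hk: "\<And>b. b \<in> carrier B \<Longrightarrow> h (k b) = b [^]\<^bsub>B\<^esub> N"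
    and kh: "\<And>a. a \<in> carrier A \<Longrightarrow> k (h a) = a [^]\<^bsub>A\<^esub> N"
  shows "krull_dim A = krull_dim B"
proof -
  have "(\<exists>Q. (\<forall>i\<le>l. primeideal (Q i) A) \<and> (\<forall>i<l. Q i \<subset> Q (Suc i))) \<longleftrightarrow>
      (\<exists>Q. (\<forall>i\<le>l. primeideal (Q i) B) \<and> (\<forall>i<l. Q i \<subset> Q (Suc i)))" for l
  proof
    assume "\<exists>Q. (\<forall>i\<le>l. primeideal (Q i) A) \<and> (\<forall>i<l. Q i \<subset> Q (Suc i))"
    then obtain Q where Q: "\<forall>i\<le>l. primeideal (Q i) A" "\<forall>i<l. Q i \<subset> Q (Suc i)"
      by blast
    show "\<exists>Q. (\<forall>i\<le>l. primeideal (Q i) B) \<and> (\<forall>i<l. Q i \<subset> Q (Suc i))"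
      by (rule prime_chain_vimage[OF B A k ring_hom_closed[OF h] kh N Q])
  next
    assume "\<exists>Q. (\<forall>i\<le>l. primeideal (Q i) B) \<and> (\<forall>i<l. Q i \<subset> Q (Suc i))"
    then obtain Q where Q: "\<forall>i\<le>l. primeideal (Q i) B" "\<forall>i<l. Q i \<subset> Q (Suc i)"
      by blast
    show "\<exists>Q. (\<forall>i\<le>l. primeideal (Q i) A) \<and> (\<forall>i<l. Q i \<subset> Q (Suc i))"
      by (rule prime_chain_vimage[OF A B h ring_hom_closed[OF k] hk N Q])
  qed
  then show ?thesis
    by (simp add: krull_dim_def)
qed

lemma (in ideal) unit_imp_carrier:
  assumes "u \<in> I" "u \<in> Units R"
  shows "I = carrier R"
proof -
  have "inv u \<otimes> u \<in> I"
    using assms by (intro I_l_closed) auto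
  then show ?thesis
    using assms one_imp_carrier by simp
qed

text \<open>Evaluates the definite description in the definition of
  \<open>residue_field\<close>.\<close>

lemma local_maximalideal:
  assumes R: "cring R" and I: "ideal I R" "I \<noteq> carrier R"
    and local: "\<And>a. a \<in> carrier R \<Longrightarrow> a \<notin> I \<Longrightarrow> a \<in> Units R"
  shows "maximalideal M R \<longleftrightarrow> M = I"
proof -
  interpret cring R by fact
  interpret I: ideal I R by fact
  have sub: "J \<subseteq> I" if J: "ideal J R" "J \<noteq> carrier R" for J
  proof
    fix a assume a: "a \<in> J"
    interpret J: ideal J R by fact
    show "a \<in> I"
      using J.unit_imp_carrier[OF a] local[of a] J.Icarr[OF a] J(2) by blast
  qed
  have "maximalideal I R"
    using I sub by (intro maximalidealI) (auto intro: I.is_ideal)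
  moreover have "M = I" if "maximalideal M R"
  proof -
    interpret M: maximalideal M R by fact
    show ?thesis
      using M.I_maximal[OF I(1)] sub[OF M.is_ideal] M.I_notcarr I(2) I.Icarr by blast
  qed
  ultimately show ?thesis
    by blast
qed

text \<open>The kernel of \<chi> is the maximal ideal, since everything outside it is a unit. The
  residue field is thus isomorphic to \<open>K\<close>, compatibly with \<open>p\<close>-th powers,
  and the degree carries over.\<close>

lemma residue_log_degree_eq:
  assumes R: "cring R" and K: "field K" and \<chi>: "\<chi> \<in> ring_hom R K" "\<chi> ` carrier R = carrier K"
    and local: "\<And>a. a \<in> carrier R \<Longrightarrow> \<chi> a \<noteq> \<zero>\<^bsub>K\<^esub> \<Longrightarrow> a \<in> Units R"
    and powers: "subfield (pth_powers p K) K"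
    and dim: "ring.dimension K b (pth_powers p K) (carrier K)"
  shows "residue_log_degree p R = log (real p) (real b)"
proof -
  interpret R: cring R by fact
  interpret K: field K by fact
  interpret ring_hom_ring R K \<chi>
    by (rule ring_hom_ringI2[OF R.ring_axioms K.ring_axioms \<chi>(1)])
  define I where "I = a_kernel R K \<chi>"
  have I_iff: "a \<in> I \<longleftrightarrow> a \<in> carrier R \<and> \<chi> a = \<zero>\<^bsub>K\<^esub>" for a
    unfolding I_def a_kernel_def' by blast
  have I: "ideal I R"
    unfolding I_def by (rule kernel_is_ideal)
  have "\<one>\<^bsub>R\<^esub> \<notin> I"
    unfolding I_iff using hom_one K.one_not_zero by simp
  then have ne: "I \<noteq> carrier R"
    using R.one_closed by blast
  have "maximalideal M R \<longleftrightarrow> M = I" for M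
  proof (rule local_maximalideal[OF R I ne])
    fix a assume "a \<in> carrier R" "a \<notin> I"
    then show "a \<in> Units R"
      unfolding I_iff by (intro local) simp_all
  qed
  then have k: "residue_field R = R Quot I"
    unfolding residue_field_def by simp
  define L where "L = R Quot I"
  have ringL: "ring L"
    unfolding L_def by (rule ideal.quotient_is_ring[OF I])
  have "(\<lambda>Y. the_elem (\<chi> ` Y)) \<in> ring_iso L K"
    unfolding L_def I_def by (rule FactRing_iso_set[OF \<chi>(2)])
  \<comment> \<open>The isomorphism is inverted because the dimension is known over \<open>K\<close>
    and has to be pushed forward to the quotient.\<close>
  then have "inv_into (carrier L) (\<lambda>Y. the_elem (\<chi> ` Y)) \<in> ring_iso K L"
    by (rule ring_iso_set_sym[OF ringL])
  then obtain g where g: "g \<in> ring_iso K L"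
    by blast
  interpret L: ring L by fact
  have gh: "g \<in> ring_hom K L"
    using g unfolding ring_iso_def by blast
  interpret g: ring_hom_ring K L g
    by (rule ring_hom_ringI2[OF K.ring_axioms ringL gh])
  have bij: "bij_betw g (carrier K) (carrier L)"
    using g unfolding ring_iso_def by blast
  have one: "\<one>\<^bsub>L\<^esub> \<noteq> \<zero>\<^bsub>L\<^esub>"
  proof
    assume "\<one>\<^bsub>L\<^esub> = \<zero>\<^bsub>L\<^esub>"
    then have "g \<one>\<^bsub>K\<^esub> = g \<zero>\<^bsub>K\<^esub>"
      by simp
    moreover have "inj_on g (carrier K)"
      using bij by (rule bij_betw_imp_inj_on)
    ultimately have "\<one>\<^bsub>K\<^esub> = \<zero>\<^bsub>K\<^esub>"
      using inj_onD[of g "carrier K" "\<one>\<^bsub>K\<^esub>" "\<zero>\<^bsub>K\<^esub>"] K.one_closed K.zero_closed by blast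
    then show False
      using K.one_not_zero by blast
  qed
  have img: "g ` pth_powers p K = pth_powers p L"
  proof -
    have "g (x [^]\<^bsub>K\<^esub> p) = g x [^]\<^bsub>L\<^esub> p" if "x \<in> carrier K" for x
      using that by (induction p) auto
    then have "g ` pth_powers p K = (\<lambda>x. g x [^]\<^bsub>L\<^esub> p) ` carrier K"
      by (auto simp: pth_powers_def image_image)
    also have "\<dots> = pth_powers p L"
      unfolding pth_powers_def bij_betw_imp_surj_on[OF bij, symmetric] by (simp add: image_image)
    finally show ?thesis .
  qed
  have "L.dimension b (g ` pth_powers p K) (g ` carrier K)"
    using bij_betw_imp_inj_on[OF bij] dim by (rule g.inj_hom_dimension[OF powers one])
  then have "L.dimension b (pth_powers p L) (carrier L)"
    using bij_betw_imp_surj_on[OF bij] img by simp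
  moreover have "subfield (pth_powers p L) L"
    using g.img_is_subfield(2)[OF powers one] img by simp
  ultimately have "L.dim (pth_powers p L) (carrier L) = b"
    using L.dimI by (simp add: over_def)
  then show ?thesis
    unfolding residue_log_degree_def k L_def[symmetric] Let_def by simp
qed

section \<open>Bases over the \<open>p\<close>-th powers, for fields and for power series\<close>

lemma (in ring) combine_finsum:
  assumes "length Ks = length Us" "set Ks \<subseteq> carrier R" "set Us \<subseteq> carrier R"
  shows "combine Ks Us = (\<Oplus>i\<in>{..<length Us}. Ks ! i \<otimes> Us ! i)"
  using assms
proof (induction Ks Us rule: list_induct2)
  case (Cons k Ks u Us)
  have eq: "{..<length (u # Us)} = insert 0 (Suc ` {..<length Us})"
    by (simp add: lessThan_Suc_eq_insert_0)
  have c: "Ks ! i \<otimes> Us ! i \<in> carrier R" if "i < length Us" for i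
    using that Cons by (simp add: nth_mem subset_iff)
  have "(\<Oplus>i\<in>Suc ` {..<length Us}. (k # Ks) ! i \<otimes> (u # Us) ! i) = (\<Oplus>i\<in>{..<length Us}. Ks ! i \<otimes> Us ! i)"
    using c by (subst finsum_reindex) auto
  then show ?case
    unfolding eq using Cons c by (subst finsum_insert) auto
qed simp

lemma (in field) power_p_inject:
  assumes "char_cring R p" "a \<in> carrier R" "b \<in> carrier R" "a [^] p = b [^] p"
  shows "a = b"
proof -
  interpret char_cring R p by fact
  have "(a \<ominus> b) [^] p = a [^] p \<oplus> (\<ominus> b) [^] p"
    unfolding a_minus_def using assms by (intro frob_add) auto
  also have "(\<ominus> b) [^] p = \<ominus> (b [^] p)"
    using frob_minus[of b 1] assms by simp
  finally have z: "(a \<ominus> b) [^] p = \<zero>"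
    using assms by (simp add: r_neg)
  have "x = \<zero>" if "x \<in> carrier R" "x [^] n = \<zero>" for x and n :: nat
    using that(2)
  proof (induction n)
    case (Suc n)
    then show ?case
      using that(1) integral[of "x [^] n" x] by auto
  qed simp
  from this[OF _ z] have "a \<ominus> b = \<zero>"
    using assms by simp
  then show ?thesis
    using assms by simp
qed

lemma (in field) pth_powers_subfield:
  assumes "char_cring R p"
  shows "subfield (pth_powers p R) R"
proof -
  interpret char_cring R p by fact
  have "(\<lambda>x. x [^] p) \<in> ring_hom R R"
    by (rule ring_hom_memI) (auto simp: frob_add nat_pow_distrib)
  then interpret F: ring_hom_ring R R "\<lambda>x. x [^] p"
    by unfold_locales
  show ?thesis
    unfolding pth_powers_def by (rule F.img_is_subfield(2)[OF carrier_is_subfield one_not_zero])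
qed

text \<open>A vector space basis over the subfield of \<open>p\<close>-th powers, with each scalar
  replaced by its \<open>p\<close>-th root. The root is unique because Frobenius is injective on a
  field, so the coordinates range over the field itself.\<close>

lemma (in field) frobenius_basis:
  assumes char: "char_cring R p" and dim: "dimension b (pth_powers p R) (carrier R)"
  obtains u where "\<And>i. i < b \<Longrightarrow> u i \<in> carrier R"
    "additive_basis R R b (\<lambda>i s. s [^] p \<otimes> u i)"
proof -
  interpret char_cring R p by fact
  note sub = pth_powers_subfield[OF char]
  obtain Us where Us: "set Us \<subseteq> carrier R" "independent (pth_powers p R) Us" "length Us = b"
    "Span (pth_powers p R) Us = carrier R"
    using exists_base[OF sub dim] by blast
  have u: "Us ! i \<in> carrier R" if "i < b" for i
    using nth_mem[of i Us] Us(1,3) that by auto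
  have eq: "combine (map (\<lambda>i. s i [^] p) [0..<b]) Us = (\<Oplus>i\<in>{..<b}. s i [^] p \<otimes> Us ! i)"
    if "s \<in> {..<b} \<rightarrow> carrier R" for s
  proof -
    have "combine (map (\<lambda>i. s i [^] p) [0..<b]) Us = (\<Oplus>i\<in>{..<b}. map (\<lambda>i. s i [^] p) [0..<b] ! i \<otimes> Us ! i)"
      using Us that by (subst combine_finsum) auto
    also have "\<dots> = (\<Oplus>i\<in>{..<b}. s i [^] p \<otimes> Us ! i)"
      using u that by (intro finsum_cong') auto
    finally show ?thesis .
  qed
  have mem: "set (map (\<lambda>i. s i [^] p) [0..<b]) \<subseteq> pth_powers p R" if "s \<in> {..<b} \<rightarrow> carrier R" for s
  proof
    fix y assume "y \<in> set (map (\<lambda>i. s i [^] p) [0..<b])"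
    then obtain i where "i < b" "y = s i [^] p"
      by auto
    then show "y \<in> pth_powers p R"
      using funcset_mem[OF that, of i] by (simp add: pth_powers_def)
  qed
  have ex1: "\<exists>!Ks. set Ks \<subseteq> pth_powers p R \<and> length Ks = length Us \<and> x = combine Ks Us"
    if "x \<in> carrier R" for x
    by (rule unique_decomposition[OF sub Us(2)]) (simp only: that Us(4))
  have ex: "\<exists>s \<in> {..<b} \<rightarrow> carrier R. x = (\<Oplus>i\<in>{..<b}. s i [^] p \<otimes> Us ! i)" if x: "x \<in> carrier R" for x
  proof -
    obtain Ks where Ks: "set Ks \<subseteq> pth_powers p R" "length Ks = b" "x = combine Ks Us"
      using ex1_implies_ex[OF ex1[OF x]] Us(3) by blast
    have "\<forall>i\<in>{..<b}. \<exists>y. y \<in> carrier R \<and> Ks ! i = y [^] p"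
    proof
      fix i assume "i \<in> {..<b}"
      then have "Ks ! i \<in> pth_powers p R"
        using Ks(1,2) nth_mem[of i Ks] by auto
      then show "\<exists>y. y \<in> carrier R \<and> Ks ! i = y [^] p"
        unfolding pth_powers_def by blast
    qed
    then obtain s where s: "\<forall>i\<in>{..<b}. s i \<in> carrier R \<and> Ks ! i = s i [^] p"
      by (rule bchoice[THEN exE])
    then have sP: "s \<in> {..<b} \<rightarrow> carrier R"
      by simp
    have "Ks = map (\<lambda>i. s i [^] p) [0..<b]"
      using s Ks(2) by (intro nth_equalityI) simp_all
    then show ?thesis
      using Ks(3) eq[OF sP] sP by (intro bexI[of _ s]) simp_all
  qed
  have uniq: "s i = t i"
    if s: "s \<in> {..<b} \<rightarrow> carrier R" and t: "t \<in> {..<b} \<rightarrow> carrier R" and i: "i < b"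
      and st: "(\<Oplus>i\<in>{..<b}. s i [^] p \<otimes> Us ! i) = (\<Oplus>i\<in>{..<b}. t i [^] p \<otimes> Us ! i)" for s t i
  proof -
    let ?l = "\<lambda>s. map (\<lambda>i. s i [^] p) [0..<b]"
    have su: "s i [^] p \<otimes> Us ! i \<in> carrier R" if "i < b" for i
      using funcset_mem[OF s, of i] u[OF that] that by simp
    have "combine (?l s) Us \<in> carrier R"
      unfolding eq[OF s] using su by (intro finsum_closed Pi_I) simp
    then obtain Ks where "\<forall>Ks'. set Ks' \<subseteq> pth_powers p R \<and> length Ks' = length Us \<and>
        combine (?l s) Us = combine Ks' Us \<longrightarrow> Ks' = Ks"
      by (rule ex1[THEN ex1E])
    then have Ks: "?l r = Ks" if "r \<in> {..<b} \<rightarrow> carrier R" "combine (?l s) Us = combine (?l r) Us" for r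
      using mem[OF that(1)] that(2) Us(3) by (metis length_map length_upt diff_zero)
    have "combine (?l s) Us = combine (?l t) Us"
      unfolding eq[OF s] eq[OF t] by (rule st)
    then have "?l s = ?l t"
      using Ks[OF s refl] Ks[OF t] by (simp only:)
    then have "?l s ! i = ?l t ! i"
      by (rule arg_cong)
    then have "s i [^] p = t i [^] p"
      using i by simp
    then show ?thesis
      using funcset_mem[OF s, of i] funcset_mem[OF t, of i] i by - (rule power_p_inject[OF char]; simp)
  qed
  have ring: "ring R"
    by (rule ring_axioms)
  have basis: "additive_basis R R b (\<lambda>i s. s [^] p \<otimes> Us ! i)"
  proof (intro additive_basis.intro ring additive_basis_axioms.intro)
    fix x assume x: "x \<in> carrier R"
    obtain s where s: "s \<in> {..<b} \<rightarrow> carrier R" "x = (\<Oplus>i\<in>{..<b}. s i [^] p \<otimes> Us ! i)"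
      using ex[OF x] by blast
    show "\<exists>!s. s \<in> {..<b} \<rightarrow>\<^sub>E carrier R \<and> x = (\<Oplus>i\<in>{..<b}. s i [^] p \<otimes> Us ! i)"
    proof (rule ex1I[of _ "restrict s {..<b}"])
      have "x = (\<Oplus>i\<in>{..<b}. restrict s {..<b} i [^] p \<otimes> Us ! i)"
        unfolding s(2)
      proof (rule finsum_cong')
        show "(\<lambda>i. restrict s {..<b} i [^] p \<otimes> Us ! i) \<in> {..<b} \<rightarrow> carrier R"
          using funcset_mem[OF s(1)] u by (intro Pi_I) simp
      qed simp_all
      then show "restrict s {..<b} \<in> {..<b} \<rightarrow>\<^sub>E carrier R \<and> x = (\<Oplus>i\<in>{..<b}. restrict s {..<b} i [^] p \<otimes> Us ! i)"
        using s(1) by auto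
    next
      fix t assume t: "t \<in> {..<b} \<rightarrow>\<^sub>E carrier R \<and> x = (\<Oplus>i\<in>{..<b}. t i [^] p \<otimes> Us ! i)"
      then have t': "t \<in> {..<b} \<rightarrow> carrier R" "t \<in> extensional {..<b}"
        by (simp_all add: PiE_def)
      have "t i = s i" if "i < b" for i
        using t s(2) by (intro uniq[OF t'(1) s(1) that]) simp
      then show "t = restrict s {..<b}"
        using t'(2) by (intro extensionalityI[of _ "{..<b}"]) auto
    qed
  next
    fix i s assume "i < b" "s \<in> carrier R"
    then show "s [^] p \<otimes> Us ! i \<in> carrier R"
      using u[of i] by simp
  next
    fix i s t assume "i < b" "s \<in> carrier R" "t \<in> carrier R"
    then show "(s \<oplus> t) [^] p \<otimes> Us ! i = s [^] p \<otimes> Us ! i \<oplus> t [^] p \<otimes> Us ! i"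
      using u[of i] by (simp add: frob_add l_distr)
  qed
  show ?thesis
    using u basis by (rule that)
qed

locale char_power_series = power_series R V + char_cring R p
  for R (structure) and V :: "'v set" and p
begin

sublocale PC: char_cring P p
proof
  show "[p] \<cdot>\<^bsub>P\<^esub> \<one>\<^bsub>P\<^esub> = \<zero>\<^bsub>P\<^esub>"
    by (rule hom_char_zero[OF ring_axioms P.ring_axioms ps_const_hom char_p])
qed (rule prime_p)

text \<open>Frobenius is additive on finite sums only. Hence \<open>s\<close> is cut after the
  degree of \<open>m\<close>: the polynomial part is raised termwise, and the power of the tail has
  no coefficient at \<open>m\<close>.\<close>

lemma coeff_pth_power:
  assumes s: "s \<in> carrier P" and m: "m \<in> E"
  shows "(s [^]\<^bsub>P\<^esub> p) m = (if \<forall>v. p dvd m v then s (\<lambda>v. m v div p) [^] p else \<zero>)"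
proof -
  define A where "A = {k \<in> E. edeg V k < Suc (edeg V m)}"
  have A: "finite A" "A \<subseteq> E"
    unfolding A_def using finite_edeg by auto
  have sA: "s k \<in> carrier R" if "k \<in> A" for k
    using that A s by blast
  define f where "f = (\<Oplus>\<^bsub>P\<^esub>k\<in>A. pmonom (s k) k)"
  define r where "r = s \<ominus>\<^bsub>P\<^esub> f"
  have f: "f \<in> carrier P"
    unfolding f_def using sA by (intro P.finsum_closed) auto
  have fk: "f k = (if k \<in> A then s k else \<zero>)" if "k \<in> E" for k
    unfolding f_def using A sA that by (intro finsum_pmonom) auto
  have r: "r \<in> carrier P"
    using s f by (simp add: r_def)
  have rk: "r k = \<zero>" if "k \<in> E" "edeg V k < Suc (edeg V m)" for k
    using that s f fk[OF that(1)] coeff_closed[OF s that(1)] by (simp add: r_def A_def a_minus_def r_neg)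
  have "f \<oplus>\<^bsub>P\<^esub> r = s"
    unfolding r_def using s f by algebra
  then have "s [^]\<^bsub>P\<^esub> p = f [^]\<^bsub>P\<^esub> p \<oplus>\<^bsub>P\<^esub> r [^]\<^bsub>P\<^esub> p"
    using PC.frob_add[OF f r] by simp
  moreover have "(r [^]\<^bsub>P\<^esub> p) m = \<zero>"
  proof -
    obtain p' where p': "p = Suc p'"
      using p_pos by (cases p) auto
    have "r [^]\<^bsub>P\<^esub> p = r \<otimes>\<^bsub>P\<^esub> r [^]\<^bsub>P\<^esub> p'"
      unfolding p' using r by (simp add: P.m_comm)
    then show ?thesis
      using low_coeff_mult[OF r _ rk m] r by simp
  qed
  ultimately have "(s [^]\<^bsub>P\<^esub> p) m = (f [^]\<^bsub>P\<^esub> p) m"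
    using f m by simp
  also have "f [^]\<^bsub>P\<^esub> p = (\<Oplus>\<^bsub>P\<^esub>k\<in>A. pmonom (s k) k [^]\<^bsub>P\<^esub> p)"
    using PC.frob_finsum[of A "\<lambda>k. pmonom (s k) k" 1] A sA by (simp add: f_def Pi_iff)
  also have "\<dots> = (\<Oplus>\<^bsub>P\<^esub>k\<in>A. pmonom (s k [^] p) (\<lambda>v. p * k v))"
    using sA A by (intro P.finsum_cong') (auto simp: monom_pow)
  also have "\<dots> m = (\<Oplus>k\<in>A. if m = (\<lambda>v. p * k v) then s k [^] p else \<zero>)"
    using A sA m by (subst coeff_finsum) (auto simp: coeff_monom intro!: finsum_cong')
  also have "\<dots> = (if \<forall>v. p dvd m v then s (\<lambda>v. m v div p) [^] p else \<zero>)"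
  proof (cases "\<forall>v. p dvd m v")
    case True
    define k0 where "k0 = (\<lambda>v. m v div p)"
    have iff: "m = (\<lambda>v. p * k v) \<longleftrightarrow> k = k0" for k
      using True p_pos by (auto simp: k0_def fun_eq_iff)
    have "k0 \<in> below m"
      by (auto simp: k0_def below_def)
    then have "k0 \<in> A"
      using below_exponents[OF m] edeg_esum[of V k0 "ediff m k0"] by (simp add: A_def)
    then have "(\<Oplus>k\<in>A. if k = k0 then s k [^] p else \<zero>) = s k0 [^] p"
      using A sA by (subst finsum_single[of _ k0]) auto
    then show ?thesis
      using True unfolding iff k0_def[symmetric] by simp
  next
    case False
    then have "m \<noteq> (\<lambda>v. p * k v)" for k
      by (metis dvd_triv_left)
    then have "(\<Oplus>k\<in>A. if m = (\<lambda>v. p * k v) then s k [^] p else \<zero>) = \<zero>"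
      by (intro finsum_zeroI) simp
    then show ?thesis
      unfolding if_not_P[OF False] .
  qed
  finally show ?thesis .
qed

definition small_exponents :: "('v \<Rightarrow> nat) set" where
  "small_exponents = {m \<in> E. \<forall>v. m v < p}"

lemma card_small_exponents: "card small_exponents = p ^ card V"
proof -
  have "bij_betw (\<lambda>m. restrict m V) small_exponents (PiE V (\<lambda>_. {..<p}))"
  proof (rule bij_betwI[of _ _ _ "\<lambda>g v. if v \<in> V then g v else 0"])
    show "(\<lambda>m. restrict m V) \<in> small_exponents \<rightarrow> PiE V (\<lambda>_. {..<p})"
      by (auto simp: small_exponents_def)
    show "(\<lambda>g v. if v \<in> V then g v else 0) \<in> PiE V (\<lambda>_. {..<p}) \<rightarrow> small_exponents"
      using p_pos by (auto simp: small_exponents_def exponents_def)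
    show "(\<lambda>v. if v \<in> V then restrict m V v else 0) = m" if "m \<in> small_exponents" for m
      using that by (auto simp: small_exponents_def exponents_def fun_eq_iff)
    show "restrict (\<lambda>v. if v \<in> V then g v else 0) V = g" if "g \<in> PiE V (\<lambda>_. {..<p})" for g
      using that by (auto simp: fun_eq_iff PiE_def extensional_def)
  qed
  then show ?thesis
    using finite_vars by (simp add: bij_betw_same_card card_PiE)
qed

text \<open>The shift by \<open>a\<close> confines the product to exponents congruent to
  \<open>a\<close> modulo \<open>p\<close>, so the products for different small exponents do not
  overlap.\<close>

lemma coeff_pth_power_monom_mult:
  assumes s: "s \<in> carrier P" and u: "u \<in> carrier R" and a: "a \<in> small_exponents" and m: "m \<in> E"
  shows "(s [^]\<^bsub>P\<^esub> p \<otimes>\<^bsub>P\<^esub> pmonom u a) m =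
    (if a = (\<lambda>v. m v mod p) then s (\<lambda>v. m v div p) [^] p \<otimes> u else \<zero>)"
proof -
  have aE: "a \<in> E" and ap: "a v < p" for v
    using a by (auto simp: small_exponents_def)
  have "(s [^]\<^bsub>P\<^esub> p \<otimes>\<^bsub>P\<^esub> pmonom u a) m = (pmonom u a \<otimes>\<^bsub>P\<^esub> s [^]\<^bsub>P\<^esub> p) m"
    using s u by (simp add: P.m_comm)
  also have "\<dots> = (if a \<in> below m then u \<otimes> (s [^]\<^bsub>P\<^esub> p) (ediff m a) else \<zero>)"
    using s u aE m by (intro coeff_monom_mult) auto
  also have "\<dots> = (if a = (\<lambda>v. m v mod p) then s (\<lambda>v. m v div p) [^] p \<otimes> u else \<zero>)"
  proof (cases "a = (\<lambda>v. m v mod p)")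
    case True
    have "a \<in> below m"
      by (simp add: True below_def)
    moreover have "p dvd ediff m a v" and "ediff m a v div p = m v div p" for v
      by (simp_all add: True ediff_def minus_mod_eq_mult_div p_pos)
    moreover have "(\<lambda>v. m v div p) \<in> E"
      using m by (simp add: exponents_def)
    ultimately show ?thesis
      using True s u m by (simp add: coeff_pth_power m_comm)
  next
    case False
    have notall: "\<not> (\<forall>v. p dvd ediff m a v)" if below: "a \<in> below m"
    proof
      assume dvd: "\<forall>v. p dvd ediff m a v"
      have "a v = m v mod p" for v
      proof -
        obtain k where "m v - a v = p * k"
          using dvd by (auto simp: ediff_def dvd_def)
        moreover have "a v \<le> m v"
          using below by (simp add: below_def)
        ultimately have "m v = a v + p * k"
          by simp
        then show ?thesis
          using ap[of v] by simp
      qed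
      then show False
        using False by blast
    qed
    have "(s [^]\<^bsub>P\<^esub> p) (ediff m a) = \<zero>" if "a \<in> below m"
      unfolding coeff_pth_power[OF s exponents_ediff[OF m]] if_not_P[OF notall[OF that]] by (rule refl)
    then have "u \<otimes> (s [^]\<^bsub>P\<^esub> p) (ediff m a) = \<zero>" if "a \<in> below m"
      using that u by simp
    then show ?thesis
      using False by simp
  qed
  finally show ?thesis .
qed

text \<open>Every exponent is uniquely \<open>p k + a\<close> with all entries of \<open>a\<close>
  below \<open>p\<close>, and the coefficient there expands over the basis of the field. The basis
  consists of the monomials with coefficient \<open>u i\<close> and exponent \<open>a\<close>,
  whence the count \<open>b * p ^ card V\<close>.\<close>

lemma frobenius_basis_series:
  assumes u: "\<And>i. i < b \<Longrightarrow> u i \<in> carrier R"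
    and basis: "additive_basis R R b (\<lambda>i s. s [^] p \<otimes> u i)"
  obtains v where "\<And>i. i < b * p ^ card V \<Longrightarrow> v i \<in> carrier P"
    "additive_basis P P (b * p ^ card V) (\<lambda>i s. s [^]\<^bsub>P\<^esub> p \<otimes>\<^bsub>P\<^esub> v i)"
proof -
  interpret K: additive_basis R R b "\<lambda>i s. s [^] p \<otimes> u i" by fact
  let ?A = "small_exponents"
  define c where "c = b * p ^ card V"
  have cA: "card ({..<b} \<times> ?A) = c"
    by (simp add: c_def card_cartesian_product card_small_exponents)
  have finA: "finite ?A"
    using card_small_exponents p_pos by (intro card_ge_0_finite) simp
  then obtain h where h: "bij_betw h {0..<c} ({..<b} \<times> ?A)"
    using ex_bij_betw_nat_finite[of "{..<b} \<times> ?A"] cA by auto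
  then have h: "bij_betw h {..<c} ({..<b} \<times> ?A)"
    by (simp add: atLeast0LessThan)
  define g where "g = inv_into {..<c} h"
  have hg: "h (g x) = x" "g x \<in> {..<c}" if "x \<in> {..<b} \<times> ?A" for x
  proof -
    have "x \<in> h ` {..<c}"
      using bij_betw_imp_surj_on[OF h] that by simp
    then show "h (g x) = x" "g x \<in> {..<c}"
      unfolding g_def by (rule f_inv_into_f, rule inv_into_into)
  qed
  have gh: "g (h i) = i" if "i < c" for i
    using h that unfolding g_def by (simp add: bij_betw_inv_into_left)
  have hi: "fst (h i) < b" "snd (h i) \<in> ?A" if "i < c" for i
    using bij_betwE[OF h] that by (auto simp: mem_Times_iff)
  define v where "v i = pmonom (u (fst (h i))) (snd (h i))" for i
  have v: "v i \<in> carrier P" if "i < c" for i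
    using u hi[OF that] by (auto simp: v_def)
  have md: "(\<lambda>w. m w mod p) \<in> ?A" "(\<lambda>w. m w div p) \<in> E" if "m \<in> E" for m :: "'v \<Rightarrow> nat"
    using that p_pos by (auto simp: small_exponents_def exponents_def)
  have coeff: "(\<Oplus>\<^bsub>P\<^esub>i\<in>{..<c}. \<sigma> i [^]\<^bsub>P\<^esub> p \<otimes>\<^bsub>P\<^esub> v i) m =
      K.comb (\<lambda>i. \<sigma> (g (i, \<lambda>w. m w mod p)) (\<lambda>w. m w div p))"
    if \<sigma>: "\<And>i. i < c \<Longrightarrow> \<sigma> i \<in> carrier P" and m: "m \<in> E" for \<sigma> m
  proof -
    define a where "a = (\<lambda>w. m w mod p)"
    define k where "k = (\<lambda>w. m w div p)"
    have a: "a \<in> ?A" and k: "k \<in> E"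
      using md[OF m] by (auto simp: a_def k_def)
    \<comment> \<open>Only basis elements whose exponent is the residue of \<open>m\<close> modulo
      \<open>p\<close> contribute, so the coefficient at \<open>m\<close> is a combination over the
      basis of the field.\<close>
    define F where "F x = (if snd x = a then \<sigma> (g x) k [^] p \<otimes> u (fst x) else \<zero>)" for x
    have Fc: "F x \<in> carrier R" if "x \<in> {..<b} \<times> ?A" for x
      using \<sigma> hg(2)[OF that] u that k by (auto simp: F_def)
    have "(\<Oplus>\<^bsub>P\<^esub>i\<in>{..<c}. \<sigma> i [^]\<^bsub>P\<^esub> p \<otimes>\<^bsub>P\<^esub> v i) m = (\<Oplus>i\<in>{..<c}. (\<sigma> i [^]\<^bsub>P\<^esub> p \<otimes>\<^bsub>P\<^esub> v i) m)"
      using \<sigma> v m by (intro coeff_finsum) auto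
    also have "\<dots> = (\<Oplus>i\<in>{..<c}. F (h i))"
    proof (rule finsum_cong')
      fix i assume "i \<in> {..<c}"
      then have i: "i < c"
        by simp
      show "(\<sigma> i [^]\<^bsub>P\<^esub> p \<otimes>\<^bsub>P\<^esub> v i) m = F (h i)"
        using coeff_pth_power_monom_mult[OF \<sigma>[OF i] u[OF hi(1)[OF i]] hi(2)[OF i] m] gh[OF i]
        by (simp add: F_def v_def a_def k_def)
    qed (use Fc bij_betwE[OF h] in auto)
    also have "\<dots> = (\<Oplus>x\<in>{..<b} \<times> ?A. F x)"
      using h Fc by (rule finsum_bij)
    also have "\<dots> = (\<Oplus>i\<in>{..<b}. \<Oplus>x\<in>?A. F (i, x))"
      using finsum_Sigma[of "{..<b}" "\<lambda>_. ?A" "\<lambda>i x. F (i, x)"] finA Fc by simp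
    also have "\<dots> = (\<Oplus>i\<in>{..<b}. F (i, a))"
    proof (rule finsum_cong')
      fix i assume i: "i \<in> {..<b}"
      show "(\<Oplus>x\<in>?A. F (i, x)) = F (i, a)"
        using finA a Fc[of "(i, a)"] i by (intro finsum_single) (auto simp: F_def)
    qed (use Fc a in auto)
    also have "\<dots> = K.comb (\<lambda>i. \<sigma> (g (i, a)) k)"
      unfolding K.comb_def by (simp add: F_def)
    finally show ?thesis
      by (simp add: a_def k_def)
  qed
  have "additive_basis P P c (\<lambda>i s. s [^]\<^bsub>P\<^esub> p \<otimes>\<^bsub>P\<^esub> v i)"
  proof unfold_locales
    fix s assume s: "s \<in> carrier P"
    \<comment> \<open>Forced by the formula \<open>coeff\<close>: the coefficient of the
      \<open>i\<close>-th coordinate at \<open>k\<close> is read off from the coefficient of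
      \<open>s\<close> at \<open>p k + a\<close>.\<close>
    define \<tau> where "\<tau> i = (\<lambda>k\<in>E. K.coord (s (\<lambda>w. p * k w + snd (h i) w)) (fst (h i)))" for i
    have pk: "(\<lambda>w. p * k w + a w) \<in> E" if "k \<in> E" "a \<in> ?A" for k a
      using that by (auto simp: exponents_def small_exponents_def)
    have \<tau>: "\<tau> i \<in> carrier P" if i: "i < c" for i
      unfolding \<tau>_def using K.coord_closed hi[OF i] pk s by (intro series_closedI) auto
    show "\<exists>!\<sigma>. \<sigma> \<in> {..<c} \<rightarrow>\<^sub>E carrier P \<and> s = (\<Oplus>\<^bsub>P\<^esub>i\<in>{..<c}. \<sigma> i [^]\<^bsub>P\<^esub> p \<otimes>\<^bsub>P\<^esub> v i)"
    proof (rule ex1I[of _ "restrict \<tau> {..<c}"])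
      have "s = (\<Oplus>\<^bsub>P\<^esub>i\<in>{..<c}. \<tau> i [^]\<^bsub>P\<^esub> p \<otimes>\<^bsub>P\<^esub> v i)"
      proof (rule series_eqI)
        fix m assume m: "m \<in> E"
        have "(\<Oplus>\<^bsub>P\<^esub>i\<in>{..<c}. \<tau> i [^]\<^bsub>P\<^esub> p \<otimes>\<^bsub>P\<^esub> v i) m = K.comb (\<lambda>i. \<tau> (g (i, \<lambda>w. m w mod p)) (\<lambda>w. m w div p))"
          using \<tau> m by (rule coeff)
        also have "\<dots> = K.comb (K.coord (s m))"
          using md[OF m] hg(1) K.coord_closed[OF coeff_closed[OF s m]]
          by (intro K.comb_cong) (auto simp: \<tau>_def)
        also have "\<dots> = s m"
          using s m by (intro K.coord_props) auto
        finally show "s m = (\<Oplus>\<^bsub>P\<^esub>i\<in>{..<c}. \<tau> i [^]\<^bsub>P\<^esub> p \<otimes>\<^bsub>P\<^esub> v i) m"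
          by simp
      qed (use s \<tau> v in \<open>auto intro!: P.finsum_closed\<close>)
      also have "\<dots> = (\<Oplus>\<^bsub>P\<^esub>i\<in>{..<c}. restrict \<tau> {..<c} i [^]\<^bsub>P\<^esub> p \<otimes>\<^bsub>P\<^esub> v i)"
        using \<tau> v by (intro P.finsum_cong') auto
      finally show "restrict \<tau> {..<c} \<in> {..<c} \<rightarrow>\<^sub>E carrier P \<and>
          s = (\<Oplus>\<^bsub>P\<^esub>i\<in>{..<c}. restrict \<tau> {..<c} i [^]\<^bsub>P\<^esub> p \<otimes>\<^bsub>P\<^esub> v i)"
        using \<tau> by auto
    next
      fix \<sigma> assume *: "\<sigma> \<in> {..<c} \<rightarrow>\<^sub>E carrier P \<and> s = (\<Oplus>\<^bsub>P\<^esub>i\<in>{..<c}. \<sigma> i [^]\<^bsub>P\<^esub> p \<otimes>\<^bsub>P\<^esub> v i)"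
      then have \<sigma>: "\<sigma> i \<in> carrier P" if "i < c" for i
        using that by auto
      have "\<sigma> i = \<tau> i" if i: "i < c" for i
      proof (rule series_eqI[OF \<sigma>[OF i] \<tau>[OF i]])
        fix k assume k: "k \<in> E"
        define a where "a = snd (h i)"
        have a: "a \<in> ?A" "a w < p" for w
          using hi[OF i] by (auto simp: a_def small_exponents_def)
        define m where "m = (\<lambda>w. p * k w + a w)"
        have mE: "m \<in> E"
          unfolding m_def using k a by (intro pk)
        have mod: "(\<lambda>w. m w mod p) = a" and div: "(\<lambda>w. m w div p) = k"
          using a p_pos by (auto simp: m_def)
        have gc: "g (j, a) < c" if "j < b" for j
          using hg(2)[of "(j, a)"] that a by simp
        have "s m = K.comb (\<lambda>j. \<sigma> (g (j, a)) k)"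
          using coeff[OF \<sigma> mE] * unfolding mod div by simp
        then have "K.coord (s m) (fst (h i)) = \<sigma> (g (fst (h i), a)) k"
          using K.coord_comb[of "\<lambda>j. \<sigma> (g (j, a)) k" "fst (h i)"] \<sigma> gc k hi[OF i] by auto
        then show "\<sigma> i k = \<tau> i k"
          using gh[OF i] k by (simp add: \<tau>_def m_def a_def)
      qed
      then show "\<sigma> = restrict \<tau> {..<c}"
        using * by (intro extensionalityI[of _ "{..<c}"]) (auto simp: PiE_def)
    qed
  qed (use v in \<open>auto simp: PC.frob_add P.l_distr\<close>)
  then show ?thesis
    using that[of v] v by (simp add: c_def)
qed

end

section \<open>The hypersurface ring: Weierstrass basis, residue map and units\<close>

locale hypersurface = S: power_series K V for K (structure) and V :: "'v set" +
  fixes f :: "('v \<Rightarrow> nat) \<Rightarrow> 'a" and q :: nat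
  assumes f: "f \<in> carrier S.P" and f_zero: "f ezero = \<zero>" and q: "q > 0"
begin

abbreviation e :: "nat \<Rightarrow> unit \<Rightarrow> nat" where
  "e k \<equiv> \<lambda>_. k"

sublocale T: power_series S.P "{()}"
  by unfold_locales simp

lemma exponents_unit [simp]: "m \<in> exponents {()}"
  by (simp add: exponents_def)

lemma unit_exponentE:
  obtains k where "m = e k"
proof -
  have "m x = m ()" for x
    by simp
  then have "m = e (m ())"
    by (rule ext)
  then show ?thesis
    by (rule that)
qed

definition y where "y = ps_var {()} S.P ()"

definition g where "g = y [^]\<^bsub>T.P\<^esub> q \<oplus>\<^bsub>T.P\<^esub> ps_const {()} S.P f"

lemma y_pow: "y [^]\<^bsub>T.P\<^esub> k = T.pmonom \<one>\<^bsub>S.P\<^esub> (e k)"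
proof -
  have "(\<lambda>_. 0)(() := 1) = e 1"
    by (simp add: fun_eq_iff)
  then have "y = T.pmonom \<one>\<^bsub>S.P\<^esub> (e 1)"
    by (simp add: y_def T.ps_var_monom)
  then show ?thesis
    by (simp add: T.monom_pow)
qed

lemma y_closed: "y \<in> carrier T.P"
  using y_pow[of 1] T.monom_closed[of "\<one>\<^bsub>S.P\<^esub>" "e 1"] unfolding y_def T.ps_var_monom by simp

lemma const_closed: "a \<in> carrier S.P \<Longrightarrow> ps_const {()} S.P a \<in> carrier T.P"
  by (simp add: T.ps_const_monom)

lemma g_closed: "g \<in> carrier T.P"
  using y_closed const_closed[OF f] by (simp add: g_def)

lemma monom_eq: "a \<in> carrier S.P \<Longrightarrow> T.pmonom a (e k) = ps_const {()} S.P a \<otimes>\<^bsub>T.P\<^esub> y [^]\<^bsub>T.P\<^esub> k"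
  by (simp add: y_pow T.ps_const_monom T.monom_mult)

lemma coeff_g_mult:
  assumes u: "u \<in> carrier T.P"
  shows "(g \<otimes>\<^bsub>T.P\<^esub> u) (e k) = (if q \<le> k then u (e (k - q)) else \<zero>\<^bsub>S.P\<^esub>) \<oplus>\<^bsub>S.P\<^esub> f \<otimes>\<^bsub>S.P\<^esub> u (e k)"
proof -
  have "g \<otimes>\<^bsub>T.P\<^esub> u = T.pmonom \<one>\<^bsub>S.P\<^esub> (e q) \<otimes>\<^bsub>T.P\<^esub> u \<oplus>\<^bsub>T.P\<^esub> ps_const {()} S.P f \<otimes>\<^bsub>T.P\<^esub> u"
    using u f const_closed[OF f] by (simp add: g_def y_pow T.P.l_distr)
  moreover have "(ps_const {()} S.P f \<otimes>\<^bsub>T.P\<^esub> u) (e k) = f \<otimes>\<^bsub>S.P\<^esub> u (e k)"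
    using f u by (intro T.coeff_const_mult) auto
  moreover have "(T.pmonom \<one>\<^bsub>S.P\<^esub> (e q) \<otimes>\<^bsub>T.P\<^esub> u) (e k) = (if q \<le> k then u (e (k - q)) else \<zero>\<^bsub>S.P\<^esub>)"
    using u by (subst T.coeff_monom_mult) (auto simp: below_def ediff_def)
  ultimately show ?thesis
    by simp
qed

text \<open>The vanishing constant term of \<open>f\<close> removes the summand with
  \<open>x\<close> at \<open>a\<close> itself. Only coefficients of \<open>x\<close> of lower degree
  remain, which is what makes division by \<open>g\<close> and its uniqueness work by
  descent.\<close>

lemma coeff_f_mult:
  assumes x: "x \<in> carrier S.P" and a: "a \<in> S.E"
  shows "(f \<otimes>\<^bsub>S.P\<^esub> x) a = (\<Oplus>c\<in>below a - {ezero}. f c \<otimes> x (ediff a c))"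
proof -
  have fin: "finite (below a)"
    using finite_below[OF S.finite_vars a] .
  have c: "f c \<otimes> x (ediff a c) \<in> carrier K" if "c \<in> below a" for c
    using that x f a below_exponents[OF a that] by auto
  have "(f \<otimes>\<^bsub>S.P\<^esub> x) a = (\<Oplus>c\<in>below a. f c \<otimes> x (ediff a c))"
    using a by (rule S.coeff_mult_below)
  also have "\<dots> = (\<Oplus>c\<in>below a - {ezero}. f c \<otimes> x (ediff a c))"
    using fin c x a by (intro S.finsum_neutral_right) (auto simp: f_zero)
  finally show ?thesis .
qed

lemma coeff_poly:
  assumes s: "\<And>k. k < q \<Longrightarrow> s k \<in> carrier S.P"
  shows "(\<Oplus>\<^bsub>T.P\<^esub>k\<in>{..<q}. T.pmonom (s k) (e k)) (e j) = (if j < q then s j else \<zero>\<^bsub>S.P\<^esub>)"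
proof -
  have "(\<Oplus>\<^bsub>T.P\<^esub>k\<in>{..<q}. T.pmonom (s k) (e k)) (e j) = (\<Oplus>\<^bsub>S.P\<^esub>k\<in>{..<q}. if j = k then s k else \<zero>\<^bsub>S.P\<^esub>)"
    using s by (subst T.coeff_finsum) (auto simp: T.coeff_monom fun_eq_iff intro!: S.P.finsum_cong')
  also have "\<dots> = (if j < q then s j else \<zero>\<^bsub>S.P\<^esub>)"
  proof (cases "j < q")
    case True
    then show ?thesis
      using s by (subst S.P.finsum_single[of _ j]) auto
  next
    case False
    then have "(\<Oplus>\<^bsub>S.P\<^esub>k\<in>{..<q}. if j = k then s k else \<zero>\<^bsub>S.P\<^esub>) = \<zero>\<^bsub>S.P\<^esub>"
      by (intro S.P.finsum_zeroI) auto
    then show ?thesis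
      using False by (simp only: if_False)
  qed
  finally show ?thesis .
qed

text \<open>Weierstrass division by \<open>g\<close>; the quotient is determined by recursion on the degree in \<open>S\<close>,
  because \<open>f\<close> has no constant term.\<close>

lemma divide_by_g:
  assumes t: "t \<in> carrier T.P"
  obtains u s where "u \<in> carrier T.P" "\<And>k. k < q \<Longrightarrow> s k \<in> carrier S.P"
    "t = g \<otimes>\<^bsub>T.P\<^esub> u \<oplus>\<^bsub>T.P\<^esub> (\<Oplus>\<^bsub>T.P\<^esub>k\<in>{..<q}. T.pmonom (s k) (e k))"
proof -
  define B where "B a = below a - {ezero}" for a :: "'v \<Rightarrow> nat"
  \<comment> \<open>Comparing coefficients of y^(k+q) in t = g u + remainder demands u_k = t_(k+q) -
    f u_(k+q). The index \<open>k\<close> grows along the recursion, but u_(k+q) is consulted only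
    at exponents of lower degree in \<open>S\<close>.\<close>
  define F where "F z x = (case x of (k, a) \<Rightarrow> if a \<in> S.E then t (e (k + q)) a \<ominus>
      (\<Oplus>c\<in>B a. f c \<otimes> (if z (k + q, ediff a c) \<in> carrier K then z (k + q, ediff a c) else \<zero>)) else \<zero>)"
    for z and x :: "nat \<times> ('v \<Rightarrow> nat)"
  have tk: "t (e k) \<in> carrier S.P" for k
    using t by auto
  have fB: "f c \<in> carrier K" if "a \<in> S.E" "c \<in> B a" for a c
    using that f below_exponents[OF that(1)] by (auto simp: B_def)
  have adm: "F z x = F z' x" if zz: "\<And>w. edeg V (snd w) < edeg V (snd x) \<Longrightarrow> z w = z' w" for z z' x
  proof -
    obtain k a where x: "x = (k, a)"
      by force
    show ?thesis
    proof (cases "a \<in> S.E")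
      case True
      have "z (k + q, ediff a c) = z' (k + q, ediff a c)" if "c \<in> B a" for c
        using that edeg_ediff_less[OF S.finite_vars True, of c] by (intro zz) (auto simp: x B_def)
      then have "(\<Oplus>c\<in>B a. f c \<otimes> (if z (k + q, ediff a c) \<in> carrier K then z (k + q, ediff a c) else \<zero>)) =
        (\<Oplus>c\<in>B a. f c \<otimes> (if z' (k + q, ediff a c) \<in> carrier K then z' (k + q, ediff a c) else \<zero>))"
        using fB[OF True] by (intro S.finsum_cong') auto
      then show ?thesis
        by (simp add: F_def x)
    qed (simp add: F_def x)
  qed
  obtain z where z: "\<And>x. z x = F z x"
    using recursive_solution[of "\<lambda>x. edeg V (snd x)" F] adm by blast
  have zc: "z (k, a) \<in> carrier K" for k a
  proof (cases "a \<in> S.E")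
    case True
    have "(\<Oplus>c\<in>B a. f c \<otimes> (if z (k + q, ediff a c) \<in> carrier K then z (k + q, ediff a c) else \<zero>)) \<in> carrier K"
      using fB[OF True] by (intro S.finsum_closed) auto
    then show ?thesis
      unfolding z[of "(k, a)"] F_def using True S.coeff_closed[OF tk True] by simp
  qed (simp add: z[of "(k, a)"] F_def)
  define U where "U k = (\<lambda>a\<in>S.E. z (k, a))" for k
  have U: "U k \<in> carrier S.P" for k
    unfolding U_def using zc by (intro S.series_closedI)
  have Ueq: "U k = t (e (k + q)) \<ominus>\<^bsub>S.P\<^esub> f \<otimes>\<^bsub>S.P\<^esub> U (k + q)" for k
  proof (rule S.series_eqI)
    fix a assume a: "a \<in> S.E"
    have "(f \<otimes>\<^bsub>S.P\<^esub> U (k + q)) a = (\<Oplus>c\<in>B a. f c \<otimes> U (k + q) (ediff a c))"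
      unfolding B_def using U a by (rule coeff_f_mult)
    also have "\<dots> = (\<Oplus>c\<in>B a. f c \<otimes> (if z (k + q, ediff a c) \<in> carrier K then z (k + q, ediff a c) else \<zero>))"
      using fB[OF a] a zc by (intro S.finsum_cong') (auto simp: U_def)
    finally show "U k a = (t (e (k + q)) \<ominus>\<^bsub>S.P\<^esub> f \<otimes>\<^bsub>S.P\<^esub> U (k + q)) a"
      using a tk U f z[of "(k, a)"] by (simp add: F_def U_def)
  qed (use U tk f in auto)
  define u where "u = (\<lambda>m\<in>exponents {()}. U (m ()))"
  have u: "u \<in> carrier T.P"
    unfolding u_def using U by (intro T.series_closedI)
  have uk: "u (e k) = U k" for k
    by (simp add: u_def)
  \<comment> \<open>The recursion makes all coefficients of \<open>r\<close> from y^q on vanish, so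
    \<open>r\<close> is a polynomial in \<open>y\<close> of degree below \<open>q\<close>.\<close>
  define r where "r = t \<ominus>\<^bsub>T.P\<^esub> g \<otimes>\<^bsub>T.P\<^esub> u"
  have r: "r \<in> carrier T.P"
    using t g_closed u by (simp add: r_def)
  have rk: "r (e k) = \<zero>\<^bsub>S.P\<^esub>" if "\<not> k < q" for k
  proof -
    have "(g \<otimes>\<^bsub>T.P\<^esub> u) (e k) = U (k - q) \<oplus>\<^bsub>S.P\<^esub> f \<otimes>\<^bsub>S.P\<^esub> U k"
      using coeff_g_mult[OF u, of k] that by (simp add: uk)
    also have "U (k - q) = t (e k) \<ominus>\<^bsub>S.P\<^esub> f \<otimes>\<^bsub>S.P\<^esub> U k"
      using Ueq[of "k - q"] that by simp
    also have "t (e k) \<ominus>\<^bsub>S.P\<^esub> f \<otimes>\<^bsub>S.P\<^esub> U k \<oplus>\<^bsub>S.P\<^esub> f \<otimes>\<^bsub>S.P\<^esub> U k = t (e k)"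
      using tk[of k] f U[of k] by (simp add: a_minus_def S.P.a_assoc S.P.l_neg)
    finally show ?thesis
      unfolding r_def using t g_closed u tk[of k] by (simp add: a_minus_def S.P.r_neg)
  qed
  have rc: "r (e k) \<in> carrier S.P" for k
    using r by auto
  have "r = (\<Oplus>\<^bsub>T.P\<^esub>k\<in>{..<q}. T.pmonom (r (e k)) (e k))"
  proof (rule T.series_eqI[OF r])
    fix m :: "unit \<Rightarrow> nat"
    have coeff: "r (e k) = (\<Oplus>\<^bsub>T.P\<^esub>k\<in>{..<q}. T.pmonom (r (e k)) (e k)) (e k)" for k
      using coeff_poly[of "\<lambda>k. r (e k)" k] rc rk[of k] by simp
    obtain j where j: "m = e j"
      by (rule unit_exponentE)
    show "r m = (\<Oplus>\<^bsub>T.P\<^esub>k\<in>{..<q}. T.pmonom (r (e k)) (e k)) m"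
      unfolding j by (rule coeff)
  qed (use rc in \<open>auto intro!: T.P.finsum_closed\<close>)
  moreover have "t = g \<otimes>\<^bsub>T.P\<^esub> u \<oplus>\<^bsub>T.P\<^esub> r"
    unfolding r_def using t g_closed u by algebra
  ultimately show ?thesis
    using that[of u "\<lambda>k. r (e k)"] u rc by simp
qed

text \<open>From y^q on, the coefficients of \<open>g u\<close> vanish, that is u_k = - f u_(k+q)
  for all \<open>k\<close>. Since multiplication by \<open>f\<close> raises the order,
  \<open>u\<close> vanishes by induction on the degree in \<open>S\<close>.\<close>

lemma g_multiple_poly:
  assumes u: "u \<in> carrier T.P" and s: "\<And>k. k < q \<Longrightarrow> s k \<in> carrier S.P"
    and eq: "(\<Oplus>\<^bsub>T.P\<^esub>k\<in>{..<q}. T.pmonom (s k) (e k)) = g \<otimes>\<^bsub>T.P\<^esub> u" and k: "k < q"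
  shows "s k = \<zero>\<^bsub>S.P\<^esub>"
proof -
  have uk: "u (e k) \<in> carrier S.P" for k
    using u by auto
  have fu: "f \<otimes>\<^bsub>S.P\<^esub> u (e k) \<in> carrier S.P" for k
    using f uk by simp
  have "u (e k) a = \<zero>" if "a \<in> S.E" for k a
    using that
  proof (induction "edeg V a" arbitrary: a k rule: less_induct)
    case less
    have "f c \<otimes> u (e (k + q)) (ediff a c) = \<zero>" if "c \<in> below a - {ezero}" for c
    proof -
      have "u (e (k + q)) (ediff a c) = \<zero>"
        using that less.prems by (intro less.hyps edeg_ediff_less[OF S.finite_vars]) auto
      then show ?thesis
        using that f below_exponents[OF less.prems] by auto
    qed
    then have "(f \<otimes>\<^bsub>S.P\<^esub> u (e (k + q))) a = \<zero>"
      unfolding coeff_f_mult[OF uk less.prems] by (rule S.finsum_zeroI)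
    moreover have "u (e k) \<oplus>\<^bsub>S.P\<^esub> f \<otimes>\<^bsub>S.P\<^esub> u (e (k + q)) = \<zero>\<^bsub>S.P\<^esub>"
      using coeff_g_mult[OF u, of "k + q"] coeff_poly[where s = s and j = "k + q", OF s] eq by simp
    then have "(u (e k) \<oplus>\<^bsub>S.P\<^esub> f \<otimes>\<^bsub>S.P\<^esub> u (e (k + q))) a = \<zero>"
      using less.prems by simp
    ultimately show ?case
      using less.prems S.coeff_closed[OF uk less.prems] by simp
  qed
  then have "u (e k) = \<zero>\<^bsub>S.P\<^esub>"
    using uk S.P_zero_closed by (intro S.series_eqI) auto
  then show ?thesis
    using coeff_g_mult[OF u, of k] coeff_poly[where s = s and j = k, OF s] eq k f by simp
qed

abbreviation I where "I \<equiv> PIdl\<^bsub>T.P\<^esub> g"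

definition Q where "Q = T.P Quot I"

definition pr where "pr t = I +>\<^bsub>T.P\<^esub> t"

definition \<iota> where "\<iota> s = pr (ps_const {()} S.P s)"

definition \<eta> where "\<eta> = pr y"

sublocale I: ideal I T.P
  using g_closed by (rule T.P.cgenideal_ideal)

sublocale Q: cring Q
  unfolding Q_def using T.P.is_cring by (rule I.quotient_is_cring)

lemma pr_hom: "pr \<in> ring_hom T.P Q"
  using I.rcos_ring_hom unfolding Q_def pr_def by simp

sublocale pr: ring_hom_cring T.P Q pr
  by unfold_locales (rule pr_hom)

lemma pr_surj: "r \<in> carrier Q \<Longrightarrow> \<exists>t\<in>carrier T.P. r = pr t"
  unfolding Q_def pr_def FactRing_def A_RCOSETS_def' by auto

lemma pr_eq_zero: "t \<in> carrier T.P \<Longrightarrow> pr t = \<zero>\<^bsub>Q\<^esub> \<longleftrightarrow> t \<in> I"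
  using T.P.quotient_eq_iff_same_a_r_cos[OF I.is_ideal, of t "\<zero>\<^bsub>T.P\<^esub>"] pr.hom_zero
  unfolding pr_def by (simp add: a_minus_def)

lemma mem_I: "t \<in> I \<longleftrightarrow> (\<exists>u\<in>carrier T.P. t = g \<otimes>\<^bsub>T.P\<^esub> u)"
proof -
  have "u \<otimes>\<^bsub>T.P\<^esub> g = g \<otimes>\<^bsub>T.P\<^esub> u" if "u \<in> carrier T.P" for u
    using that g_closed by (rule T.P.m_comm)
  then show ?thesis
    unfolding cgenideal_def by (simp, metis)
qed

lemma \<iota>_hom: "\<iota> \<in> ring_hom S.P Q"
  unfolding \<iota>_def using ring_hom_trans[OF T.ps_const_hom pr_hom] by (simp add: comp_def)

lemma \<eta>_closed: "\<eta> \<in> carrier Q"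
  unfolding \<eta>_def using y_closed by simp

lemma pr_poly:
  assumes "\<And>k. k < q \<Longrightarrow> s k \<in> carrier S.P"
  shows "pr (\<Oplus>\<^bsub>T.P\<^esub>k\<in>{..<q}. T.pmonom (s k) (e k)) = (\<Oplus>\<^bsub>Q\<^esub>k\<in>{..<q}. \<iota> (s k) \<otimes>\<^bsub>Q\<^esub> \<eta> [^]\<^bsub>Q\<^esub> k)"
proof -
  have pow: "pr (y [^]\<^bsub>T.P\<^esub> k) = \<eta> [^]\<^bsub>Q\<^esub> k" for k :: nat
    unfolding \<eta>_def using y_closed by (induction k) auto
  have "pr (\<Oplus>\<^bsub>T.P\<^esub>k\<in>{..<q}. T.pmonom (s k) (e k)) = (\<Oplus>\<^bsub>Q\<^esub>k\<in>{..<q}. pr (T.pmonom (s k) (e k)))"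
    using assms by (subst pr.hom_finsum) (auto simp: comp_def)
  also have "\<dots> = (\<Oplus>\<^bsub>Q\<^esub>k\<in>{..<q}. \<iota> (s k) \<otimes>\<^bsub>Q\<^esub> \<eta> [^]\<^bsub>Q\<^esub> k)"
  proof (rule Q.finsum_cong')
    fix k assume "k \<in> {..<q}"
    then show "pr (T.pmonom (s k) (e k)) = \<iota> (s k) \<otimes>\<^bsub>Q\<^esub> \<eta> [^]\<^bsub>Q\<^esub> k"
      using assms[of k] const_closed y_closed by (simp add: monom_eq \<iota>_def pow)
  qed (use assms \<eta>_closed ring_hom_closed[OF \<iota>_hom] in auto)
  finally show ?thesis .
qed

text \<open>Existence is Weierstrass division. For uniqueness, the difference of two expansions
  comes from a polynomial in \<open>y\<close> of degree below \<open>q\<close> that is a multiple of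
  \<open>g\<close>.\<close>

lemma basis: "additive_basis S.P Q q (\<lambda>k s. \<iota> s \<otimes>\<^bsub>Q\<^esub> \<eta> [^]\<^bsub>Q\<^esub> k)"
proof unfold_locales
  fix k :: nat and s assume "s \<in> carrier S.P"
  then show "\<iota> s \<otimes>\<^bsub>Q\<^esub> \<eta> [^]\<^bsub>Q\<^esub> k \<in> carrier Q"
    using ring_hom_closed[OF \<iota>_hom] \<eta>_closed by simp
next
  fix k :: nat and s t assume "s \<in> carrier S.P" "t \<in> carrier S.P"
  then show "\<iota> (s \<oplus>\<^bsub>S.P\<^esub> t) \<otimes>\<^bsub>Q\<^esub> \<eta> [^]\<^bsub>Q\<^esub> k = \<iota> s \<otimes>\<^bsub>Q\<^esub> \<eta> [^]\<^bsub>Q\<^esub> k \<oplus>\<^bsub>Q\<^esub> \<iota> t \<otimes>\<^bsub>Q\<^esub> \<eta> [^]\<^bsub>Q\<^esub> k"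
    using ring_hom_closed[OF \<iota>_hom] ring_hom_add[OF \<iota>_hom] \<eta>_closed by (simp add: Q.l_distr)
next
  fix r assume "r \<in> carrier Q"
  then obtain t where t: "t \<in> carrier T.P" "r = pr t"
    using pr_surj by blast
  obtain u s where us: "u \<in> carrier T.P" "\<And>k. k < q \<Longrightarrow> s k \<in> carrier S.P"
    "t = g \<otimes>\<^bsub>T.P\<^esub> u \<oplus>\<^bsub>T.P\<^esub> (\<Oplus>\<^bsub>T.P\<^esub>k\<in>{..<q}. T.pmonom (s k) (e k))"
    using divide_by_g[OF t(1)] by blast
  let ?p = "\<lambda>s. \<Oplus>\<^bsub>T.P\<^esub>k\<in>{..<q}. T.pmonom (s k) (e k)"
  have pc: "?p s \<in> carrier T.P" if "\<And>k. k < q \<Longrightarrow> s k \<in> carrier S.P" for s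
    using that by (intro T.P.finsum_closed) auto
  have gu: "pr (g \<otimes>\<^bsub>T.P\<^esub> u) = \<zero>\<^bsub>Q\<^esub>"
    using us(1) g_closed by (subst pr_eq_zero) (auto simp: mem_I)
  have r: "r = pr (?p s)"
    unfolding t(2) us(3) using us(1) g_closed pc[OF us(2)] gu by simp
  show "\<exists>!s. s \<in> {..<q} \<rightarrow>\<^sub>E carrier S.P \<and> r = (\<Oplus>\<^bsub>Q\<^esub>k\<in>{..<q}. \<iota> (s k) \<otimes>\<^bsub>Q\<^esub> \<eta> [^]\<^bsub>Q\<^esub> k)"
  proof (rule ex1I[of _ "restrict s {..<q}"])
    have "?p (restrict s {..<q}) = ?p s"
      using us(2) by (intro T.P.finsum_cong') auto
    then have "r = (\<Oplus>\<^bsub>Q\<^esub>k\<in>{..<q}. \<iota> (restrict s {..<q} k) \<otimes>\<^bsub>Q\<^esub> \<eta> [^]\<^bsub>Q\<^esub> k)"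
      using r pr_poly[of "restrict s {..<q}"] us(2) by simp
    then show "restrict s {..<q} \<in> {..<q} \<rightarrow>\<^sub>E carrier S.P \<and>
        r = (\<Oplus>\<^bsub>Q\<^esub>k\<in>{..<q}. \<iota> (restrict s {..<q} k) \<otimes>\<^bsub>Q\<^esub> \<eta> [^]\<^bsub>Q\<^esub> k)"
      using us(2) by auto
  next
    fix s' assume s': "s' \<in> {..<q} \<rightarrow>\<^sub>E carrier S.P \<and> r = (\<Oplus>\<^bsub>Q\<^esub>k\<in>{..<q}. \<iota> (s' k) \<otimes>\<^bsub>Q\<^esub> \<eta> [^]\<^bsub>Q\<^esub> k)"
    then have s'c: "s' k \<in> carrier S.P" if "k < q" for k
      using that by auto
    have "pr (?p s') = pr (?p s)"
      using pr_poly[OF s'c] s' r by simp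
    moreover have d: "?p (\<lambda>k. s' k \<ominus>\<^bsub>S.P\<^esub> s k) = ?p s' \<ominus>\<^bsub>T.P\<^esub> ?p s"
    proof (rule T.series_eqI)
      fix m :: "unit \<Rightarrow> nat"
      have "?p (\<lambda>k. s' k \<ominus>\<^bsub>S.P\<^esub> s k) (e j) = (?p s' \<ominus>\<^bsub>T.P\<^esub> ?p s) (e j)" for j
      proof -
        have "(?p s' \<ominus>\<^bsub>T.P\<^esub> ?p s) (e j) = ?p s' (e j) \<ominus>\<^bsub>S.P\<^esub> ?p s (e j)"
          using pc[OF s'c] pc[OF us(2)] by simp
        then show ?thesis
          using coeff_poly[of "\<lambda>k. s' k \<ominus>\<^bsub>S.P\<^esub> s k" j] coeff_poly[where s = s' and j = j, OF s'c] coeff_poly[where s = s and j = j, OF us(2)]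
            s'c us(2) by (simp add: a_minus_def)
      qed
      moreover obtain j where j: "m = e j"
        by (rule unit_exponentE)
      ultimately show "?p (\<lambda>k. s' k \<ominus>\<^bsub>S.P\<^esub> s k) m = (?p s' \<ominus>\<^bsub>T.P\<^esub> ?p s) m"
        unfolding j by blast
    qed (use pc s'c us(2) in auto)
    ultimately have "pr (?p (\<lambda>k. s' k \<ominus>\<^bsub>S.P\<^esub> s k)) = \<zero>\<^bsub>Q\<^esub>"
      using pc[OF s'c] pc[OF us(2)] by (simp add: a_minus_def Q.r_neg)
    moreover have dc: "s' k \<ominus>\<^bsub>S.P\<^esub> s k \<in> carrier S.P" if "k < q" for k
      using s'c us(2) that by simp
    ultimately obtain u' where "u' \<in> carrier T.P" "?p (\<lambda>k. s' k \<ominus>\<^bsub>S.P\<^esub> s k) = g \<otimes>\<^bsub>T.P\<^esub> u'"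
      using pr_eq_zero[OF pc[of "\<lambda>k. s' k \<ominus>\<^bsub>S.P\<^esub> s k", OF dc]] mem_I by blast
    then have "s' k \<ominus>\<^bsub>S.P\<^esub> s k = \<zero>\<^bsub>S.P\<^esub>" if "k < q" for k
      using g_multiple_poly[of u' "\<lambda>k. s' k \<ominus>\<^bsub>S.P\<^esub> s k" k] dc that by blast
    then have "s' k = s k" if "k < q" for k
      using s'c us(2) that by simp
    then show "s' = restrict s {..<q}"
      using s' by (intro extensionalityI[of _ "{..<q}"]) (auto simp: PiE_def)
  qed
qed

lemma \<eta>_pow: "\<eta> [^]\<^bsub>Q\<^esub> q = \<iota> (\<ominus>\<^bsub>S.P\<^esub> f)"
proof -
  have "g = g \<otimes>\<^bsub>T.P\<^esub> \<one>\<^bsub>T.P\<^esub>"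
    using g_closed by simp
  then have "pr g = \<zero>\<^bsub>Q\<^esub>"
    using pr_eq_zero[OF g_closed] mem_I[of g] T.P.one_closed by blast
  moreover have "pr g = \<eta> [^]\<^bsub>Q\<^esub> q \<oplus>\<^bsub>Q\<^esub> \<iota> f"
  proof -
    have "pr (y [^]\<^bsub>T.P\<^esub> k) = \<eta> [^]\<^bsub>Q\<^esub> k" for k :: nat
      unfolding \<eta>_def using y_closed by (induction k) auto
    then show ?thesis
      unfolding g_def \<iota>_def using y_closed const_closed[OF f] by simp
  qed
  moreover have "\<iota> (\<ominus>\<^bsub>S.P\<^esub> f) \<oplus>\<^bsub>Q\<^esub> \<iota> f = \<zero>\<^bsub>Q\<^esub>"
  proof -
    interpret \<iota>: ring_hom_ring S.P Q \<iota>
      by (rule ring_hom_ringI2[OF S.P.ring_axioms Q.ring_axioms \<iota>_hom])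
    show ?thesis
      using f by (simp add: Q.l_neg)
  qed
  ultimately show ?thesis
    using \<eta>_closed ring_hom_closed[OF \<iota>_hom] f
    by (metis Q.add.r_cancel Q.nat_pow_closed S.P.a_inv_closed)
qed

text \<open>The residue map: the constant term of some lift. The choice is harmless since
  \<open>g\<close> has no constant term, as \<open>q > 0\<close> and \<open>f\<close> has
  none.\<close>

definition \<chi> where "\<chi> r = (SOME t. t \<in> carrier T.P \<and> pr t = r) (e 0) ezero"

lemma \<chi>_pr:
  assumes t: "t \<in> carrier T.P"
  shows "\<chi> (pr t) = t (e 0) ezero"
proof -
  define t' where "t' = (SOME t'. t' \<in> carrier T.P \<and> pr t' = pr t)"
  have t': "t' \<in> carrier T.P \<and> pr t' = pr t"
    unfolding t'_def by (rule someI[of _ t]) (use t in simp)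
  then have "pr (t' \<ominus>\<^bsub>T.P\<^esub> t) = \<zero>\<^bsub>Q\<^esub>"
    using t by (simp add: a_minus_def Q.r_neg)
  then obtain u where u: "u \<in> carrier T.P" "t' \<ominus>\<^bsub>T.P\<^esub> t = g \<otimes>\<^bsub>T.P\<^esub> u"
    using pr_eq_zero[of "t' \<ominus>\<^bsub>T.P\<^esub> t"] t t' mem_I by auto
  have u0: "u (e 0) \<in> carrier S.P"
    using u by auto
  have "(t' \<ominus>\<^bsub>T.P\<^esub> t) (e 0) = f \<otimes>\<^bsub>S.P\<^esub> u (e 0)"
    using coeff_g_mult[OF u(1), of 0] u(2) q f u0 by simp
  then have "t' (e 0) \<ominus>\<^bsub>S.P\<^esub> t (e 0) = f \<otimes>\<^bsub>S.P\<^esub> u (e 0)"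
    using t t' by simp
  moreover have "(f \<otimes>\<^bsub>S.P\<^esub> u (e 0)) ezero = \<zero>"
  proof -
    have "below ezero - {ezero} = ({} :: ('v \<Rightarrow> nat) set)"
      by (auto simp: below_def)
    then show ?thesis
      unfolding coeff_f_mult[OF u0 exponents_zero] by (simp only: S.finsum_empty)
  qed
  moreover have tc: "t (e 0) \<in> carrier S.P" "t' (e 0) \<in> carrier S.P"
    using t t' by auto
  ultimately have "t' (e 0) ezero \<ominus> t (e 0) ezero = \<zero>"
    using S.coeff_diff[OF tc(2,1) exponents_zero] by simp
  then show ?thesis
    unfolding \<chi>_def t'_def[symmetric] using S.coeff_closed[OF tc(1)] S.coeff_closed[OF tc(2)] by simp
qed

lemma \<chi>_hom: "\<chi> \<in> ring_hom Q K"
proof (rule ring_hom_memI)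
  have hom: "(\<lambda>t. t (e 0) ezero) \<in> ring_hom T.P K"
    using ring_hom_trans[OF T.coeff_zero_hom S.coeff_zero_hom] by (simp add: comp_def)
  fix r r' assume "r \<in> carrier Q" "r' \<in> carrier Q"
  then obtain t t' where t: "t \<in> carrier T.P" "r = pr t" "t' \<in> carrier T.P" "r' = pr t'"
    using pr_surj by meson
  show "\<chi> (r \<otimes>\<^bsub>Q\<^esub> r') = \<chi> r \<otimes> \<chi> r'"
    unfolding t using ring_hom_mult[OF hom t(1,3)] t(1,3) \<chi>_pr[OF t(1)] \<chi>_pr[OF t(3)]
      \<chi>_pr[OF T.P.m_closed[OF t(1,3)]] by simp
  show "\<chi> (r \<oplus>\<^bsub>Q\<^esub> r') = \<chi> r \<oplus> \<chi> r'"
    unfolding t using ring_hom_add[OF hom t(1,3)] t(1,3) \<chi>_pr[OF t(1)] \<chi>_pr[OF t(3)]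
      \<chi>_pr[OF T.P.a_closed[OF t(1,3)]] by simp
next
  fix r assume "r \<in> carrier Q"
  then obtain t where t: "t \<in> carrier T.P" "r = pr t"
    using pr_surj by blast
  show "\<chi> r \<in> carrier K"
    unfolding t(2) \<chi>_pr[OF t(1)] using t(1) by auto
next
  show "\<chi> \<one>\<^bsub>Q\<^esub> = \<one>"
    using \<chi>_pr[OF T.P.one_closed] by (simp add: T.coeff_one S.coeff_one)
qed

lemma \<chi>_surj: "\<chi> ` carrier Q = carrier K"
proof
  show "\<chi> ` carrier Q \<subseteq> carrier K"
    using ring_hom_closed[OF \<chi>_hom] by blast
  show "carrier K \<subseteq> \<chi> ` carrier Q"
  proof
    fix a assume a: "a \<in> carrier K"
    define t where "t = ps_const {()} S.P (ps_const V K a)"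
    have t: "t \<in> carrier T.P"
      unfolding t_def using a by (intro const_closed) (simp add: S.ps_const_monom)
    have "\<chi> (pr t) = a"
      unfolding \<chi>_pr[OF t] by (simp add: t_def T.ps_const_monom T.coeff_monom S.ps_const_monom S.coeff_monom)
    moreover have "pr t \<in> carrier Q"
      using t by simp
    ultimately show "a \<in> \<chi> ` carrier Q"
      by blast
  qed
qed

text \<open>A lift of \<open>r\<close> has invertible constant term; the unit criterion for series,
  applied over \<open>K\<close> and then over \<open>S\<close>, makes the lift invertible.\<close>

lemma \<chi>_unit:
  assumes K: "field K" and r: "r \<in> carrier Q" "\<chi> r \<noteq> \<zero>"
  shows "r \<in> Units Q"
proof -
  obtain t where t: "t \<in> carrier T.P" "r = pr t"
    using pr_surj[OF r(1)] by blast
  have t0: "t (e 0) \<in> carrier S.P"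
    using t(1) by auto
  have "t (e 0) ezero \<in> Units K"
    using r(2) S.coeff_closed[OF t0 exponents_zero] field.field_Units[OF K]
    unfolding t(2) \<chi>_pr[OF t(1)] by simp
  then have "t (e 0) \<in> Units S.P"
    by (rule S.series_Units[OF t0])
  then have u: "t \<in> Units T.P"
    by (rule T.series_Units[OF t(1)])
  then have "pr (inv\<^bsub>T.P\<^esub> t) \<otimes>\<^bsub>Q\<^esub> pr t = \<one>\<^bsub>Q\<^esub>"
    using t(1) pr.hom_mult[of "inv\<^bsub>T.P\<^esub> t" t] by simp
  moreover have "pr (inv\<^bsub>T.P\<^esub> t) \<in> carrier Q" "pr t \<in> carrier Q"
    using u t by simp_all
  ultimately show ?thesis
    unfolding t(2) Units_def using Q.m_comm[of "pr t" "pr (inv\<^bsub>T.P\<^esub> t)"] by auto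
qed

end

subsection \<open>Purely inseparable extensions by a root\<close>

lemma frobenius_pushforward_simps [simp]:
  "carrier (frobenius_pushforward p e A) = carrier A"
  "\<zero>\<^bsub>frobenius_pushforward p e A\<^esub> = \<zero>\<^bsub>A\<^esub>"
  "x \<oplus>\<^bsub>frobenius_pushforward p e A\<^esub> y = x \<oplus>\<^bsub>A\<^esub> y"
  "a \<odot>\<^bsub>frobenius_pushforward p e A\<^esub> x = a [^]\<^bsub>A\<^esub> (p ^ e) \<otimes>\<^bsub>A\<^esub> x"
  by (simp_all add: frobenius_pushforward_def)

lemma frobenius_pushforward_finsum [simp]:
  "finsum (frobenius_pushforward p e A) = finsum A"
  by (intro ext) (simp add: finsum_def finprod_def frobenius_pushforward_def)

lemma (in char_cring) frobenius_pushforward_module: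
  "module R (frobenius_pushforward p e R)"
proof (rule moduleI)
  show "abelian_group (frobenius_pushforward p e R)"
    by (rule abelian_groupI) (auto simp: a_ac intro: bexI[of _ "\<ominus> x" for x] l_neg)
qed (auto simp: is_cring frob_pow_add l_distr r_distr nat_pow_distrib m_assoc)

text \<open>Collects what the power series rings provide: a root \<eta> of an element of
  \<open>S\<close> generating \<open>R\<close> freely, a finite basis of \<open>S\<close> over its
  \<open>p\<close>-th powers, and locality of \<open>R\<close>, expressed by a prime ideal with only
  units outside it.\<close>

locale radical_extension = S: char_cring S p + R: cring R
  for S :: "('s, 'x) ring_scheme" and R :: "('r, 'y) ring_scheme" and p :: nat +
  fixes \<iota> :: "'s \<Rightarrow> 'r" and \<eta> :: 'r and h :: 's and d c :: nat and v :: "nat \<Rightarrow> 's" and I :: "'r set"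
  assumes \<iota>_hom: "\<iota> \<in> ring_hom S R" and \<eta>: "\<eta> \<in> carrier R" and h: "h \<in> carrier S"
    and \<eta>_pow: "\<eta> [^]\<^bsub>R\<^esub> (p ^ d) = \<iota> h"
    and basis: "additive_basis S R (p ^ d) (\<lambda>k s. \<iota> s \<otimes>\<^bsub>R\<^esub> \<eta> [^]\<^bsub>R\<^esub> k)"
    and v: "\<And>i. i < c \<Longrightarrow> v i \<in> carrier S"
    and p_basis: "additive_basis S S c (\<lambda>i s. s [^]\<^bsub>S\<^esub> p \<otimes>\<^bsub>S\<^esub> v i)"
    and I: "primeideal I R" and local: "\<And>a. a \<in> carrier R \<Longrightarrow> a \<notin> I \<Longrightarrow> a \<in> Units R"
begin

sublocale B: additive_basis S R "p ^ d" "\<lambda>k s. \<iota> s \<otimes>\<^bsub>R\<^esub> \<eta> [^]\<^bsub>R\<^esub> k"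
  by (rule basis)

sublocale D: additive_basis S S c "\<lambda>i s. s [^]\<^bsub>S\<^esub> p \<otimes>\<^bsub>S\<^esub> v i"
  by (rule p_basis)

sublocale \<iota>: ring_hom_cring S R \<iota>
  by unfold_locales (rule \<iota>_hom)

sublocale RC: char_cring R p
proof
  show "[p] \<cdot>\<^bsub>R\<^esub> \<one>\<^bsub>R\<^esub> = \<zero>\<^bsub>R\<^esub>"
    by (rule hom_char_zero[OF S.ring_axioms R.ring_axioms \<iota>_hom S.char_p])
qed (rule S.prime_p)

lemma q_pos: "p ^ d > 0"
  using S.p_pos by simp

lemma \<iota>_pow: "s \<in> carrier S \<Longrightarrow> \<iota> (s [^]\<^bsub>S\<^esub> (k::nat)) = \<iota> s [^]\<^bsub>R\<^esub> k"
  by (induction k) simp_all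

lemma \<iota>_inj:
  assumes "s \<in> carrier S" "t \<in> carrier S" "\<iota> s = \<iota> t"
  shows "s = t"
  using B.coord_m[OF q_pos q_pos assms(1)] B.coord_m[OF q_pos q_pos assms(2)] assms by simp

text \<open>The power map r \<mapsto> r^(p^d) with values in \<open>S\<close>: Frobenius acts
  termwise on the expansion of \<open>r\<close> in powers of \<eta>, and \<eta>^(p^d) comes from
  \<open>h\<close>.\<close>

definition \<phi> :: "'r \<Rightarrow> 's" where
  "\<phi> r = (\<Oplus>\<^bsub>S\<^esub>k\<in>{..<p ^ d}. B.coord r k [^]\<^bsub>S\<^esub> (p ^ d) \<otimes>\<^bsub>S\<^esub> h [^]\<^bsub>S\<^esub> k)"

lemma \<phi>_closed: "r \<in> carrier R \<Longrightarrow> \<phi> r \<in> carrier S"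
  unfolding \<phi>_def using B.coord_closed h by (intro S.finsum_closed) auto

lemma \<iota>_\<phi>:
  assumes r: "r \<in> carrier R"
  shows "\<iota> (\<phi> r) = r [^]\<^bsub>R\<^esub> (p ^ d)"
proof -
  have c: "B.coord r k \<in> carrier S" if "k < p ^ d" for k
    using B.coord_closed[OF r that] .
  have "r [^]\<^bsub>R\<^esub> (p ^ d) = (\<Oplus>\<^bsub>R\<^esub>k\<in>{..<p ^ d}. \<iota> (B.coord r k) \<otimes>\<^bsub>R\<^esub> \<eta> [^]\<^bsub>R\<^esub> k) [^]\<^bsub>R\<^esub> (p ^ d)"
    using B.coord_props(2)[OF r] by (simp add: B.comb_def)
  also have "\<dots> = (\<Oplus>\<^bsub>R\<^esub>k\<in>{..<p ^ d}. (\<iota> (B.coord r k) \<otimes>\<^bsub>R\<^esub> \<eta> [^]\<^bsub>R\<^esub> k) [^]\<^bsub>R\<^esub> (p ^ d))"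
    using c \<eta> by (intro RC.frob_finsum) auto
  also have "\<dots> = (\<Oplus>\<^bsub>R\<^esub>k\<in>{..<p ^ d}. \<iota> (B.coord r k [^]\<^bsub>S\<^esub> (p ^ d) \<otimes>\<^bsub>S\<^esub> h [^]\<^bsub>S\<^esub> k))"
  proof (rule R.finsum_cong')
    fix k assume "k \<in> {..<p ^ d}"
    then have k: "B.coord r k \<in> carrier S"
      using c by simp
    have "(\<eta> [^]\<^bsub>R\<^esub> k) [^]\<^bsub>R\<^esub> (p ^ d) = \<iota> h [^]\<^bsub>R\<^esub> k"
      using \<eta> by (simp add: R.nat_pow_pow mult.commute[of k] flip: \<eta>_pow)
    then show "(\<iota> (B.coord r k) \<otimes>\<^bsub>R\<^esub> \<eta> [^]\<^bsub>R\<^esub> k) [^]\<^bsub>R\<^esub> (p ^ d) =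
        \<iota> (B.coord r k [^]\<^bsub>S\<^esub> (p ^ d) \<otimes>\<^bsub>S\<^esub> h [^]\<^bsub>S\<^esub> k)"
      using k h \<eta> by (simp add: R.nat_pow_distrib \<iota>_pow)
  next
    show "(\<lambda>k. \<iota> (B.coord r k [^]\<^bsub>S\<^esub> (p ^ d) \<otimes>\<^bsub>S\<^esub> h [^]\<^bsub>S\<^esub> k)) \<in> {..<p ^ d} \<rightarrow> carrier R"
      using c h by (intro Pi_I) simp
  qed simp
  also have "\<dots> = \<iota> (\<phi> r)"
    unfolding \<phi>_def using c h by (subst \<iota>.hom_finsum) (auto simp: comp_def)
  finally show ?thesis
    by simp
qed

lemma \<phi>_hom: "\<phi> \<in> ring_hom R S"
proof (rule ring_hom_memI)
  fix r r' assume r: "r \<in> carrier R" "r' \<in> carrier R"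
  note rc = \<phi>_closed[OF r(1)] \<phi>_closed[OF r(2)]
  have "\<iota> (\<phi> (r \<otimes>\<^bsub>R\<^esub> r')) = \<iota> (\<phi> r \<otimes>\<^bsub>S\<^esub> \<phi> r')"
    using r rc by (simp add: \<iota>_\<phi> R.nat_pow_distrib)
  then show "\<phi> (r \<otimes>\<^bsub>R\<^esub> r') = \<phi> r \<otimes>\<^bsub>S\<^esub> \<phi> r'"
    using r rc \<phi>_closed[of "r \<otimes>\<^bsub>R\<^esub> r'"] by (intro \<iota>_inj) simp_all
  have "\<iota> (\<phi> (r \<oplus>\<^bsub>R\<^esub> r')) = \<iota> (\<phi> r \<oplus>\<^bsub>S\<^esub> \<phi> r')"
    using r rc by (simp add: \<iota>_\<phi> RC.frob_pow_add)
  then show "\<phi> (r \<oplus>\<^bsub>R\<^esub> r') = \<phi> r \<oplus>\<^bsub>S\<^esub> \<phi> r'"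
    using r rc \<phi>_closed[of "r \<oplus>\<^bsub>R\<^esub> r'"] by (intro \<iota>_inj) simp_all
next
  have "\<iota> (\<phi> \<one>\<^bsub>R\<^esub>) = \<iota> \<one>\<^bsub>S\<^esub>"
    by (simp add: \<iota>_\<phi>)
  then show "\<phi> \<one>\<^bsub>R\<^esub> = \<one>\<^bsub>S\<^esub>"
    using \<phi>_closed[of "\<one>\<^bsub>R\<^esub>"] by (intro \<iota>_inj) simp_all
qed (rule \<phi>_closed)

lemma krull_dim_extension: "krull_dim R = krull_dim S"
proof (rule krull_dim_eq[OF R.is_cring S.is_cring \<phi>_hom \<iota>_hom q_pos])
  fix s assume s: "s \<in> carrier S"
  then have "\<iota> (\<phi> (\<iota> s)) = \<iota> (s [^]\<^bsub>S\<^esub> (p ^ d))"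
    by (simp add: \<iota>_\<phi> \<iota>_pow)
  then show "\<phi> (\<iota> s) = s [^]\<^bsub>S\<^esub> (p ^ d)"
    using s \<phi>_closed[of "\<iota> s"] by (intro \<iota>_inj) simp_all
qed (rule \<iota>_\<phi>)

text \<open>Here e \<ge> d enters: r^(p^e) is a further power of r^(p^d), which already comes from
  \<open>S\<close>.\<close>

lemma power_in_image:
  assumes r: "r \<in> carrier R" and e: "d \<le> e"
  obtains \<psi> where "\<psi> \<in> carrier S" "r [^]\<^bsub>R\<^esub> (p ^ e) = \<iota> \<psi>"
proof (rule that)
  show "\<phi> r [^]\<^bsub>S\<^esub> (p ^ (e - d)) \<in> carrier S"
    using \<phi>_closed[OF r] by simp
  have "p ^ d * p ^ (e - d) = p ^ e"
    using e by (simp flip: power_add)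
  then show "r [^]\<^bsub>R\<^esub> (p ^ e) = \<iota> (\<phi> r [^]\<^bsub>S\<^esub> (p ^ (e - d)))"
    using r \<phi>_closed[OF r] by (simp add: \<iota>_pow \<iota>_\<phi> R.nat_pow_pow)
qed

lemma comb_scale:
  assumes "a \<in> carrier S" "\<And>k. k < p ^ d \<Longrightarrow> s k \<in> carrier S"
  shows "\<iota> a \<otimes>\<^bsub>R\<^esub> B.comb s = B.comb (\<lambda>k. a \<otimes>\<^bsub>S\<^esub> s k)"
  using assms \<eta> by (intro B.comb_map[of "\<lambda>x. \<iota> a \<otimes>\<^bsub>R\<^esub> x" "\<lambda>_ s. a \<otimes>\<^bsub>S\<^esub> s"]) (simp_all add: R.r_distr R.m_assoc)

lemma coord_scale:
  assumes "a \<in> carrier S" "r \<in> carrier R" "k < p ^ d"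
  shows "B.coord (\<iota> a \<otimes>\<^bsub>R\<^esub> r) k = a \<otimes>\<^bsub>S\<^esub> B.coord r k"
  using assms \<eta> by (intro B.coord_map[of "\<lambda>x. \<iota> a \<otimes>\<^bsub>R\<^esub> x" "\<lambda>_ s. a \<otimes>\<^bsub>S\<^esub> s"]) (simp_all add: R.r_distr R.m_assoc)

lemma p_coord_scale:
  assumes "a \<in> carrier S" "s \<in> carrier S" "i < c"
  shows "D.coord (a [^]\<^bsub>S\<^esub> p \<otimes>\<^bsub>S\<^esub> s) i = a \<otimes>\<^bsub>S\<^esub> D.coord s i"
  using assms v by (intro D.coord_map[of "\<lambda>x. a [^]\<^bsub>S\<^esub> p \<otimes>\<^bsub>S\<^esub> x" "\<lambda>_ s. a \<otimes>\<^bsub>S\<^esub> s"])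
    (simp_all add: S.r_distr S.m_assoc S.nat_pow_distrib)

text \<open>The inclusion of the \<open>i\<close>-th copy and, below, the projection
  \<open>\<pi> i\<close> onto it. Both act separately on each coordinate with respect to the powers
  of \<eta>, by s \<mapsto> s^p v_i and by taking the \<open>i\<close>-th coordinate over the
  \<open>p\<close>-th powers.\<close>

definition \<kappa> :: "nat \<Rightarrow> 'r \<Rightarrow> 'r" where
  "\<kappa> i r = B.comb (\<lambda>k. B.coord r k [^]\<^bsub>S\<^esub> p \<otimes>\<^bsub>S\<^esub> v i)"

definition \<pi> :: "nat \<Rightarrow> 'r \<Rightarrow> 'r" where
  "\<pi> i r = B.comb (\<lambda>k. D.coord (B.coord r k) i)"

lemma \<kappa>_coeff_closed:
  "i < c \<Longrightarrow> r \<in> carrier R \<Longrightarrow> k < p ^ d \<Longrightarrow> B.coord r k [^]\<^bsub>S\<^esub> p \<otimes>\<^bsub>S\<^esub> v i \<in> carrier S"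
  using B.coord_closed[of r k] v[of i] by simp

lemma \<pi>_coeff_closed:
  "i < c \<Longrightarrow> r \<in> carrier R \<Longrightarrow> k < p ^ d \<Longrightarrow> D.coord (B.coord r k) i \<in> carrier S"
  using D.coord_closed[OF B.coord_closed] .

lemma pushforward_scalar:
  assumes \<psi>: "\<psi> \<in> carrier S" "r \<in> carrier R" "r [^]\<^bsub>R\<^esub> (p ^ e) = \<iota> \<psi>"
  shows "r [^]\<^bsub>R\<^esub> (p ^ Suc e) = \<iota> (\<psi> [^]\<^bsub>S\<^esub> p)"
  using assms by (simp add: \<iota>_pow mult.commute[of p] flip: R.nat_pow_pow)

text \<open>A scalar \<open>a\<close> acts on the source through some \<psi> of \<open>S\<close> and
  on the target through \<psi>^p. Multiplication by elements of \<open>S\<close> is coordinatewise,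
  and s \<mapsto> s^p v_i turns the factor \<psi> into \<psi>^p.\<close>

lemma \<kappa>_linear:
  assumes i: "i < c" and e: "d \<le> e"
  shows "linear_map R (frobenius_pushforward p e R) (frobenius_pushforward p (Suc e) R) (\<kappa> i)"
  unfolding linear_map_def frobenius_pushforward_simps
proof (intro conjI ballI)
  fix r assume r: "r \<in> carrier R"
  show "\<kappa> i r \<in> carrier R"
    unfolding \<kappa>_def using \<kappa>_coeff_closed[OF i r] by (rule B.comb_closed)
  fix r' assume r': "r' \<in> carrier R"
  have "\<kappa> i (r \<oplus>\<^bsub>R\<^esub> r') = B.comb (\<lambda>k. B.coord r k [^]\<^bsub>S\<^esub> p \<otimes>\<^bsub>S\<^esub> v i \<oplus>\<^bsub>S\<^esub> B.coord r' k [^]\<^bsub>S\<^esub> p \<otimes>\<^bsub>S\<^esub> v i)"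
    unfolding \<kappa>_def
  proof (rule B.comb_cong)
    fix k assume k: "k < p ^ d"
    show "B.coord (r \<oplus>\<^bsub>R\<^esub> r') k [^]\<^bsub>S\<^esub> p \<otimes>\<^bsub>S\<^esub> v i =
        B.coord r k [^]\<^bsub>S\<^esub> p \<otimes>\<^bsub>S\<^esub> v i \<oplus>\<^bsub>S\<^esub> B.coord r' k [^]\<^bsub>S\<^esub> p \<otimes>\<^bsub>S\<^esub> v i"
      using B.coord_closed[OF r k] B.coord_closed[OF r' k] v[OF i]
      by (simp add: B.coord_add[OF r r' k] S.frob_add S.l_distr)
    show "B.coord r k [^]\<^bsub>S\<^esub> p \<otimes>\<^bsub>S\<^esub> v i \<oplus>\<^bsub>S\<^esub> B.coord r' k [^]\<^bsub>S\<^esub> p \<otimes>\<^bsub>S\<^esub> v i \<in> carrier S"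
      using \<kappa>_coeff_closed[OF i r k] \<kappa>_coeff_closed[OF i r' k] by simp
  qed
  also have "\<dots> = \<kappa> i r \<oplus>\<^bsub>R\<^esub> \<kappa> i r'"
    unfolding \<kappa>_def using \<kappa>_coeff_closed[OF i r] \<kappa>_coeff_closed[OF i r'] by (rule B.comb_add)
  finally show "\<kappa> i (r \<oplus>\<^bsub>R\<^esub> r') = \<kappa> i r \<oplus>\<^bsub>R\<^esub> \<kappa> i r'" .
next
  fix a r assume a: "a \<in> carrier R" and r: "r \<in> carrier R"
  obtain \<psi> where \<psi>: "\<psi> \<in> carrier S" "a [^]\<^bsub>R\<^esub> (p ^ e) = \<iota> \<psi>"
    using power_in_image[OF a e] by blast
  have "\<kappa> i (\<iota> \<psi> \<otimes>\<^bsub>R\<^esub> r) = B.comb (\<lambda>k. \<psi> [^]\<^bsub>S\<^esub> p \<otimes>\<^bsub>S\<^esub> (B.coord r k [^]\<^bsub>S\<^esub> p \<otimes>\<^bsub>S\<^esub> v i))"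
    unfolding \<kappa>_def
  proof (rule B.comb_cong)
    fix k assume k: "k < p ^ d"
    show "B.coord (\<iota> \<psi> \<otimes>\<^bsub>R\<^esub> r) k [^]\<^bsub>S\<^esub> p \<otimes>\<^bsub>S\<^esub> v i = \<psi> [^]\<^bsub>S\<^esub> p \<otimes>\<^bsub>S\<^esub> (B.coord r k [^]\<^bsub>S\<^esub> p \<otimes>\<^bsub>S\<^esub> v i)"
      using B.coord_closed[OF r k] v[OF i] \<psi>(1)
      by (simp add: coord_scale[OF \<psi>(1) r k] S.nat_pow_distrib S.m_assoc)
    show "\<psi> [^]\<^bsub>S\<^esub> p \<otimes>\<^bsub>S\<^esub> (B.coord r k [^]\<^bsub>S\<^esub> p \<otimes>\<^bsub>S\<^esub> v i) \<in> carrier S"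
      using \<kappa>_coeff_closed[OF i r k] \<psi>(1) by simp
  qed
  also have "\<dots> = \<iota> (\<psi> [^]\<^bsub>S\<^esub> p) \<otimes>\<^bsub>R\<^esub> \<kappa> i r"
    unfolding \<kappa>_def using S.nat_pow_closed[OF \<psi>(1)] \<kappa>_coeff_closed[OF i r] by (rule comb_scale[symmetric])
  finally show "\<kappa> i (a [^]\<^bsub>R\<^esub> (p ^ e) \<otimes>\<^bsub>R\<^esub> r) = a [^]\<^bsub>R\<^esub> (p ^ Suc e) \<otimes>\<^bsub>R\<^esub> \<kappa> i r"
    unfolding \<psi>(2) pushforward_scalar[OF \<psi>(1) a \<psi>(2)] .
qed

lemma \<pi>_linear:
  assumes i: "i < c" and e: "d \<le> e"
  shows "linear_map R (frobenius_pushforward p (Suc e) R) (frobenius_pushforward p e R) (\<pi> i)"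
  unfolding linear_map_def frobenius_pushforward_simps
proof (intro conjI ballI)
  fix r assume r: "r \<in> carrier R"
  show "\<pi> i r \<in> carrier R"
    unfolding \<pi>_def using \<pi>_coeff_closed[OF i r] by (rule B.comb_closed)
  fix r' assume r': "r' \<in> carrier R"
  have "\<pi> i (r \<oplus>\<^bsub>R\<^esub> r') = B.comb (\<lambda>k. D.coord (B.coord r k) i \<oplus>\<^bsub>S\<^esub> D.coord (B.coord r' k) i)"
    unfolding \<pi>_def
  proof (rule B.comb_cong)
    fix k assume k: "k < p ^ d"
    show "D.coord (B.coord (r \<oplus>\<^bsub>R\<^esub> r') k) i = D.coord (B.coord r k) i \<oplus>\<^bsub>S\<^esub> D.coord (B.coord r' k) i"
      unfolding B.coord_add[OF r r' k] by (rule D.coord_add[OF B.coord_closed[OF r k] B.coord_closed[OF r' k] i])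
    show "D.coord (B.coord r k) i \<oplus>\<^bsub>S\<^esub> D.coord (B.coord r' k) i \<in> carrier S"
      using \<pi>_coeff_closed[OF i r k] \<pi>_coeff_closed[OF i r' k] by simp
  qed
  also have "\<dots> = \<pi> i r \<oplus>\<^bsub>R\<^esub> \<pi> i r'"
    unfolding \<pi>_def using \<pi>_coeff_closed[OF i r] \<pi>_coeff_closed[OF i r'] by (rule B.comb_add)
  finally show "\<pi> i (r \<oplus>\<^bsub>R\<^esub> r') = \<pi> i r \<oplus>\<^bsub>R\<^esub> \<pi> i r'" .
next
  fix a r assume a: "a \<in> carrier R" and r: "r \<in> carrier R"
  obtain \<psi> where \<psi>: "\<psi> \<in> carrier S" "a [^]\<^bsub>R\<^esub> (p ^ e) = \<iota> \<psi>"
    using power_in_image[OF a e] by blast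
  have "\<pi> i (\<iota> (\<psi> [^]\<^bsub>S\<^esub> p) \<otimes>\<^bsub>R\<^esub> r) = B.comb (\<lambda>k. \<psi> \<otimes>\<^bsub>S\<^esub> D.coord (B.coord r k) i)"
    unfolding \<pi>_def
  proof (rule B.comb_cong)
    fix k assume k: "k < p ^ d"
    show "D.coord (B.coord (\<iota> (\<psi> [^]\<^bsub>S\<^esub> p) \<otimes>\<^bsub>R\<^esub> r) k) i = \<psi> \<otimes>\<^bsub>S\<^esub> D.coord (B.coord r k) i"
      unfolding coord_scale[OF S.nat_pow_closed[OF \<psi>(1)] r k]
      by (rule p_coord_scale[OF \<psi>(1) B.coord_closed[OF r k] i])
    show "\<psi> \<otimes>\<^bsub>S\<^esub> D.coord (B.coord r k) i \<in> carrier S"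
      using \<pi>_coeff_closed[OF i r k] \<psi>(1) by simp
  qed
  also have "\<dots> = \<iota> \<psi> \<otimes>\<^bsub>R\<^esub> \<pi> i r"
    unfolding \<pi>_def using \<psi>(1) \<pi>_coeff_closed[OF i r] by (rule comb_scale[symmetric])
  finally show "\<pi> i (a [^]\<^bsub>R\<^esub> (p ^ Suc e) \<otimes>\<^bsub>R\<^esub> r) = a [^]\<^bsub>R\<^esub> (p ^ e) \<otimes>\<^bsub>R\<^esub> \<pi> i r"
    unfolding \<psi>(2) pushforward_scalar[OF \<psi>(1) a \<psi>(2)] .
qed

lemma comb_coord_cong:
  assumes "r \<in> carrier R" "\<And>k. k < p ^ d \<Longrightarrow> s k = B.coord r k"
  shows "B.comb s = r"
proof -
  have "B.comb s = B.comb (B.coord r)"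
    using assms B.coord_closed by (intro B.comb_cong) auto
  then show ?thesis
    using B.coord_props(2)[OF assms(1)] by simp
qed

lemma \<pi>_\<kappa>:
  assumes i: "i < c" and j: "j < c" and r: "r \<in> carrier R"
  shows "\<pi> i (\<kappa> j r) = (if i = j then r else \<zero>\<^bsub>R\<^esub>)"
proof -
  have co: "D.coord (B.coord (\<kappa> j r) k) i = (if i = j then B.coord r k else \<zero>\<^bsub>S\<^esub>)" if k: "k < p ^ d" for k
  proof -
    have "B.coord (\<kappa> j r) k = B.coord r k [^]\<^bsub>S\<^esub> p \<otimes>\<^bsub>S\<^esub> v j"
      unfolding \<kappa>_def using \<kappa>_coeff_closed[OF j r] k by (rule B.coord_comb)
    then show ?thesis
      using D.coord_m[OF j i B.coord_closed[OF r k]] by simp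
  qed
  show ?thesis
  proof (cases "i = j")
    case True
    then have "\<pi> i (\<kappa> j r) = r"
      unfolding \<pi>_def using co by (intro comb_coord_cong r) simp
    then show ?thesis
      using True by simp
  next
    case False
    have "\<pi> i (\<kappa> j r) = B.comb (\<lambda>k. \<zero>\<^bsub>S\<^esub>)"
      unfolding \<pi>_def using co False by (intro B.comb_cong) simp_all
    also have "\<dots> = \<zero>\<^bsub>R\<^esub>"
      unfolding B.comb_def using \<eta> by (intro R.finsum_zeroI) simp
    finally show ?thesis
      using False by simp
  qed
qed

lemma comb_finsum:
  assumes "finite A" "\<And>a k. a \<in> A \<Longrightarrow> k < p ^ d \<Longrightarrow> s a k \<in> carrier S"
  shows "(\<Oplus>\<^bsub>R\<^esub>a\<in>A. B.comb (s a)) = B.comb (\<lambda>k. \<Oplus>\<^bsub>S\<^esub>a\<in>A. s a k)"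
  using assms
proof (induction A rule: finite_induct)
  case empty
  have "B.comb (\<lambda>k. \<zero>\<^bsub>S\<^esub>) = \<zero>\<^bsub>R\<^esub>"
    unfolding B.comb_def using \<eta> by (intro R.finsum_zeroI) simp
  then show ?case
    by simp
next
  case (insert x A)
  have c: "s x k \<in> carrier S" "(\<lambda>a. s a k) \<in> A \<rightarrow> carrier S" if "k < p ^ d" for k
    using insert.prems that by auto
  have "(\<Oplus>\<^bsub>R\<^esub>a\<in>insert x A. B.comb (s a)) = B.comb (s x) \<oplus>\<^bsub>R\<^esub> (\<Oplus>\<^bsub>R\<^esub>a\<in>A. B.comb (s a))"
    using insert.hyps insert.prems by (intro R.finsum_insert) (auto intro!: B.comb_closed)
  also have "\<dots> = B.comb (s x) \<oplus>\<^bsub>R\<^esub> B.comb (\<lambda>k. \<Oplus>\<^bsub>S\<^esub>a\<in>A. s a k)"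
    using insert.IH insert.prems by simp
  also have "\<dots> = B.comb (\<lambda>k. s x k \<oplus>\<^bsub>S\<^esub> (\<Oplus>\<^bsub>S\<^esub>a\<in>A. s a k))"
    using c S.finsum_closed by (intro B.comb_add[symmetric]) auto
  also have "\<dots> = B.comb (\<lambda>k. \<Oplus>\<^bsub>S\<^esub>a\<in>insert x A. s a k)"
    using c insert.hyps S.finsum_closed by (intro B.comb_cong) auto
  finally show ?case .
qed

lemma \<kappa>_\<pi>:
  assumes r: "r \<in> carrier R"
  shows "(\<Oplus>\<^bsub>R\<^esub>i\<in>{..<c}. \<kappa> i (\<pi> i r)) = r"
proof -
  have \<pi>r: "\<pi> i r \<in> carrier R" if "i < c" for i
    unfolding \<pi>_def using \<pi>_coeff_closed[OF that r] by (rule B.comb_closed)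
  have "(\<Oplus>\<^bsub>R\<^esub>i\<in>{..<c}. \<kappa> i (\<pi> i r)) =
      B.comb (\<lambda>k. \<Oplus>\<^bsub>S\<^esub>i\<in>{..<c}. B.coord (\<pi> i r) k [^]\<^bsub>S\<^esub> p \<otimes>\<^bsub>S\<^esub> v i)"
    unfolding \<kappa>_def using \<kappa>_coeff_closed \<pi>r by (intro comb_finsum) auto
  also have "\<dots> = r"
  proof (rule comb_coord_cong[OF r])
    fix k assume k: "k < p ^ d"
    have "B.coord (\<pi> i r) k = D.coord (B.coord r k) i" if "i < c" for i
      unfolding \<pi>_def using \<pi>_coeff_closed[OF that r] k by (rule B.coord_comb)
    then have "(\<Oplus>\<^bsub>S\<^esub>i\<in>{..<c}. B.coord (\<pi> i r) k [^]\<^bsub>S\<^esub> p \<otimes>\<^bsub>S\<^esub> v i) = D.comb (D.coord (B.coord r k))"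
      unfolding D.comb_def using \<pi>_coeff_closed[OF _ r k] v by (intro S.finsum_cong') auto
    also have "\<dots> = B.coord r k"
      using B.coord_closed[OF r k] by (rule D.coord_props(2))
    finally show "(\<Oplus>\<^bsub>S\<^esub>i\<in>{..<c}. B.coord (\<pi> i r) k [^]\<^bsub>S\<^esub> p \<otimes>\<^bsub>S\<^esub> v i) = B.coord r k" .
  qed
  finally show ?thesis .
qed

text \<open>Raising an expansion with exponent p^e to the power \<open>p\<close> and inserting it
  into the expansion over the \<open>v i\<close> gives one with exponent p^(e+1). The new generators
  are the products of \<open>p\<close>-th powers of old ones with the \<open>v i\<close>. Spanning
  suffices for the rank bound below.\<close>

lemma frobenius_generators:
  "\<exists>(N::nat) g. (\<forall>i<N. g i \<in> carrier S) \<and> (\<forall>s\<in>carrier S. \<exists>\<tau>. (\<forall>i<N. \<tau> i \<in> carrier S) \<and>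
    s = (\<Oplus>\<^bsub>S\<^esub>i\<in>{..<N}. \<tau> i [^]\<^bsub>S\<^esub> (p ^ e) \<otimes>\<^bsub>S\<^esub> g i))"
proof (induction e)
  case 0
  show ?case
  proof (rule exI[where x = "Suc 0"], rule exI[where x = "\<lambda>_. \<one>\<^bsub>S\<^esub>"], rule conjI)
    show "\<forall>s\<in>carrier S. \<exists>\<tau>. (\<forall>i<Suc 0. \<tau> i \<in> carrier S) \<and>
        s = (\<Oplus>\<^bsub>S\<^esub>i\<in>{..<Suc 0}. \<tau> i [^]\<^bsub>S\<^esub> (p ^ 0) \<otimes>\<^bsub>S\<^esub> \<one>\<^bsub>S\<^esub>)"
    proof
      fix s assume "s \<in> carrier S"
      then show "\<exists>\<tau>. (\<forall>i<Suc 0. \<tau> i \<in> carrier S) \<and>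
          s = (\<Oplus>\<^bsub>S\<^esub>i\<in>{..<Suc 0}. \<tau> i [^]\<^bsub>S\<^esub> (p ^ 0) \<otimes>\<^bsub>S\<^esub> \<one>\<^bsub>S\<^esub>)"
        by (intro exI[where x = "\<lambda>_. s"]) (simp add: lessThan_Suc)
    qed
  qed simp
next
  case (Suc e)
  then obtain N :: nat and g where g: "\<forall>i<N. g i \<in> carrier S"
    and gen: "\<forall>s\<in>carrier S. \<exists>\<tau>. (\<forall>i<N. \<tau> i \<in> carrier S) \<and> s = (\<Oplus>\<^bsub>S\<^esub>i\<in>{..<N}. \<tau> i [^]\<^bsub>S\<^esub> (p ^ e) \<otimes>\<^bsub>S\<^esub> g i)"
    by blast
  obtain \<tau> where \<tau>: "\<forall>s\<in>carrier S. (\<forall>i<N. \<tau> s i \<in> carrier S) \<and> s = (\<Oplus>\<^bsub>S\<^esub>i\<in>{..<N}. \<tau> s i [^]\<^bsub>S\<^esub> (p ^ e) \<otimes>\<^bsub>S\<^esub> g i)"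
    using gen by (rule bchoice[THEN exE])
  obtain hh where "bij_betw hh {0..<card ({..<c} \<times> {..<N})} ({..<c} \<times> {..<N})"
    using ex_bij_betw_nat_finite[of "{..<c} \<times> {..<N}"] by auto
  then have hh: "bij_betw hh {..<c * N} ({..<c} \<times> {..<N})"
    by (simp add: atLeast0LessThan card_cartesian_product)
  define g' where "g' x = g (snd x) [^]\<^bsub>S\<^esub> p \<otimes>\<^bsub>S\<^esub> v (fst x)" for x
  have g': "g' x \<in> carrier S" if "x \<in> {..<c} \<times> {..<N}" for x
    using g v that by (auto simp: g'_def)
  have hx: "hh i \<in> {..<c} \<times> {..<N}" if "i < c * N" for i
    using bij_betwE[OF hh] that by simp
  have gen': "\<exists>\<tau>'. (\<forall>i<c * N. \<tau>' i \<in> carrier S) \<and> s = (\<Oplus>\<^bsub>S\<^esub>i\<in>{..<c * N}. \<tau>' i [^]\<^bsub>S\<^esub> (p ^ Suc e) \<otimes>\<^bsub>S\<^esub> g' (hh i))"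
    if s: "s \<in> carrier S" for s
  proof -
    \<comment> \<open>Coefficients of the two nested expansions, indexed by pairs: the
      \<open>fst x\<close>-th coordinate of \<open>s\<close> is expanded over the old
      generators.\<close>
    define \<sigma> where "\<sigma> x = \<tau> (D.coord s (fst x)) (snd x)" for x
    have Dc: "D.coord s i \<in> carrier S" if "i < c" for i
      using D.coord_closed[OF s that] .
    have \<sigma>: "\<sigma> x \<in> carrier S" if "x \<in> {..<c} \<times> {..<N}" for x
      using \<tau> Dc that by (auto simp: \<sigma>_def)
    have "s = D.comb (D.coord s)"
      using D.coord_props(2)[OF s] by simp
    also have "\<dots> = (\<Oplus>\<^bsub>S\<^esub>i\<in>{..<c}. \<Oplus>\<^bsub>S\<^esub>k\<in>{..<N}. \<sigma> (i, k) [^]\<^bsub>S\<^esub> (p ^ Suc e) \<otimes>\<^bsub>S\<^esub> g' (i, k))"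
      unfolding D.comb_def
    proof (rule S.finsum_cong')
      fix i assume "i \<in> {..<c}"
      then have i: "i < c"
        by simp
      have \<sigma>i: "\<sigma> (i, k) \<in> carrier S" "g k \<in> carrier S" if "k < N" for k
        using \<sigma>[of "(i, k)"] g i that by auto
      have "D.coord s i = (\<Oplus>\<^bsub>S\<^esub>k\<in>{..<N}. \<sigma> (i, k) [^]\<^bsub>S\<^esub> (p ^ e) \<otimes>\<^bsub>S\<^esub> g k)"
        using \<tau> Dc[OF i] by (simp add: \<sigma>_def)
      then have "D.coord s i [^]\<^bsub>S\<^esub> p = (\<Oplus>\<^bsub>S\<^esub>k\<in>{..<N}. \<sigma> (i, k) [^]\<^bsub>S\<^esub> (p ^ e) \<otimes>\<^bsub>S\<^esub> g k) [^]\<^bsub>S\<^esub> (p ^ 1)"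
        by simp
      also have "\<dots> = (\<Oplus>\<^bsub>S\<^esub>k\<in>{..<N}. (\<sigma> (i, k) [^]\<^bsub>S\<^esub> (p ^ e) \<otimes>\<^bsub>S\<^esub> g k) [^]\<^bsub>S\<^esub> (p ^ 1))"
        using \<sigma>i by (intro S.frob_finsum) auto
      finally have "D.coord s i [^]\<^bsub>S\<^esub> p \<otimes>\<^bsub>S\<^esub> v i = (\<Oplus>\<^bsub>S\<^esub>k\<in>{..<N}. (\<sigma> (i, k) [^]\<^bsub>S\<^esub> (p ^ e) \<otimes>\<^bsub>S\<^esub> g k) [^]\<^bsub>S\<^esub> p \<otimes>\<^bsub>S\<^esub> v i)"
        using \<sigma>i v[OF i] by (simp add: S.finsum_ldistr Pi_iff)
      also have "\<dots> = (\<Oplus>\<^bsub>S\<^esub>k\<in>{..<N}. \<sigma> (i, k) [^]\<^bsub>S\<^esub> (p ^ Suc e) \<otimes>\<^bsub>S\<^esub> g' (i, k))"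
      proof (rule S.finsum_cong')
        fix k assume "k \<in> {..<N}"
        then have "\<sigma> (i, k) \<in> carrier S" "g k \<in> carrier S" "v i \<in> carrier S"
          using \<sigma>i v[OF i] by simp_all
        then show "(\<sigma> (i, k) [^]\<^bsub>S\<^esub> (p ^ e) \<otimes>\<^bsub>S\<^esub> g k) [^]\<^bsub>S\<^esub> p \<otimes>\<^bsub>S\<^esub> v i = \<sigma> (i, k) [^]\<^bsub>S\<^esub> (p ^ Suc e) \<otimes>\<^bsub>S\<^esub> g' (i, k)"
          by (simp add: g'_def S.nat_pow_distrib S.nat_pow_pow S.m_assoc mult.commute[of p])
      next
        show "(\<lambda>k. \<sigma> (i, k) [^]\<^bsub>S\<^esub> (p ^ Suc e) \<otimes>\<^bsub>S\<^esub> g' (i, k)) \<in> {..<N} \<rightarrow> carrier S"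
          using \<sigma>i g'[of "(i, _)"] i by (intro Pi_I) simp
      qed simp
      finally show "D.coord s i [^]\<^bsub>S\<^esub> p \<otimes>\<^bsub>S\<^esub> v i = (\<Oplus>\<^bsub>S\<^esub>k\<in>{..<N}. \<sigma> (i, k) [^]\<^bsub>S\<^esub> (p ^ Suc e) \<otimes>\<^bsub>S\<^esub> g' (i, k))" .
    next
      show "(\<lambda>i. \<Oplus>\<^bsub>S\<^esub>k\<in>{..<N}. \<sigma> (i, k) [^]\<^bsub>S\<^esub> (p ^ Suc e) \<otimes>\<^bsub>S\<^esub> g' (i, k)) \<in> {..<c} \<rightarrow> carrier S"
        using \<sigma> g' by (intro Pi_I S.finsum_closed) auto
    qed simp
    also have "\<dots> = (\<Oplus>\<^bsub>S\<^esub>x\<in>{..<c} \<times> {..<N}. \<sigma> (fst x, snd x) [^]\<^bsub>S\<^esub> (p ^ Suc e) \<otimes>\<^bsub>S\<^esub> g' (fst x, snd x))"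
      using \<sigma> g' by (intro S.finsum_Sigma) auto
    also have "\<dots> = (\<Oplus>\<^bsub>S\<^esub>x\<in>{..<c} \<times> {..<N}. \<sigma> x [^]\<^bsub>S\<^esub> (p ^ Suc e) \<otimes>\<^bsub>S\<^esub> g' x)"
      by simp
    also have "\<dots> = (\<Oplus>\<^bsub>S\<^esub>i\<in>{..<c * N}. \<sigma> (hh i) [^]\<^bsub>S\<^esub> (p ^ Suc e) \<otimes>\<^bsub>S\<^esub> g' (hh i))"
      using \<sigma> g' by (intro S.finsum_bij[OF hh, symmetric]) simp
    finally show ?thesis
      using \<sigma> hx by (intro exI[of _ "\<lambda>i. \<sigma> (hh i)"]) simp
  qed
  show ?case
  proof (rule exI[where x = "c * N"], rule exI[where x = "\<lambda>i. g' (hh i)"], rule conjI)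
    show "\<forall>i<c * N. g' (hh i) \<in> carrier S"
      using g' hx by blast
  qed (use gen' in blast)
qed

text \<open>The images of the generators of \<open>S\<close> times the powers of \<eta> generate the
  \<open>d\<close>-th pushforward over \<open>R\<close>, because scalars from \<open>S\<close>
  already act by their p^d-th powers. The ranks of its free summands are therefore bounded.\<close>

lemma free_rank_bounded: "\<exists>b. \<forall>r. has_free_summand R (frobenius_pushforward p d R) r \<longrightarrow> r \<le> b"
proof -
  obtain N :: nat and g where g: "\<forall>i<N. g i \<in> carrier S"
    and gen: "\<forall>s\<in>carrier S. \<exists>\<tau>. (\<forall>i<N. \<tau> i \<in> carrier S) \<and> s = (\<Oplus>\<^bsub>S\<^esub>i\<in>{..<N}. \<tau> i [^]\<^bsub>S\<^esub> (p ^ d) \<otimes>\<^bsub>S\<^esub> g i)"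
    using frobenius_generators[of d] by blast
  obtain \<tau> where \<tau>: "\<forall>s\<in>carrier S. (\<forall>i<N. \<tau> s i \<in> carrier S) \<and> s = (\<Oplus>\<^bsub>S\<^esub>i\<in>{..<N}. \<tau> s i [^]\<^bsub>S\<^esub> (p ^ d) \<otimes>\<^bsub>S\<^esub> g i)"
    using gen by (rule bchoice[THEN exE])
  let ?J = "{..<p ^ d} \<times> {..<N}"
  let ?F = "frobenius_pushforward p d R"
  define G where "G x = \<iota> (g (snd x)) \<otimes>\<^bsub>R\<^esub> \<eta> [^]\<^bsub>R\<^esub> fst x" for x :: "nat \<times> nat"
  have G: "G x \<in> carrier R" if "x \<in> ?J" for x
    using g that \<eta> by (auto simp: G_def)
  have span: "\<exists>a \<in> ?J \<rightarrow> carrier R. r = (\<Oplus>\<^bsub>?F\<^esub>x\<in>?J. a x \<odot>\<^bsub>?F\<^esub> G x)" if "r \<in> carrier ?F" for r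
  proof -
    have r: "r \<in> carrier R"
      using that by simp
    have Bc: "B.coord r k \<in> carrier S" if "k < p ^ d" for k
      using B.coord_closed[OF r that] .
    define a where "a x = \<iota> (\<tau> (B.coord r (fst x)) (snd x))" for x
    have a: "a x \<in> carrier R" if "x \<in> ?J" for x
      using \<tau> Bc that by (auto simp: a_def)
    have "r = B.comb (B.coord r)"
      using B.coord_props(2)[OF r] by simp
    also have "\<dots> = (\<Oplus>\<^bsub>R\<^esub>k\<in>{..<p ^ d}. \<Oplus>\<^bsub>R\<^esub>i\<in>{..<N}. a (k, i) [^]\<^bsub>R\<^esub> (p ^ d) \<otimes>\<^bsub>R\<^esub> G (k, i))"
      unfolding B.comb_def
    proof (rule R.finsum_cong')
      fix k assume "k \<in> {..<p ^ d}"
      then have k: "k < p ^ d"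
        by simp
      let ?t = "\<tau> (B.coord r k)"
      have t: "?t i \<in> carrier S" "g i \<in> carrier S" if "i < N" for i
        using \<tau> Bc[OF k] g that by auto
      have "B.coord r k = (\<Oplus>\<^bsub>S\<^esub>i\<in>{..<N}. ?t i [^]\<^bsub>S\<^esub> (p ^ d) \<otimes>\<^bsub>S\<^esub> g i)"
        using \<tau> Bc[OF k] by simp
      then have "\<iota> (B.coord r k) = \<iota> (\<Oplus>\<^bsub>S\<^esub>i\<in>{..<N}. ?t i [^]\<^bsub>S\<^esub> (p ^ d) \<otimes>\<^bsub>S\<^esub> g i)"
        by (rule arg_cong)
      also have "\<dots> = (\<Oplus>\<^bsub>R\<^esub>i\<in>{..<N}. \<iota> (?t i [^]\<^bsub>S\<^esub> (p ^ d) \<otimes>\<^bsub>S\<^esub> g i))"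
        using t by (subst \<iota>.hom_finsum) (auto simp: comp_def)
      finally have "\<iota> (B.coord r k) \<otimes>\<^bsub>R\<^esub> \<eta> [^]\<^bsub>R\<^esub> k = (\<Oplus>\<^bsub>R\<^esub>i\<in>{..<N}. \<iota> (?t i [^]\<^bsub>S\<^esub> (p ^ d) \<otimes>\<^bsub>S\<^esub> g i) \<otimes>\<^bsub>R\<^esub> \<eta> [^]\<^bsub>R\<^esub> k)"
        using t \<eta> by (simp add: R.finsum_ldistr Pi_iff)
      also have "\<dots> = (\<Oplus>\<^bsub>R\<^esub>i\<in>{..<N}. a (k, i) [^]\<^bsub>R\<^esub> (p ^ d) \<otimes>\<^bsub>R\<^esub> G (k, i))"
      proof (rule R.finsum_cong')
        fix i assume "i \<in> {..<N}"
        then have "?t i \<in> carrier S" "g i \<in> carrier S"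
          using t by simp_all
        then show "\<iota> (?t i [^]\<^bsub>S\<^esub> (p ^ d) \<otimes>\<^bsub>S\<^esub> g i) \<otimes>\<^bsub>R\<^esub> \<eta> [^]\<^bsub>R\<^esub> k = a (k, i) [^]\<^bsub>R\<^esub> (p ^ d) \<otimes>\<^bsub>R\<^esub> G (k, i)"
          using \<eta> by (simp add: a_def G_def \<iota>_pow R.m_assoc)
      next
        show "(\<lambda>i. a (k, i) [^]\<^bsub>R\<^esub> (p ^ d) \<otimes>\<^bsub>R\<^esub> G (k, i)) \<in> {..<N} \<rightarrow> carrier R"
          using a[of "(k, _)"] G[of "(k, _)"] k by (intro Pi_I) simp
      qed simp
      finally show "\<iota> (B.coord r k) \<otimes>\<^bsub>R\<^esub> \<eta> [^]\<^bsub>R\<^esub> k = (\<Oplus>\<^bsub>R\<^esub>i\<in>{..<N}. a (k, i) [^]\<^bsub>R\<^esub> (p ^ d) \<otimes>\<^bsub>R\<^esub> G (k, i))" .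
    next
      show "(\<lambda>k. \<Oplus>\<^bsub>R\<^esub>i\<in>{..<N}. a (k, i) [^]\<^bsub>R\<^esub> (p ^ d) \<otimes>\<^bsub>R\<^esub> G (k, i)) \<in> {..<p ^ d} \<rightarrow> carrier R"
        using a G by (intro Pi_I R.finsum_closed) auto
    qed simp
    also have "\<dots> = (\<Oplus>\<^bsub>R\<^esub>x\<in>?J. a (fst x, snd x) [^]\<^bsub>R\<^esub> (p ^ d) \<otimes>\<^bsub>R\<^esub> G (fst x, snd x))"
      using a G by (intro R.finsum_Sigma) auto
    finally show ?thesis
      using a by (intro bexI[of _ a]) auto
  qed
  have "r \<le> card ?J" if "has_free_summand R ?F r" for r
  proof -
    obtain w \<psi> where "dual_system R ?F r w \<psi>"
      using has_free_summand_iff[OF RC.frobenius_pushforward_module, of d r] \<open>has_free_summand R ?F r\<close> by blast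
    then show ?thesis
      using span G by (intro dual_system_le_generators[OF RC.frobenius_pushforward_module I, of ?J G]) auto
  qed
  then show ?thesis
    by blast
qed

text \<open>The induction carries the boundedness of ranks along, since comparing greatest ranks at
  one step presupposes it at that step.\<close>

lemma max_free_rank_pushforward:
  "max_free_rank (frobenius_pushforward p (d + k) R) R = c ^ k * max_free_rank (frobenius_pushforward p d R) R"
proof -
  let ?F = "\<lambda>k. frobenius_pushforward p (d + k) R"
  have "(\<exists>b. \<forall>r. has_free_summand R (?F k) r \<longrightarrow> r \<le> b) \<and>
      max_free_rank (?F k) R = c ^ k * max_free_rank (?F 0) R" for k
  proof (induction k)
    case 0
    then show ?case
      using free_rank_bounded by simp
  next
    case (Suc k)
    then obtain b where b: "\<And>r. has_free_summand R (?F k) r \<Longrightarrow> r \<le> b"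
      by blast
    have M: "module R (?F k)" "module R (frobenius_pushforward p (Suc (d + k)) R)"
      by (rule RC.frobenius_pushforward_module)+
    have lin: "linear_map R (frobenius_pushforward p (Suc (d + k)) R) (?F k) (\<pi> i)"
      "linear_map R (?F k) (frobenius_pushforward p (Suc (d + k)) R) (\<kappa> i)" if "i < c" for i
      using \<pi>_linear[OF that] \<kappa>_linear[OF that] by simp_all
    have id1: "\<pi> i (\<kappa> j r) = (if i = j then r else \<zero>\<^bsub>?F k\<^esub>)" if "i < c" "j < c" "r \<in> carrier (?F k)" for i j r
      using \<pi>_\<kappa>[OF that(1,2)] that(3) by simp
    have id2: "(\<Oplus>\<^bsub>frobenius_pushforward p (Suc (d + k)) R\<^esub>i\<in>{..<c}. \<kappa> i (\<pi> i r)) = r"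
      if "r \<in> carrier (frobenius_pushforward p (Suc (d + k)) R)" for r
      using \<kappa>_\<pi> that by simp
    from max_free_rank_copies[OF M I local b lin id1 id2]
    show ?case
      using Suc by simp
  qed
  then show ?thesis
    by simp
qed

end

section \<open>The F-signature of the hypersurface ring\<close>

theorem proposition6p15:
  fixes K :: "('k, 'z) ring_scheme"
    and p b n d :: nat
    and S :: "((nat \<Rightarrow> nat) \<Rightarrow> 'k) ring"
    and \<mm> :: "((nat \<Rightarrow> nat) \<Rightarrow> 'k) set"
    and f :: "(nat \<Rightarrow> nat) \<Rightarrow> 'k"
    and T :: "((unit \<Rightarrow> nat) \<Rightarrow> (nat \<Rightarrow> nat) \<Rightarrow> 'k) ring"
    and y :: "(unit \<Rightarrow> nat) \<Rightarrow> (nat \<Rightarrow> nat) \<Rightarrow> 'k"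
    and \<RR> :: "((unit \<Rightarrow> nat) \<Rightarrow> (nat \<Rightarrow> nat) \<Rightarrow> 'k) set ring"
  assumes "field K"
    and "Factorial_Ring.prime p"
    and "[p] \<cdot>\<^bsub>K\<^esub> \<one>\<^bsub>K\<^esub> = \<zero>\<^bsub>K\<^esub>"
    and "ring.dimension K b (pth_powers p K) (carrier K)"
    and "S = power_series_ring {1..n} K"
    and "maximalideal \<mm> S"
    and "f \<in> \<mm>"
    and "f \<noteq> \<zero>\<^bsub>S\<^esub>"
    and "d > 0"
    and "T = power_series_ring {()} S"
    and "y = ps_var {()} S ()"
    and "\<RR> = T Quot (PIdl\<^bsub>T\<^esub> (y [^]\<^bsub>T\<^esub> (p ^ d) \<oplus>\<^bsub>T\<^esub> ps_const {()} S f))"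
  shows "convergent (F_signature_seq p \<RR>) \<and>
    F_signature p \<RR> =
      real (max_free_rank (frobenius_pushforward p d \<RR>) \<RR>) / (real b ^ d * real p ^ (n * d))"
proof -
  interpret K: field K
    by fact
  have char: "char_cring K p"
    using assms(2,3) by (intro char_cring.intro char_cring_axioms.intro K.is_cring)
  interpret char_power_series K "{1..n}" p
    using char by (intro char_power_series.intro power_series.intro power_series_axioms.intro K.is_cring) simp_all
  have S: "S = P"
    by (rule assms(5))
  interpret mm: maximalideal \<mm> P
    using assms(6) unfolding S .
  have f: "f \<in> carrier P"
    using assms(7) by (rule mm.Icarr)
  \<comment> \<open>A series with nonzero constant term over a field is a unit and cannot lie in the
    proper ideal \<open>\<mm>\<close>.\<close>
  have f0: "f ezero = \<zero>\<^bsub>K\<^esub>"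
  proof (rule ccontr)
    assume "f ezero \<noteq> \<zero>\<^bsub>K\<^esub>"
    then have "f \<in> Units P"
      using coeff_closed[OF f exponents_zero] by (intro series_Units[OF f]) (simp add: K.field_Units)
    then show False
      using mm.unit_imp_carrier[OF assms(7)] mm.I_notcarr by simp
  qed
  have p: "p > 1"
    using assms(2) by (rule prime_gt_1_nat)
  interpret H: hypersurface K "{1..n}" f "p ^ d"
    using f f0 p by (intro hypersurface.intro hypersurface_axioms.intro power_series_axioms) simp_all
  have R: "\<RR> = H.Q"
    unfolding assms(10-12) S H.Q_def H.g_def H.y_def ..
  obtain u where u: "\<And>i. i < b \<Longrightarrow> u i \<in> carrier K" "additive_basis K K b (\<lambda>i s. s [^]\<^bsub>K\<^esub> p \<otimes>\<^bsub>K\<^esub> u i)"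
    using K.frobenius_basis[OF char assms(4)] by blast
  obtain v where v: "\<And>i. i < b * p ^ card {1..n} \<Longrightarrow> v i \<in> carrier P"
    "additive_basis P P (b * p ^ card {1..n}) (\<lambda>i s. s [^]\<^bsub>P\<^esub> p \<otimes>\<^bsub>P\<^esub> v i)"
    using frobenius_basis_series[OF u] by blast
  have mf: "\<ominus>\<^bsub>P\<^esub> f \<in> carrier P"
    using f by (rule P.a_inv_closed)
  define c where "c = b * p ^ n"
  \<comment> \<open>The kernel of the residue map, written as the preimage of the zero ideal of
    \<open>K\<close> so that its primality follows from \<open>primeideal_vimage\<close>.\<close>
  define J where "J = {r \<in> carrier H.Q. H.\<chi> r \<in> {\<zero>\<^bsub>K\<^esub>}}"
  have J: "primeideal J H.Q"
    unfolding J_def by (rule primeideal_vimage[OF H.Q.is_cring K.is_cring H.\<chi>_hom K.zeroprimeideal])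
  interpret X: radical_extension P H.Q p H.\<iota> H.\<eta> "\<ominus>\<^bsub>P\<^esub> f" d c v J
  proof (intro radical_extension.intro radical_extension_axioms.intro)
    show "\<eta> \<in> Units H.Q" if "\<eta> \<in> carrier H.Q" "\<eta> \<notin> J" for \<eta>
      using that H.\<chi>_unit[OF assms(1)] by (simp add: J_def)
  qed (use mf v J H.\<iota>_hom H.\<eta>_closed H.\<eta>_pow H.basis PC.char_cring_axioms H.Q.is_cring in \<open>simp_all add: c_def\<close>)
  have dim: "krull_dim \<RR> = enat n"
    unfolding R X.krull_dim_extension using krull_dim_power_series[OF assms(1), of "{1..n}"] by simp
  have deg: "residue_log_degree p \<RR> = log (real p) (real b)"
    unfolding R using H.\<chi>_unit[OF assms(1)] assms(4)
    by (intro residue_log_degree_eq[OF H.Q.is_cring assms(1) H.\<chi>_hom H.\<chi>_surj] K.pth_powers_subfield[OF char])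
  \<comment> \<open>Positivity of \<open>b\<close> is what makes \<open>p powr log p b\<close> equal
    to \<open>b\<close> and allows powers of \<open>c\<close> to be cancelled.\<close>
  have b: "b > 0"
  proof (rule ccontr)
    assume "\<not> b > 0"
    then have "carrier K = {\<zero>\<^bsub>K\<^esub>}"
      using K.dimension_zero[of "pth_powers p K" "carrier K"] K.pth_powers_subfield[OF char] assms(4) by simp
    then show False
      using K.one_closed K.one_not_zero by blast
  qed
  define M where "M = max_free_rank (frobenius_pushforward p d \<RR>) \<RR>"
  have "F_signature_seq p \<RR> e = real M / (real b ^ d * real p ^ (n * d))" if "d \<le> e" for e
  proof -
    \<comment> \<open>The exponent of the normalization is real, so it is evaluated through p^(n +
      log_p b) = p^n b = c before taking the \<open>e\<close>-th power.\<close>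
    have "real p powr (real e * (real n + log (real p) (real b))) =
        (real p powr real n * real p powr log (real p) (real b)) powr real e"
      using p by (simp add: powr_powr mult.commute flip: powr_add)
    also have "\<dots> = real c ^ e"
      using p b by (simp add: powr_realpow c_def mult.commute)
    finally have den: "real p powr (real e * (real n + log (real p) (real b))) = real c ^ e" .
    have "max_free_rank (frobenius_pushforward p e \<RR>) \<RR> = c ^ (e - d) * M"
      using X.max_free_rank_pushforward[of "e - d"] that by (simp add: M_def R)
    then have "F_signature_seq p \<RR> e = real c ^ (e - d) * real M / real c ^ e"
      by (simp add: F_signature_seq_def dim deg den)
    also have "real c ^ e = real c ^ (e - d) * real c ^ d"
      using that by (simp flip: power_add)
    also have "real c ^ (e - d) * real M / (real c ^ (e - d) * real c ^ d) = real M / real c ^ d"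
      using b p by (simp add: c_def)
    also have "real c ^ d = real b ^ d * real p ^ (n * d)"
      by (simp add: c_def power_mult_distrib power_mult)
    finally show ?thesis .
  qed
  \<comment> \<open>The values before index \<open>d\<close> do not affect the limit, so constancy
    from \<open>d\<close> on gives convergence as well as the value.\<close>
  then have "\<forall>\<^sub>F e in sequentially. F_signature_seq p \<RR> e = real M / (real b ^ d * real p ^ (n * d))"
    by (rule eventually_sequentiallyI)
  then have "F_signature_seq p \<RR> \<longlonglongrightarrow> real M / (real b ^ d * real p ^ (n * d))"
    by (rule tendsto_eventually)
  then show ?thesis
    unfolding F_signature_def M_def[symmetric] by (auto intro: convergentI limI)
qed

end
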